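(* Let $0\le\delta\le\frac12$. Consider the i.i.d. two-vertex model on $\mathbb{Z}^2$ where $b_2=b_4=r_2=r_4=\frac14$, $b_1=.3$, $b_3=.2$, $r_1=\delta$, and $r_3=\frac12-\delta$. For every $\varepsilon>0$, there exists a $p^*\in(0,1)$ such that whenever $p\in(p^*,1)$, the almost-sure limiting speed $\lim_{n\to\infty}\frac{X_n\cdot e_1}{n}$ (exists and) is at least $0.1-\varepsilon$.
   Context: Two-vertex model on $\mathbb{Z}^2$: let $e_1,e_2,e_3,e_4$ denote respectively the right, up, left and down axis unit vectors of $\mathbb{Z}^2$ (so $e_3=-e_1$, $e_4=-e_2$). Given $p\in(0,1)$ and two probability vectors $(b_1,b_2,b_3,b_4)$ and $(r_1,r_2,r_3,r_4)$, each site of $\mathbb{Z}^2$ is, independently, blue with probability $p$ and red with probability $1-p$. Given the colors, $(X_n)_{n\ge 0}$ is the Markov chain on $\mathbb{Z}^2$ started at $X_0=0$ that steps in direction $e_i$ from a blue site with probability $b_i$ and from a red site with probability $r_i$. (Here zero entries in the red vector are allowed.) "Almost sure" refers to the annealed law $\mathbb{P}^0$, i.e. the joint law of the random coloring and the walk. *)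

theory Defs
  imports "HOL-Probability.Probability"
begin

datatype color = Blue | Red

definition axis_unit :: "nat \<Rightarrow> int \<times> int" where
  "axis_unit i = [(1, 0), (0, 1), (-1, 0), (0, -1)] ! (i - 1)"

text \<open>Probability vectors are functions on the indices \<open>1, \<dots>, 4\<close>; other indices are irrelevant.\<close>

definition step_pmf :: "(nat \<Rightarrow> real) \<Rightarrow> (int \<times> int) pmf" where
  "step_pmf w = pmf_of_list [(axis_unit i, w i). i \<leftarrow> [1, 2, 3, 4]]"

lemma pmf_step_pmf:
  assumes "\<And>i. i \<in> {1..4} \<Longrightarrow> 0 \<le> w i" and "(\<Sum>i=1..4. w i) = 1" and "i \<in> {1..4}"
  shows "pmf (step_pmf w) (axis_unit i) = w i"
proof -
  have I: "{1..4} = {1, 2, 3, 4::nat}"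
    by auto
  have "pmf_of_list_wf [(axis_unit i, w i). i \<leftarrow> [1, 2, 3, 4]]"
    using assms(1)[of 1] assms(1)[of 2] assms(1)[of 3] assms(1)[of 4] assms(2)
    unfolding I by (intro pmf_of_list_wfI) (auto simp: add.assoc)
  moreover from assms(3) have "i = 1 \<or> i = 2 \<or> i = 3 \<or> i = 4"
    unfolding I by simp
  ultimately show ?thesis
    unfolding step_pmf_def by (auto simp: pmf_pmf_of_list axis_unit_def)
qed

definition coloring_law :: "real \<Rightarrow> (int \<times> int \<Rightarrow> color) measure" where
  "coloring_law p =
     (\<Pi>\<^sub>M x\<in>UNIV. measure_pmf (map_pmf (\<lambda>t. if t then Blue else Red) (bernoulli_pmf p)))"

text \<open>The conditional law of \<open>X\<^sub>n\<close> given the coloring and \<open>X\<^sub>0, \<dots>, X\<^sub>n\<^sub>-\<^sub>1\<close>.\<close>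

primrec transition ::
  "(nat \<Rightarrow> real) \<Rightarrow> (nat \<Rightarrow> real) \<Rightarrow> (int \<times> int \<Rightarrow> color) \<Rightarrow> nat \<Rightarrow> (nat \<Rightarrow> int \<times> int) \<Rightarrow> (int \<times> int) pmf"
where
  "transition b r c 0 X = return_pmf 0"
| "transition b r c (Suc n) X =
     map_pmf (\<lambda>s. X n + s) (step_pmf (case c (X n) of Blue \<Rightarrow> b | Red \<Rightarrow> r))"

abbreviation path_space :: "(nat \<Rightarrow> int \<times> int) measure" where
  "path_space \<equiv> (\<Pi>\<^sub>M n\<in>UNIV. count_space UNIV)"

abbreviation coloring_space :: "(int \<times> int \<Rightarrow> color) measure" where
  "coloring_space \<equiv> (\<Pi>\<^sub>M x\<in>UNIV. count_space UNIV)"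

text \<open>The Ionescu-Tulcea limit of the transition kernels: the law of the walk in a fixed coloring.\<close>

definition quenched_law ::
  "(nat \<Rightarrow> real) \<Rightarrow> (nat \<Rightarrow> real) \<Rightarrow> (int \<times> int \<Rightarrow> color) \<Rightarrow> (nat \<Rightarrow> int \<times> int) measure" where
  "quenched_law b r c =
     projective_family.lim UNIV
       (Ionescu_Tulcea.CI (\<lambda>n X. measure_pmf (transition b r c n X)) (\<lambda>_. count_space UNIV))
       (\<lambda>_. count_space UNIV)"

definition annealed_law ::
  "real \<Rightarrow> (nat \<Rightarrow> real) \<Rightarrow> (nat \<Rightarrow> real) \<Rightarrow>
    ((int \<times> int \<Rightarrow> color) \<times> (nat \<Rightarrow> int \<times> int)) measure" where
  "annealed_law p b r =
     coloring_law p \<bind> (\<lambda>c. distr (quenched_law b r c) (coloring_space \<Otimes>\<^sub>M path_space) (Pair c))"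

lemma measurable_transition:
  "(\<lambda>(c, X). measure_pmf (transition b r c n X)) \<in>
     measurable (coloring_space \<Otimes>\<^sub>M (\<Pi>\<^sub>M i\<in>{0..<n}. count_space UNIV)) (subprob_algebra (count_space UNIV))"
proof (cases n)
  case 0
  then show ?thesis by (simp add: measure_pmf_in_subprob_algebra)
next
  case (Suc k)
  let ?K = "\<lambda>y a. measure_pmf (map_pmf (\<lambda>s. y + s) (step_pmf (case a of Blue \<Rightarrow> b | Red \<Rightarrow> r)))"
  have 1: "(\<lambda>z. snd z k) \<in> measurable (coloring_space \<Otimes>\<^sub>M (\<Pi>\<^sub>M i\<in>{0..<Suc k}. count_space UNIV))
      (count_space (UNIV :: (int \<times> int) set))"
    by (rule measurable_compose[OF measurable_snd measurable_component_singleton]) auto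
  have 2: "(\<lambda>z. ?K y (fst z y)) \<in> measurable (coloring_space \<Otimes>\<^sub>M (\<Pi>\<^sub>M i\<in>{0..<Suc k}. count_space UNIV))
      (subprob_algebra (count_space (UNIV :: (int \<times> int) set)))" for y
    by (rule measurable_compose[OF measurable_compose[OF measurable_fst measurable_component_singleton[of y]]])
       (auto simp: measure_pmf_in_subprob_algebra)
  have "(\<lambda>z. ?K (snd z k) (fst z (snd z k))) \<in> measurable (coloring_space \<Otimes>\<^sub>M (\<Pi>\<^sub>M i\<in>{0..<Suc k}. count_space UNIV))
      (subprob_algebra (count_space (UNIV :: (int \<times> int) set)))"
    by (rule measurable_compose_countable[OF 2 1])
  then show ?thesis by (simp add: Suc case_prod_beta)
qed

lemma Ionescu_Tulcea_transition:
  "Ionescu_Tulcea (\<lambda>n X. measure_pmf (transition b r c n X)) (\<lambda>_. count_space UNIV)"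
proof
  fix n :: nat
  have "Pair c \<in> measurable (\<Pi>\<^sub>M i\<in>{0..<n}. count_space (UNIV :: (int \<times> int) set))
      (coloring_space \<Otimes>\<^sub>M (\<Pi>\<^sub>M i\<in>{0..<n}. count_space UNIV))"
    by (rule measurable_Pair1') (simp add: space_PiM)
  from measurable_compose[OF this measurable_transition[where b = b and r = r and n = n]]
  show "(\<lambda>X. measure_pmf (transition b r c n X)) \<in>
     measurable (\<Pi>\<^sub>M i\<in>{0..<n}. count_space UNIV) (subprob_algebra (count_space UNIV))"
    by simp
qed

lemma sets_quenched_law [simp, measurable_cong]: "sets (quenched_law b r c) = sets path_space"
proof -
  interpret Ionescu_Tulcea "\<lambda>n X. measure_pmf (transition b r c n X)" "\<lambda>_. count_space UNIV"
    by (rule Ionescu_Tulcea_transition)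
  show ?thesis by (simp add: quenched_law_def)
qed

lemma prob_space_quenched_law: "prob_space (quenched_law b r c)"
proof -
  interpret Ionescu_Tulcea "\<lambda>n X. measure_pmf (transition b r c n X)" "\<lambda>_. count_space UNIV"
    by (rule Ionescu_Tulcea_transition)
  have "emeasure (CI {}) (space (CI {})) = 1"
    by (intro prob_space.emeasure_space_1 PF.prob_space_P) auto
  then have "emeasure PF.lim (PF.emb UNIV {} (space (PiM {} (\<lambda>_. count_space UNIV)))) = 1"
    by (subst lim) (auto simp: CI_def)
  then show ?thesis
    unfolding quenched_law_def by (intro prob_spaceI) (simp add: prod_emb_def space_PiM vimage_def restrict_def)
qed

lemma measurable_C_transition:
  "(\<lambda>c. Ionescu_Tulcea.C (\<lambda>n X. measure_pmf (transition b r c n X)) (\<lambda>_. count_space UNIV) 0 n u) \<in>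
     measurable coloring_space (subprob_algebra (\<Pi>\<^sub>M i\<in>{0..<n}. count_space UNIV))"
  if "u = (\<lambda>_. undefined)"
proof (induction n)
  interpret IT: Ionescu_Tulcea "\<lambda>n X. measure_pmf (transition b r c n X)" "\<lambda>_. count_space UNIV" for c
    by (rule Ionescu_Tulcea_transition)
  {
    case 0
    show ?case
      by (auto simp: that space_PiM intro!: measurable_const measurable_space[OF return_measurable])
  next
    case (Suc n)
    have "(\<lambda>z. distr (measure_pmf (transition b r (fst z) n (snd z)))
          (\<Pi>\<^sub>M i\<in>{0..<Suc n}. count_space UNIV) (fun_upd (snd z) n)) \<in>
        measurable (coloring_space \<Otimes>\<^sub>M (\<Pi>\<^sub>M i\<in>{0..<n}. count_space UNIV))
          (subprob_algebra (\<Pi>\<^sub>M i\<in>{0..<Suc n}. count_space UNIV))"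
      using measurable_transition[of b r n]
      by (intro measurable_distr2[where M = "count_space UNIV"])
         (auto simp: case_prod_beta' intro!: measurable_fun_upd[where J = "{0..<n}"])
    with Suc show ?case
      by (simp add: IT.eP_def[abs_def])
  }
qed

lemma measurable_quenched_law [measurable]:
  "quenched_law b r \<in> measurable coloring_space (prob_algebra path_space)"
proof (rule measurable_prob_algebra_generated[OF sets_PiM Int_stable_prod_algebra prod_algebra_sets_into_space])
  fix A :: "(nat \<Rightarrow> int \<times> int) set"
  assume "A \<in> prod_algebra UNIV (\<lambda>_. count_space UNIV)"
  then obtain J E where A: "A = prod_emb UNIV (\<lambda>_. count_space UNIV) J (\<Pi>\<^sub>E j\<in>J. E j)" and J: "finite J"
    by (rule prod_algebraE)
  interpret IT: Ionescu_Tulcea "\<lambda>n X. measure_pmf (transition b r c n X)" "\<lambda>_. count_space UNIV" for c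
    by (rule Ionescu_Tulcea_transition)
  have E: "(\<Pi>\<^sub>E j\<in>J. E j) \<in> sets (\<Pi>\<^sub>M j\<in>J. count_space UNIV)"
    using J by (intro sets_PiM_I_finite) auto
  have "(\<lambda>c. emeasure (IT.C c 0 (IT.up_to J) (\<lambda>_. undefined))
      (prod_emb {0..<IT.up_to J} (\<lambda>_. count_space UNIV) J (\<Pi>\<^sub>E j\<in>J. E j))) \<in> borel_measurable coloring_space"
    using IT.up_to[OF J] E
    by (intro measurable_compose[OF measurable_C_transition measurable_emeasure_subprob_algebra]
        measurable_prod_emb) auto
  then show "(\<lambda>c. emeasure (quenched_law b r c) A) \<in> borel_measurable coloring_space"
    by (simp add: quenched_law_def A IT.lim[OF J E] IT.emeasure_CI'[OF J E])
qed (simp_all add: prob_space_quenched_law)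

lemma transition_restrict: "transition b r c n (restrict x {0..<n}) = transition b r c n x"
  by (cases n) auto

lemma emeasure_quenched_law:
  "emeasure (quenched_law b r c) {X. \<forall>k<n. X k = x k} =
     (\<Prod>k<n. ennreal (pmf (transition b r c k x) (x k)))"
proof -
  interpret Ionescu_Tulcea "\<lambda>n X. measure_pmf (transition b r c n X)" "\<lambda>_. count_space UNIV"
    by (rule Ionescu_Tulcea_transition)
  have single: "{restrict x {0..<n}} \<in> sets (\<Pi>\<^sub>M i\<in>{0..<n}. count_space UNIV)" for n
  proof -
    have "(\<Pi>\<^sub>E i\<in>{0..<n}. {x i}) \<in> sets (\<Pi>\<^sub>M i\<in>{0..<n}. count_space UNIV)"
      by (intro sets_PiM_I_finite) auto
    also have "(\<Pi>\<^sub>E i\<in>{0..<n}. {x i}) = {restrict x {0..<n}}"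
      by (auto simp: PiE_iff extensional_def restrict_def fun_eq_iff)
    finally show ?thesis .
  qed
  have C: "emeasure (C 0 n (\<lambda>_. undefined)) {restrict x {0..<n}} =
      (\<Prod>k<n. ennreal (pmf (transition b r c k x) (x k)))"
  proof (induction n)
    case 0
    then show ?case using single[of 0] by (simp add: restrict_def)
  next
    case (Suc n)
    have "emeasure (C 0 (Suc n) (\<lambda>_. undefined)) {restrict x {0..<Suc n}} =
       (\<integral>\<^sup>+\<omega>. emeasure (eP n \<omega>) {restrict x {0..<Suc n}} \<partial>C 0 n (\<lambda>_. undefined))"
      using measurable_eP[of n] single[of "Suc n"] prob_space_C[of "\<lambda>_. undefined" 0 n]
      by (simp add: emeasure_bind[where N = "\<Pi>\<^sub>M i\<in>{0..<Suc n}. count_space UNIV"] prob_space.not_empty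
          measurable_cong_sets[OF sets_C refl] space_PiM)
    also have "\<dots> = (\<integral>\<^sup>+\<omega>. ennreal (pmf (transition b r c n x) (x n)) * indicator {restrict x {0..<n}} \<omega>
        \<partial>C 0 n (\<lambda>_. undefined))"
    proof (rule nn_integral_cong)
      fix \<omega> assume "\<omega> \<in> space (C 0 n (\<lambda>_. undefined))"
      then have \<omega>: "\<omega> \<in> space (\<Pi>\<^sub>M i\<in>{0..<n}. count_space UNIV)"
        by (simp add: space_C space_PiM)
      have eq: "fun_upd \<omega> n -` {restrict x {0..<Suc n}} = (if \<omega> = restrict x {0..<n} then {x n} else {})"
        using \<omega> by (auto simp: space_PiM PiE_def extensional_def restrict_def fun_eq_iff less_Suc_eq split: if_splits)
      show "emeasure (eP n \<omega>) {restrict x {0..<Suc n}} =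
          ennreal (pmf (transition b r c n x) (x n)) * indicator {restrict x {0..<n}} \<omega>"
        using emeasure_eP[OF \<omega> single[of "Suc n"]]
        by (auto simp: eq transition_restrict emeasure_pmf_single)
    qed
    also have "\<dots> = ennreal (pmf (transition b r c n x) (x n)) * emeasure (C 0 n (\<lambda>_. undefined)) {restrict x {0..<n}}"
      using single[of n] sets_C[of "\<lambda>_. undefined" 0 n] by (simp add: nn_integral_cmult_indicator space_PiM)
    finally show ?case by (simp only: Suc prod.lessThan_Suc mult.commute)
  qed
  have "{X. \<forall>k<n. X k = x k} = PF.emb UNIV {0..<n} {restrict x {0..<n}}"
    by (auto simp: prod_emb_def restrict_def fun_eq_iff) metis
  then have "emeasure (quenched_law b r c) {X. \<forall>k<n. X k = x k} = emeasure (CI {0..<n}) {restrict x {0..<n}}"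
    by (simp add: quenched_law_def lim[OF _ single])
  also have "\<dots> = emeasure (C 0 n (\<lambda>_. undefined)) (PF.emb {0..<n} {0..<n} {restrict x {0..<n}})"
    by (rule emeasure_CI[OF subset_refl single])
  also have "PF.emb {0..<n} {0..<n} {restrict x {0..<n}} = {restrict x {0..<n}}"
    by (rule prod_emb_id) auto
  finally show ?thesis by (simp add: C)
qed

lemma coloring_law_in_prob_algebra: "coloring_law p \<in> space (prob_algebra coloring_space)"
proof -
  have "prob_space (coloring_law p)"
    unfolding coloring_law_def by (intro prob_space_PiM prob_space_measure_pmf)
  moreover have "sets (coloring_law p) = sets coloring_space"
    unfolding coloring_law_def by (intro sets_PiM_cong) auto
  ultimately show ?thesis by (simp add: space_prob_algebra)
qed

lemma measurable_annealed_kernel: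
  "(\<lambda>c. distr (quenched_law b r c) (coloring_space \<Otimes>\<^sub>M path_space) (Pair c)) \<in>
     measurable coloring_space (prob_algebra (coloring_space \<Otimes>\<^sub>M path_space))"
  by measurable

lemma prob_space_annealed_law: "prob_space (annealed_law p b r)"
  unfolding annealed_law_def
  by (rule prob_space_bind'[OF coloring_law_in_prob_algebra measurable_annealed_kernel])

lemma sets_annealed_law [simp, measurable_cong]:
  "sets (annealed_law p b r) = sets (coloring_space \<Otimes>\<^sub>M path_space)"
  unfolding annealed_law_def
  by (rule sets_bind'[OF coloring_law_in_prob_algebra measurable_annealed_kernel])

lemma emeasure_annealed_law:
  assumes "A \<in> sets coloring_space"
  shows "emeasure (annealed_law p b r) (A \<times> {X. \<forall>k<n. X k = x k}) =
     (\<integral>\<^sup>+c\<in>A. (\<Prod>k<n. ennreal (pmf (transition b r c k x) (x k))) \<partial>coloring_law p)"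
proof -
  have cyl: "{X. \<forall>k<n. X k = x k} \<in> sets path_space"
  proof -
    have "{X \<in> space path_space. \<forall>k<n. X k = x k} \<in> sets path_space" by measurable
    then show ?thesis by (simp add: space_PiM)
  qed
  have "emeasure (annealed_law p b r) (A \<times> {X. \<forall>k<n. X k = x k}) =
     (\<integral>\<^sup>+c. emeasure (distr (quenched_law b r c) (coloring_space \<Otimes>\<^sub>M path_space) (Pair c))
        (A \<times> {X. \<forall>k<n. X k = x k}) \<partial>coloring_law p)"
    unfolding annealed_law_def
    using assms cyl
    by (intro emeasure_bind_prob_algebra[OF coloring_law_in_prob_algebra measurable_annealed_kernel]) auto
  also have "\<dots> = (\<integral>\<^sup>+c\<in>A. (\<Prod>k<n. ennreal (pmf (transition b r c k x) (x k))) \<partial>coloring_law p)"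
  proof (rule nn_integral_cong)
    fix c
    have "Pair c \<in> measurable (quenched_law b r c) (coloring_space \<Otimes>\<^sub>M path_space)"
      by (simp add: measurable_cong_sets[OF sets_quenched_law refl] space_PiM)
    moreover have "space (quenched_law b r c) = UNIV"
      using sets_eq_imp_space_eq[OF sets_quenched_law[of b r c]] by (simp add: space_PiM)
    moreover have "Pair c -` (A \<times> {X. \<forall>k<n. X k = x k}) = (if c \<in> A then {X. \<forall>k<n. X k = x k} else {})"
      by auto
    ultimately show "emeasure (distr (quenched_law b r c) (coloring_space \<Otimes>\<^sub>M path_space) (Pair c))
        (A \<times> {X. \<forall>k<n. X k = x k}) =
        (\<Prod>k<n. ennreal (pmf (transition b r c k x) (x k))) * indicator A c"
      using assms cyl by (simp add: emeasure_distr emeasure_quenched_law)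
  qed
  finally show ?thesis .
qed

end

theory Submission
  imports Defs
begin

text \<open>
  \<^emph>\<open>Few red visits.\<close> Changing a red site to blue when the site above it is blue changes the discounted
  Green functions of the walk by at most a constant factor, even if \<open>r\<close> has a zero entry: the vertical
  steps always lead around the site, via the blue neighbor. Flipping the red sites below the first blue one
  in the column above \<open>x\<close> from the top downwards shows that, when \<open>p\<close> is close to \<open>1\<close>, the annealed
  time spent at red sites is a small fraction \<open>\<kappa>\<close> of the total, also after weighting by any function of
  the site. Hence the expected displacement after \<open>n\<close> steps is at least \<open>(1/10 - O(\<kappa>)) n\<close>, and
  \<open>(5/6) ^ x\<close> is an annealed strict supermartingale on average, so that visits to the far left are
  exponentially rare. The same holds for the squared Green function, which yields the summability of
  \<open>(n + 1) P(x\<^sub>n < 0)\<close>.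

  \<^emph>\<open>Existence of the speed.\<close> Call a level a regeneration level if the walk never goes below it after
  first hitting it. What happens before and after that time depends on disjoint sets of columns, so the
  first coordinate of the walk has an exact renewal structure. The correlation of two regeneration
  levels at distance \<open>k\<close> is controlled by the probability of returning to the left half plane after time
  \<open>k\<close>, which is summable. A strong law for weakly correlated variables then applies to the times
  between regenerations, which have finite mean because of the linear displacement.
\<close>

section \<open>A strong law for weakly correlated variables\<close>

text \<open>Some colorings make the walk recurrent (all red with \<open>\<delta> = 1/4\<close> is
  simple random walk), so Green functions are finite uniformly in the coloring only after
  discounting; all constants are independent of the discount. What replaces ellipticity is that
  vertical steps have probability \<open>1/4\<close> in both colors.

  The strong law is applied to a sequence indexed by levels, not by successive regenerations. This
  avoids conditioning on a regeneration at the start: \<open>level_gap m\<close> has the same law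
  for every \<open>m\<close>, vanishes unless \<open>m\<close> is a regeneration level, and its
  partial sums are elapsed times, so the speed is the reciprocal of its mean. The price is
  correlation between levels. The covariance at distance \<open>k\<close> is at most a convolution
  of two summable sequences: the mean gap split by the next regeneration level, and the tail sums of
  \<open>P(x n < 0)\<close>. Summing these tails produces the weight \<open>n + 1\<close>, hence the
  squared Green function. Only the first moment of the gaps is under control, so the strong law
  follows Etemadi: truncation, geometric subsequences, monotonicity.\<close>

lemma (in prob_space) AE_tendsto_0_if_summable_second_moments:
  fixes Y :: "nat \<Rightarrow> 'a \<Rightarrow> real"
  assumes [measurable]: "\<And>n. Y n \<in> borel_measurable M"
    and fin: "(\<Sum>n. \<integral>\<^sup>+x. ennreal ((Y n x)\<^sup>2) \<partial>M) < \<infinity>"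
  shows "AE x in M. (\<lambda>n. Y n x) \<longlonglongrightarrow> 0"
proof -
  have "(\<integral>\<^sup>+x. (\<Sum>n. ennreal ((Y n x)\<^sup>2)) \<partial>M) < \<infinity>"
    using fin by (subst nn_integral_suminf) auto
  then have "AE x in M. (\<Sum>n. ennreal ((Y n x)\<^sup>2)) \<noteq> \<infinity>"
    by (intro nn_integral_PInf_AE) auto
  then show ?thesis
  proof eventually_elim
    case (elim x)
    have "summable (\<lambda>n. (Y n x)\<^sup>2)"
      using elim by (intro summable_suminf_not_top) auto
    from summable_LIMSEQ_zero[OF this] show ?case
      by (simp add: power_tendsto_0_iff)
  qed
qed

text \<open>The terms vanish up to the first \<open>N\<close> with
  \<open>z \<le> \<alpha> ^ N\<close>; there the term is at most \<open>z\<close>, and the rest is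
  geometric. Integrated over \<open>z\<close>, this controls truncated second moments along a
  geometric subsequence by the first moment alone.\<close>

lemma geometric_tail_bound:
  fixes \<alpha> z :: real
  assumes \<alpha>: "1 < \<alpha>" and z: "0 \<le> z"
  shows "summable (\<lambda>n. (if z \<le> \<alpha> ^ n then z\<^sup>2 / \<alpha> ^ n else 0))"
    and "(\<Sum>n. (if z \<le> \<alpha> ^ n then z\<^sup>2 / \<alpha> ^ n else 0)) \<le> z * (\<alpha> / (\<alpha> - 1))"
proof -
  let ?f = "\<lambda>n. if z \<le> \<alpha> ^ n then z\<^sup>2 / \<alpha> ^ n else 0"
  have g: "summable (\<lambda>n. (1 / \<alpha>) ^ n)" using \<alpha> by (intro summable_geometric) simp
  show sm: "summable ?f"
    using \<alpha> by (intro summable_comparison_test'[OF summable_mult[OF g, of "z\<^sup>2"], of 0])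
      (auto simp: power_one_over field_simps)
  show "suminf ?f \<le> z * (\<alpha> / (\<alpha> - 1))"
  proof (cases "z = 0")
    case False
    with z have zp: "0 < z" by simp
    have "\<exists>n. z \<le> \<alpha> ^ n" using real_arch_pow[OF \<alpha>, of z] by (auto intro: less_imp_le)
    define N where "N = (LEAST n. z \<le> \<alpha> ^ n)"
    have N: "z \<le> \<alpha> ^ N" unfolding N_def by (rule LeastI_ex) fact
    have 0: "?f n = 0" if "n < N" for n using not_less_Least[of n "\<lambda>n. z \<le> \<alpha> ^ n"] that by (auto simp: N_def)
    have "suminf ?f = (\<Sum>n. ?f (n + N))"
      using suminf_split_initial_segment[OF sm, of N] 0 by simp
    also have "\<dots> \<le> (\<Sum>n. z * (1 / \<alpha>) ^ n)"
    proof (intro suminf_le summable_mult g)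
      show "summable (\<lambda>n. ?f (n + N))" using sm by (rule summable_ignore_initial_segment)
      fix n
      have "z * z \<le> \<alpha> ^ N * z" using N zp by (intro mult_right_mono) auto
      then show "?f (n + N) \<le> z * (1 / \<alpha>) ^ n"
        using \<alpha> zp by (simp add: power2_eq_square power_add power_one_over divide_simps)
    qed
    also have "\<dots> = z * (\<alpha> / (\<alpha> - 1))"
      using \<alpha> by (subst suminf_mult[OF g]) (simp add: suminf_geometric divide_simps)
    finally show ?thesis .
  qed (simp cong: if_cong)
qed

lemma tendsto_averages:
  fixes a :: "nat \<Rightarrow> real"
  assumes "a \<longlonglongrightarrow> L"
  shows "(\<lambda>n. (\<Sum>i<n. a i) / real n) \<longlonglongrightarrow> L"
proof (rule LIMSEQ_I)
  fix e :: real assume e: "0 < e"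
  from LIMSEQ_D[OF assms, of "e/2"] e obtain N where N: "\<And>n. n \<ge> N \<Longrightarrow> \<bar>a n - L\<bar> < e/2"
    by auto
  define K where "K = (\<Sum>i<N. \<bar>a i - L\<bar>)"
  have K: "0 \<le> K" by (simp add: K_def sum_nonneg)
  have bound: "\<bar>\<Sum>i<n. a i - L\<bar> \<le> K + n * (e/2)" for n
  proof -
    have "\<bar>\<Sum>i<n. a i - L\<bar> \<le> (\<Sum>i<n. (if i < N then \<bar>a i - L\<bar> else 0) + e/2)"
      using N e by (intro order_trans[OF sum_abs] sum_mono) (auto simp: not_less less_imp_le)
    also have "\<dots> = (\<Sum>i\<in>{..<n} \<inter> {..<N}. \<bar>a i - L\<bar>) + n * (e/2)"
      by (subst sum.inter_restrict) (auto simp: sum.distrib)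
    also have "(\<Sum>i\<in>{..<n} \<inter> {..<N}. \<bar>a i - L\<bar>) \<le> K"
      unfolding K_def by (intro sum_mono2) auto
    finally show ?thesis by simp
  qed
  obtain n0 where n0: "2 * K / e < real n0" using reals_Archimedean2 by blast
  show "\<exists>no. \<forall>n\<ge>no. norm ((\<Sum>i<n. a i) / real n - L) < e"
  proof (intro exI allI impI)
    fix n assume n: "n \<ge> Suc n0"
    have "(\<Sum>i<n. a i) / real n - L = (\<Sum>i<n. a i - L) / n"
      using n by (simp add: sum_subtractf field_simps)
    moreover have "K + n * (e/2) < e * n"
      using n0 n e by (simp add: field_simps) (smt (verit) mult_left_mono of_nat_le_iff Suc_leD mult_less_cancel_left_pos)
    ultimately show "norm ((\<Sum>i<n. a i) / real n - L) < e"
      using bound[of n] n by (simp add: divide_less_eq)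
  qed
qed

text \<open>Monotonicity sandwiches \<open>S N / N\<close> between \<open>q / \<alpha>^2\<close> at
  the last subsequence point before \<open>N\<close> and \<open>\<alpha> * q\<close> at the next
  one. The ratio \<open>\<alpha>\<close> can be taken arbitrarily close to 1, with countably many
  ratios so that almost sure statements can be combined.\<close>

lemma tendsto_of_geometric_subsequences:
  fixes S :: "nat \<Rightarrow> real"
  assumes mono: "mono S" and nonneg: "\<And>n. 0 \<le> S n"
    and lim: "\<And>j. (\<lambda>n. S (nat \<lfloor>(1 + 1 / real (Suc j)) ^ n\<rfloor>) / real (nat \<lfloor>(1 + 1 / real (Suc j)) ^ n\<rfloor>)) \<longlonglongrightarrow> L"
  shows "(\<lambda>n. S n / real n) \<longlonglongrightarrow> L"
proof -
  define \<alpha> where "\<alpha> j = 1 + 1 / real (Suc j)" for j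
  define k where "k j n = nat \<lfloor>\<alpha> j ^ n\<rfloor>" for j n
  define q where "q j n = S (k j n) / real (k j n)" for j n
  have \<alpha>: "1 < \<alpha> j" for j by (simp add: \<alpha>_def)
  have \<alpha>_lim: "\<alpha> \<longlonglongrightarrow> 1"
    unfolding \<alpha>_def using tendsto_add[OF tendsto_const LIMSEQ_inverse_real_of_nat, of 1]
    by (simp add: inverse_eq_divide)
  have q: "q j \<longlonglongrightarrow> L" for j
    using lim unfolding q_def k_def \<alpha>_def .
  have k_le: "real (k j n) \<le> \<alpha> j ^ n" for j n
    using \<alpha>[of j] by (simp add: k_def)
  have k_gt: "\<alpha> j ^ n < real (k j n) + 1" for j n
    using real_of_int_floor_add_one_gt[of "\<alpha> j ^ n"] \<alpha>[of j] by (simp add: k_def)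
  have k_pos: "1 \<le> k j n" for j n
    using \<alpha>[of j] one_le_power[of "\<alpha> j" n] by (simp add: k_def le_nat_iff)
  have L: "0 \<le> L"
    by (rule LIMSEQ_le_const[OF q[of 0]]) (auto simp: q_def nonneg)
  have bracket: "\<exists>n\<ge>n0. \<alpha> j ^ n \<le> real N \<and> real N < \<alpha> j ^ Suc n" if N: "\<alpha> j ^ n0 \<le> real N" for j n0 N
  proof -
    have ex: "\<exists>m. real N < \<alpha> j ^ m" using real_arch_pow[OF \<alpha>] by blast
    define m where "m = (LEAST m. real N < \<alpha> j ^ m)"
    have m: "real N < \<alpha> j ^ m" unfolding m_def by (rule LeastI_ex[OF ex])
    with N have "n0 < m" using power_less_imp_less_exp[OF \<alpha>, of j n0 m] by linarith
    then obtain n where n: "m = Suc n" "n0 \<le> n" by (cases m) auto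
    have "\<not> real N < \<alpha> j ^ n" using not_less_Least[of n "\<lambda>m. real N < \<alpha> j ^ m"] n by (simp add: m_def)
    then show ?thesis using m n by auto
  qed
  have large: "eventually (\<lambda>N. \<alpha> j ^ n0 \<le> real N) sequentially" for j n0
    using filterlim_real_sequentially by (simp add: filterlim_at_top)
  show ?thesis
  proof (rule order_tendstoI)
    fix u assume u: "L < u"
    have "(\<lambda>j. \<alpha> j * L) \<longlonglongrightarrow> 1 * L" by (intro tendsto_intros \<alpha>_lim)
    with u have "eventually (\<lambda>j. \<alpha> j * L < u) sequentially" by (intro order_tendstoD) auto
    then obtain j where j: "\<alpha> j * L < u" by (auto simp: eventually_sequentially)
    have "(\<lambda>n. \<alpha> j * q j n) \<longlonglongrightarrow> \<alpha> j * L" by (intro tendsto_intros q)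
    with j have "eventually (\<lambda>n. \<alpha> j * q j n < u) sequentially" by (intro order_tendstoD) auto
    then obtain n0 where n0: "\<And>n. n \<ge> n0 \<Longrightarrow> \<alpha> j * q j n < u" by (auto simp: eventually_sequentially)
    show "eventually (\<lambda>N. S N / real N < u) sequentially"
      using large[of j n0]
    proof eventually_elim
      case (elim N)
      then obtain n where n: "n \<ge> n0" "\<alpha> j ^ n \<le> real N" "real N < \<alpha> j ^ Suc n" using bracket by blast
      have Np: "0 < real N" using n(2) \<alpha>[of j] zero_less_power[of "\<alpha> j" n] by linarith
      have "real N < real (k j (Suc n)) + 1" using n(3) k_gt[of j "Suc n"] by linarith
      then have "N \<le> k j (Suc n)" by linarith
      then have "S N \<le> S (k j (Suc n))" using mono by (rule monoD[rotated])
      also have "\<dots> = q j (Suc n) * k j (Suc n)" using k_pos[of j "Suc n"] by (simp add: q_def)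
      also have "\<dots> \<le> q j (Suc n) * (\<alpha> j * N)"
        using k_le[of j "Suc n"] n(2) \<alpha>[of j] by (intro mult_left_mono) (auto simp: q_def nonneg intro: order_trans)
      finally have "S N / N \<le> \<alpha> j * q j (Suc n)" using Np by (simp add: divide_le_eq mult_ac)
      then show ?case using n0[of "Suc n"] n(1) by simp
    qed
  next
    fix l assume l: "l < L"
    have "(\<lambda>j. L / (\<alpha> j)\<^sup>2) \<longlonglongrightarrow> L / 1\<^sup>2" by (intro tendsto_intros \<alpha>_lim) auto
    with l have "eventually (\<lambda>j. l < L / (\<alpha> j)\<^sup>2) sequentially" by (intro order_tendstoD) auto
    then obtain j where j: "l < L / (\<alpha> j)\<^sup>2" by (auto simp: eventually_sequentially)
    have "(\<lambda>n. q j n / (\<alpha> j)\<^sup>2) \<longlonglongrightarrow> L / (\<alpha> j)\<^sup>2" using \<alpha>[of j] by (intro tendsto_intros q) auto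
    with j have 1: "eventually (\<lambda>n. l < q j n / (\<alpha> j)\<^sup>2) sequentially" by (intro order_tendstoD) auto
    \<comment> \<open>Beyond this threshold the rounding in \<open>k j n\<close> costs at most one
      more factor \<open>\<alpha> j\<close>, which is why the lower bound carries
      \<open>\<alpha>^2\<close>.\<close>
    have 2: "eventually (\<lambda>n. \<alpha> j / (\<alpha> j - 1) < \<alpha> j ^ n) sequentially"
    proof -
      obtain m where "\<alpha> j / (\<alpha> j - 1) < \<alpha> j ^ m" using real_arch_pow[OF \<alpha>] by blast
      then show ?thesis
        using \<alpha>[of j] by (intro eventually_mono[OF eventually_ge_at_top[of m]]) (auto intro: less_le_trans power_increasing)
    qed
    obtain n0 where n0: "\<And>n. n \<ge> n0 \<Longrightarrow> l < q j n / (\<alpha> j)\<^sup>2" "\<And>n. n \<ge> n0 \<Longrightarrow> \<alpha> j / (\<alpha> j - 1) < \<alpha> j ^ n"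
      using eventually_conj[OF 1 2] by (auto simp: eventually_sequentially)
    show "eventually (\<lambda>N. l < S N / real N) sequentially"
      using large[of j n0]
    proof eventually_elim
      case (elim N)
      then obtain n where n: "n \<ge> n0" "\<alpha> j ^ n \<le> real N" "real N < \<alpha> j ^ Suc n" using bracket by blast
      have Np: "0 < real N" using n(2) \<alpha>[of j] zero_less_power[of "\<alpha> j" n] by linarith
      have "\<alpha> j < \<alpha> j ^ n * (\<alpha> j - 1)" using n0(2)[OF n(1)] \<alpha>[of j] by (simp add: divide_less_eq)
      then have "\<alpha> j ^ n + \<alpha> j < \<alpha> j * \<alpha> j ^ n" by (simp add: algebra_simps)
      also have "\<dots> < \<alpha> j * (k j n + 1)" using k_gt[of j n] \<alpha>[of j] by simp
      finally have "\<alpha> j ^ n \<le> \<alpha> j * k j n" by (simp add: algebra_simps)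
      then have "\<alpha> j * \<alpha> j ^ n \<le> \<alpha> j * (\<alpha> j * k j n)" using \<alpha>[of j] by (intro mult_left_mono) auto
      then have N_le: "N \<le> (\<alpha> j)\<^sup>2 * k j n" using n(3) by (simp add: power2_eq_square mult.assoc)
      have "k j n \<le> N" using k_le[of j n] n(2) by linarith
      then have S: "S (k j n) \<le> S N" using mono by (rule monoD[rotated])
      have "q j n / (\<alpha> j)\<^sup>2 * N \<le> q j n / (\<alpha> j)\<^sup>2 * ((\<alpha> j)\<^sup>2 * k j n)"
        using N_le by (intro mult_left_mono) (auto simp: q_def nonneg)
      also have "\<dots> = S (k j n)" using k_pos[of j n] \<alpha>[of j] by (simp add: q_def)
      finally have "q j n / (\<alpha> j)\<^sup>2 \<le> S N / N" using S Np by (simp add: le_divide_eq)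
      then show ?case using n0(1)[OF n(1)] by simp
    qed
  qed
qed

text \<open>Etemadi's proof. It uses second moments only through the variance of truncated sums, so
  independence can be replaced by an upper bound, linear in \<open>n\<close>, for the total
  covariance of the truncated variables.\<close>

lemma (in prob_space) strong_law_weakly_correlated:
  fixes Z :: "nat \<Rightarrow> 'a \<Rightarrow> real" and D :: real
  assumes [measurable]: "\<And>m. Z m \<in> borel_measurable M"
    and nonneg: "\<And>m x. 0 \<le> Z m x"
    and ident: "\<And>m. distr M borel (Z m) = distr M borel (Z 0)"
    and int: "integrable M (Z 0)"
    and cov: "\<And>n. (\<Sum>j<n. \<Sum>i<j. expectation (\<lambda>x. (if Z i x \<le> i then Z i x else 0) * (if Z j x \<le> j then Z j x else 0))
        - expectation (\<lambda>x. if Z i x \<le> i then Z i x else 0) * expectation (\<lambda>x. if Z j x \<le> j then Z j x else 0)) \<le> D * n"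
  shows "AE x in M. (\<lambda>n. (\<Sum>m<n. Z m x) / n) \<longlonglongrightarrow> expectation (Z 0)"
proof -
  define T where "T m x = (if Z m x \<le> m then Z m x else 0)" for m x
  have [measurable]: "T m \<in> borel_measurable M" for m unfolding T_def[abs_def] by measurable
  have T0: "0 \<le> T m x" and Tm: "T m x \<le> m" for m x using nonneg by (auto simp: T_def)
  have int_T: "integrable M (T m)" for m
    by (rule integrable_const_bound[of _ m]) (use T0 Tm in auto)
  have int_TT: "integrable M (\<lambda>x. T i x * T j x)" for i j
    by (rule integrable_const_bound[of _ "real i * real j"]) (use T0 Tm in \<open>auto intro!: mult_mono\<close>)
  have int_trunc: "integrable M (\<lambda>x. if Z 0 x \<le> y then (Z 0 x)\<^sup>2 else 0)" for y :: real
    by (rule integrable_const_bound[of _ "y\<^sup>2"]) (use nonneg in \<open>auto intro!: power_mono\<close>)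
  define e where "e m = expectation (T m)" for m
  have trans: "(\<integral>\<^sup>+x. h (Z m x) \<partial>M) = (\<integral>\<^sup>+x. h (Z 0 x) \<partial>M)" if [measurable]: "h \<in> borel_measurable borel" for h m
    using nn_integral_distr[of "Z m" M borel h] nn_integral_distr[of "Z 0" M borel h] ident[of m] by simp
  have transB: "expectation (\<lambda>x. h (Z m x)) = expectation (\<lambda>x. h (Z 0 x))" if [measurable]: "h \<in> borel_measurable borel" for h :: "real \<Rightarrow> real" and m
    using integral_distr[of "Z m" M borel h] integral_distr[of "Z 0" M borel h] ident[of m] by simp
  have e_lim: "e \<longlonglongrightarrow> expectation (Z 0)"
  proof -
    have "e = (\<lambda>m. expectation (\<lambda>x. if Z 0 x \<le> m then Z 0 x else 0))"
      unfolding e_def T_def by (intro ext transB) measurable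
    also have "\<dots> \<longlonglongrightarrow> expectation (Z 0)"
    proof (rule integral_dominated_convergence[where w = "Z 0"])
      show "AE x in M. (\<lambda>m. if Z 0 x \<le> real m then Z 0 x else 0) \<longlonglongrightarrow> Z 0 x"
      proof (rule AE_I2)
        fix x
        have "eventually (\<lambda>m. Z 0 x \<le> real m) sequentially"
          using filterlim_real_sequentially by (simp add: filterlim_at_top)
        then show "(\<lambda>m. if Z 0 x \<le> real m then Z 0 x else 0) \<longlonglongrightarrow> Z 0 x"
          by (intro tendsto_eventually) (auto elim: eventually_mono)
      qed
    qed (use int nonneg in auto)
    finally show ?thesis .
  qed
  \<comment> \<open>By identical distribution the truncation probabilities add up to at most
    \<open>E Z + 1\<close>; Borel-Cantelli then leaves finitely many truncated terms.\<close>
  have trunc: "AE x in M. eventually (\<lambda>m. Z m x = T m x) sequentially"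
  proof -
    have "(\<Sum>m. emeasure M {x\<in>space M. real m < Z m x}) = (\<Sum>m. \<integral>\<^sup>+x. indicator {real m<..} (Z 0 x) \<partial>M)"
    proof (rule suminf_cong)
      fix m
      have "emeasure M {x\<in>space M. real m < Z m x} = (\<integral>\<^sup>+x. indicator {x\<in>space M. real m < Z m x} x \<partial>M)"
        by simp
      also have "\<dots> = (\<integral>\<^sup>+x. indicator {real m<..} (Z m x) \<partial>M)"
        by (intro nn_integral_cong) (auto split: split_indicator)
      also have "\<dots> = (\<integral>\<^sup>+x. indicator {real m<..} (Z 0 x) \<partial>M)"
        by (rule trans) simp
      finally show "emeasure M {x\<in>space M. real m < Z m x} = (\<integral>\<^sup>+x. indicator {real m<..} (Z 0 x) \<partial>M)" .
    qed
    also have "\<dots> = (\<integral>\<^sup>+x. (\<Sum>m. indicator {real m<..} (Z 0 x)) \<partial>M)"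
      by (rule nn_integral_suminf[symmetric]) measurable
    also have "\<dots> \<le> (\<integral>\<^sup>+x. ennreal (Z 0 x + 1) \<partial>M)"
    proof (rule nn_integral_mono)
      fix x
      have "(\<Sum>m. indicator {real m<..} (Z 0 x)) = (\<Sum>m<nat \<lceil>Z 0 x\<rceil>. (1::ennreal))"
      proof -
        have "(\<Sum>m. indicator {real m<..} (Z 0 x)) = (\<Sum>m<nat \<lceil>Z 0 x\<rceil>. indicator {real m<..} (Z 0 x) :: ennreal)"
          by (rule suminf_finite) (auto split: split_indicator, linarith)
        also have "\<dots> = (\<Sum>m<nat \<lceil>Z 0 x\<rceil>. 1)"
          by (intro sum.cong) (auto split: split_indicator, linarith)
        finally show ?thesis .
      qed
      also have "\<dots> = ennreal (real (nat \<lceil>Z 0 x\<rceil>))" by (simp add: ennreal_of_nat_eq_real_of_nat)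
      also have "\<dots> \<le> ennreal (Z 0 x + 1)"
        using nonneg[of 0 x] by (intro ennreal_leI) linarith
      finally show "(\<Sum>m. indicator {real m<..} (Z 0 x)) \<le> ennreal (Z 0 x + 1)" .
    qed
    also have "\<dots> < \<infinity>"
      using int nonneg by (subst nn_integral_eq_integral) (auto simp: add_nonneg_nonneg)
    finally have fin: "(\<Sum>m. emeasure M {x\<in>space M. real m < Z m x}) < \<infinity>" .
    have "AE x in M. eventually (\<lambda>m. x \<in> space M - {x\<in>space M. real m < Z m x}) sequentially"
    proof (rule borel_cantelli_AE1)
      show "summable (\<lambda>m. measure M {x\<in>space M. real m < Z m x})"
        using fin by (intro summable_suminf_not_top) (auto simp: emeasure_eq_measure)
    qed (auto simp: emeasure_eq_measure)
    with AE_space show ?thesis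
    proof eventually_elim
      case (elim x)
      show ?case using elim(2) by eventually_elim (auto simp: T_def)
    qed
  qed
  \<comment> \<open>The diagonal terms are bounded by a common truncation at \<open>n\<close>; the
    off-diagonal ones occur twice and are controlled by \<open>cov\<close>.\<close>
  have var: "expectation (\<lambda>x. ((\<Sum>m<n. T m x) - (\<Sum>m<n. e m))\<^sup>2) \<le>
      real n * expectation (\<lambda>x. if Z 0 x \<le> n then (Z 0 x)\<^sup>2 else 0) + 2 * (D * n)" for n
  proof -
    have *: "(\<Sum>i<n. \<Sum>j<n. c i j) = (\<Sum>i<n. c i i) + 2 * (\<Sum>j<n. \<Sum>i<j. c i j)"
      if sym: "\<And>i j. c i j = c j i" for c :: "nat \<Rightarrow> nat \<Rightarrow> real" and n
    proof (induction n)
      case (Suc n)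
      have "(\<Sum>i<n. c i n) = (\<Sum>i<n. c n i)" using sym by (intro sum.cong) auto
      then show ?case using Suc by (simp add: sum.distrib)
    qed simp
    have "expectation (\<lambda>x. ((\<Sum>m<n. T m x) - (\<Sum>m<n. e m))\<^sup>2) =
        expectation (\<lambda>x. \<Sum>i<n. \<Sum>j<n. (T i x - e i) * (T j x - e j))"
      by (simp add: power2_eq_square sum_subtractf[symmetric] sum_product)
    also have "\<dots> = (\<Sum>i<n. \<Sum>j<n. expectation (\<lambda>x. (T i x - e i) * (T j x - e j)))"
    proof -
      have "integrable M (\<lambda>x. (T i x - e i) * (T j x - e j))" for i j
        using int_T int_TT by (simp add: algebra_simps)
      then show ?thesis by (simp add: Bochner_Integration.integral_sum)
    qed
    also have "\<dots> = (\<Sum>i<n. \<Sum>j<n. expectation (\<lambda>x. T i x * T j x) - e i * e j)"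
    proof (intro sum.cong refl)
      fix i j
      have "expectation (\<lambda>x. (T i x - e i) * (T j x - e j)) =
          expectation (\<lambda>x. T i x * T j x - e j * T i x - e i * T j x + e i * e j)"
        by (simp add: algebra_simps)
      also have "\<dots> = expectation (\<lambda>x. T i x * T j x) - e j * e i - e i * e j + e i * e j"
        using int_T int_TT by (simp add: e_def prob_space)
      finally show "expectation (\<lambda>x. (T i x - e i) * (T j x - e j)) = expectation (\<lambda>x. T i x * T j x) - e i * e j"
        by simp
    qed
    also have "\<dots> = (\<Sum>i<n. expectation (\<lambda>x. T i x * T i x) - e i * e i)
        + 2 * (\<Sum>j<n. \<Sum>i<j. expectation (\<lambda>x. T i x * T j x) - e i * e j)"
      by (rule *) (simp add: mult.commute)
    also have "\<dots> \<le> (\<Sum>i<n. expectation (\<lambda>x. if Z 0 x \<le> n then (Z 0 x)\<^sup>2 else 0)) + 2 * (D * n)"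
    proof (intro add_mono mult_left_mono sum_mono)
      show "(\<Sum>j<n. \<Sum>i<j. expectation (\<lambda>x. T i x * T j x) - e i * e j) \<le> D * n"
        using cov[of n] by (simp add: e_def T_def[abs_def])
      fix i assume i: "i \<in> {..<n}"
      have "expectation (\<lambda>x. T i x * T i x) = expectation (\<lambda>x. if Z i x \<le> i then (Z i x)\<^sup>2 else 0)"
        by (intro Bochner_Integration.integral_cong) (auto simp: T_def power2_eq_square)
      also have "\<dots> = expectation (\<lambda>x. if Z 0 x \<le> i then (Z 0 x)\<^sup>2 else 0)"
        by (rule transB[of "\<lambda>z. if z \<le> i then z\<^sup>2 else 0"]) measurable
      also have "\<dots> \<le> expectation (\<lambda>x. if Z 0 x \<le> n then (Z 0 x)\<^sup>2 else 0)"
      proof (rule integral_mono[OF int_trunc int_trunc])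
        show "(if Z 0 x \<le> real i then (Z 0 x)\<^sup>2 else 0) \<le> (if Z 0 x \<le> real n then (Z 0 x)\<^sup>2 else 0)" for x
          using i by auto
      qed
      finally show "expectation (\<lambda>x. T i x * T i x) - e i * e i \<le> expectation (\<lambda>x. if Z 0 x \<le> n then (Z 0 x)\<^sup>2 else 0)"
        by (smt (verit) zero_le_square)
    qed simp
    also have "\<dots> = real n * expectation (\<lambda>x. if Z 0 x \<le> n then (Z 0 x)\<^sup>2 else 0) + 2 * (D * n)"
      by simp
    finally show ?thesis .
  qed
  define k where "k j n = nat \<lfloor>(1 + 1 / real (Suc j)) ^ n\<rfloor>" for j n
  have sub: "AE x in M. (\<lambda>n. ((\<Sum>m<k j n. T m x) - (\<Sum>m<k j n. e m)) / k j n) \<longlonglongrightarrow> 0" for j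
  proof (rule AE_tendsto_0_if_summable_second_moments)
    define \<alpha> where "\<alpha> = 1 + 1 / real (Suc j)"
    have \<alpha>: "1 < \<alpha>" by (simp add: \<alpha>_def)
    have k_pos: "1 \<le> k j n" for n
      using \<alpha> one_le_power[of \<alpha> n] unfolding k_def \<alpha>_def[symmetric] by (simp add: le_nat_iff)
    have k_le: "real (k j n) \<le> \<alpha> ^ n" for n
      using \<alpha> unfolding k_def \<alpha>_def[symmetric] by simp
    have k_ge: "\<alpha> ^ n \<le> 2 * real (k j n)" for n
    proof -
      have "\<alpha> ^ n < real (k j n) + 1"
        using real_of_int_floor_add_one_gt[of "\<alpha> ^ n"] \<alpha> unfolding k_def \<alpha>_def[symmetric] by simp
      moreover have "1 \<le> real (k j n)" using k_pos[of n] by simp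
      ultimately show ?thesis by linarith
    qed
    \<comment> \<open>Divide \<open>var\<close> by the square of \<open>k j n\<close> and use that
      \<open>k j n\<close> is at least half of \<open>\<alpha> ^ n\<close>. The absolute value
      allows for a \<open>D\<close> of any sign.\<close>
    have bound: "expectation (\<lambda>x. (((\<Sum>m<k j n. T m x) - (\<Sum>m<k j n. e m)) / k j n)\<^sup>2) \<le>
        2 * expectation (\<lambda>x. if Z 0 x \<le> \<alpha> ^ n then (Z 0 x)\<^sup>2 / \<alpha> ^ n else 0) + 4 * \<bar>D\<bar> * (1 / \<alpha>) ^ n" for n
    proof -
      define E where "E = expectation (\<lambda>x. if Z 0 x \<le> \<alpha> ^ n then (Z 0 x)\<^sup>2 else 0)"
      have kp: "0 < real (k j n)" and \<alpha>p: "0 < \<alpha> ^ n" using k_pos[of n] \<alpha> by auto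
      have inv: "1 / real (k j n) \<le> 2 / \<alpha> ^ n"
        using k_ge[of n] kp \<alpha>p by (simp add: divide_simps mult_ac)
      have E0: "0 \<le> E" unfolding E_def by (intro integral_nonneg_AE) auto
      have "expectation (\<lambda>x. if Z 0 x \<le> k j n then (Z 0 x)\<^sup>2 else 0) \<le> E"
        unfolding E_def
      proof (rule integral_mono[OF int_trunc int_trunc])
        show "(if Z 0 x \<le> real (k j n) then (Z 0 x)\<^sup>2 else 0) \<le> (if Z 0 x \<le> \<alpha> ^ n then (Z 0 x)\<^sup>2 else 0)" for x
          using k_le[of n] by auto
      qed
      then have "real (k j n) * expectation (\<lambda>x. if Z 0 x \<le> k j n then (Z 0 x)\<^sup>2 else 0) \<le> real (k j n) * E"
        by (intro mult_left_mono) auto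
      moreover have "2 * (D * real (k j n)) \<le> 2 * (\<bar>D\<bar> * real (k j n))"
        by (intro mult_left_mono mult_right_mono) auto
      ultimately have "expectation (\<lambda>x. ((\<Sum>m<k j n. T m x) - (\<Sum>m<k j n. e m))\<^sup>2) \<le> (E + 2 * \<bar>D\<bar>) * k j n"
        using var[of "k j n"] by (simp add: algebra_simps)
      then have "expectation (\<lambda>x. ((\<Sum>m<k j n. T m x) - (\<Sum>m<k j n. e m))\<^sup>2) / (k j n)\<^sup>2 \<le> (E + 2 * \<bar>D\<bar>) * (1 / k j n)"
        using kp by (simp add: divide_simps power2_eq_square)
      also have "\<dots> \<le> (E + 2 * \<bar>D\<bar>) * (2 / \<alpha> ^ n)"
        using E0 by (intro mult_left_mono inv) auto
      also have "\<dots> = 2 * (E / \<alpha> ^ n) + 4 * \<bar>D\<bar> * (1 / \<alpha>) ^ n"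
        by (simp add: power_one_over algebra_simps add_divide_distrib)
      also have "E / \<alpha> ^ n = expectation (\<lambda>x. if Z 0 x \<le> \<alpha> ^ n then (Z 0 x)\<^sup>2 / \<alpha> ^ n else 0)"
        unfolding E_def integral_divide_zero[symmetric] by (intro Bochner_Integration.integral_cong) auto
      finally show ?thesis by (simp add: power_divide)
    qed
    let ?g = "\<lambda>n x. if Z 0 x \<le> \<alpha> ^ n then (Z 0 x)\<^sup>2 / \<alpha> ^ n else 0"
    have int_g: "integrable M (?g n)" for n
      using \<alpha> nonneg by (intro integrable_const_bound[of _ "(\<alpha> ^ n)\<^sup>2 / \<alpha> ^ n"])
        (auto intro!: divide_right_mono power_mono)
    have sm: "summable (\<lambda>n. (1 / \<alpha>) ^ n)" using \<alpha> by (intro summable_geometric) simp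
    have "(\<Sum>n. \<integral>\<^sup>+x. ennreal ((((\<Sum>m<k j n. T m x) - (\<Sum>m<k j n. e m)) / k j n)\<^sup>2) \<partial>M) \<le>
        (\<Sum>n. ennreal 2 * (\<integral>\<^sup>+x. ?g n x \<partial>M) + ennreal (4 * \<bar>D\<bar> * (1 / \<alpha>) ^ n))"
    proof (intro suminf_le summableI)
      fix n
      have T_sum: "0 \<le> (\<Sum>m<k j n. T m x)" "(\<Sum>m<k j n. T m x) \<le> (\<Sum>m<k j n. real m)" for x
        using T0 Tm by (auto intro: sum_nonneg sum_mono)
      have "integrable M (\<lambda>x. (((\<Sum>m<k j n. T m x) - (\<Sum>m<k j n. e m)) / k j n)\<^sup>2)"
      proof (rule integrable_const_bound)
        show "AE x in M. norm ((((\<Sum>m<k j n. T m x) - (\<Sum>m<k j n. e m)) / k j n)\<^sup>2)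
            \<le> (((\<Sum>m<k j n. real m) + \<bar>\<Sum>m<k j n. e m\<bar>) / k j n)\<^sup>2"
          using T_sum by (intro AE_I2) (auto simp: power_divide intro!: divide_right_mono abs_le_square_iff[THEN iffD1] , smt (verit))
      qed measurable
      then have "(\<integral>\<^sup>+x. ennreal ((((\<Sum>m<k j n. T m x) - (\<Sum>m<k j n. e m)) / k j n)\<^sup>2) \<partial>M) =
          ennreal (expectation (\<lambda>x. (((\<Sum>m<k j n. T m x) - (\<Sum>m<k j n. e m)) / k j n)\<^sup>2))"
        by (intro nn_integral_eq_integral) auto
      also have "\<dots> \<le> ennreal (2 * expectation (?g n) + 4 * \<bar>D\<bar> * (1 / \<alpha>) ^ n)"
        by (intro ennreal_leI bound)
      also have "\<dots> = ennreal 2 * (\<integral>\<^sup>+x. ?g n x \<partial>M) + ennreal (4 * \<bar>D\<bar> * (1 / \<alpha>) ^ n)"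
      proof -
        have "0 \<le> expectation (?g n)" using \<alpha> by (intro integral_nonneg_AE) auto
        moreover have "(\<integral>\<^sup>+x. ?g n x \<partial>M) = ennreal (expectation (?g n))"
          using \<alpha> by (intro nn_integral_eq_integral int_g) auto
        moreover have "0 \<le> 4 * \<bar>D\<bar> * (1 / \<alpha>) ^ n" using \<alpha> by simp
        ultimately show ?thesis by (simp only: ennreal_plus ennreal_mult mult_nonneg_nonneg zero_le_numeral)
      qed
      finally show "(\<integral>\<^sup>+x. ennreal ((((\<Sum>m<k j n. T m x) - (\<Sum>m<k j n. e m)) / k j n)\<^sup>2) \<partial>M) \<le> \<dots>" .
    qed
    also have "\<dots> = ennreal 2 * (\<Sum>n. \<integral>\<^sup>+x. ?g n x \<partial>M) + (\<Sum>n. ennreal (4 * \<bar>D\<bar> * (1 / \<alpha>) ^ n))"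
      by (subst suminf_add[symmetric]) (auto intro: summableI)
    also have "(\<Sum>n. \<integral>\<^sup>+x. ?g n x \<partial>M) = (\<integral>\<^sup>+x. (\<Sum>n. ennreal (?g n x)) \<partial>M)"
      by (rule nn_integral_suminf[symmetric]) measurable
    also have "\<dots> \<le> (\<integral>\<^sup>+x. ennreal (Z 0 x * (\<alpha> / (\<alpha> - 1))) \<partial>M)"
    proof (rule nn_integral_mono)
      fix x
      have "(\<Sum>n. ennreal (?g n x)) = ennreal (\<Sum>n. ?g n x)"
        using \<alpha> nonneg by (intro suminf_ennreal_eq summable_sums geometric_tail_bound) auto
      also have "\<dots> \<le> ennreal (Z 0 x * (\<alpha> / (\<alpha> - 1)))"
        using \<alpha> nonneg by (intro ennreal_leI geometric_tail_bound)
      finally show "(\<Sum>n. ennreal (?g n x)) \<le> ennreal (Z 0 x * (\<alpha> / (\<alpha> - 1)))" .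
    qed
    also have "(\<integral>\<^sup>+x. ennreal (Z 0 x * (\<alpha> / (\<alpha> - 1))) \<partial>M) = ennreal (expectation (\<lambda>x. Z 0 x * (\<alpha> / (\<alpha> - 1))))"
      using \<alpha> nonneg int by (intro nn_integral_eq_integral) auto
    also have "(\<Sum>n. ennreal (4 * \<bar>D\<bar> * (1 / \<alpha>) ^ n)) = ennreal (\<Sum>n. 4 * \<bar>D\<bar> * (1 / \<alpha>) ^ n)"
      using \<alpha> sm by (intro suminf_ennreal_eq summable_sums summable_mult) auto
    finally show "(\<Sum>n. \<integral>\<^sup>+x. ennreal ((((\<Sum>m<k j n. T m x) - (\<Sum>m<k j n. e m)) / k j n)\<^sup>2) \<partial>M) < \<infinity>"
      by (rule le_less_trans) (auto simp: ennreal_mult_less_top ennreal_add_less_top mult_left_mono)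
  qed measurable
  have "AE x in M. \<forall>j. (\<lambda>n. ((\<Sum>m<k j n. T m x) - (\<Sum>m<k j n. e m)) / k j n) \<longlonglongrightarrow> 0"
    using sub by (simp add: AE_all_countable)
  with trunc show ?thesis
  proof eventually_elim
    case (elim x)
    have e_avg: "(\<lambda>n. (\<Sum>m<n. e m) / real n) \<longlonglongrightarrow> expectation (Z 0)"
      by (rule tendsto_averages[OF e_lim])
    have T_lim: "(\<lambda>n. (\<Sum>m<n. T m x) / real n) \<longlonglongrightarrow> expectation (Z 0)"
    proof (rule tendsto_of_geometric_subsequences)
      show "mono (\<lambda>n. \<Sum>m<n. T m x)" by (intro monoI sum_mono2) (auto simp: T0)
      show "0 \<le> (\<Sum>m<n. T m x)" for n by (simp add: T0 sum_nonneg)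
      fix j
      have "filterlim (\<lambda>n. (1 + 1 / real (Suc j)) ^ n) at_top sequentially"
        unfolding filterlim_at_top
      proof
        fix C :: real
        obtain m where m: "C < (1 + 1 / real (Suc j)) ^ m" using real_arch_pow[of "1 + 1 / real (Suc j)" C] by auto
        show "eventually (\<lambda>n. C \<le> (1 + 1 / real (Suc j)) ^ n) sequentially"
          using eventually_ge_at_top[of m]
        proof eventually_elim
          case (elim n)
          show ?case by (rule order_trans[OF less_imp_le[OF m] power_increasing[OF elim]]) simp
        qed
      qed
      then have "filterlim (\<lambda>n. nat \<lfloor>(1 + 1 / real (Suc j)) ^ n\<rfloor>) at_top sequentially"
        by (intro filterlim_compose[OF filterlim_nat_sequentially] filterlim_compose[OF filterlim_floor_sequentially])
      then have k_top: "filterlim (k j) at_top sequentially" by (simp add: k_def[abs_def])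
      have "(\<lambda>n. ((\<Sum>m<k j n. T m x) - (\<Sum>m<k j n. e m)) / k j n + (\<Sum>m<k j n. e m) / k j n) \<longlonglongrightarrow> 0 + expectation (Z 0)"
        using elim(2) by (intro tendsto_add filterlim_compose[OF e_avg k_top]) auto
      then show "(\<lambda>n. (\<Sum>m<nat \<lfloor>(1 + 1 / real (Suc j)) ^ n\<rfloor>. T m x) / real (nat \<lfloor>(1 + 1 / real (Suc j)) ^ n\<rfloor>)) \<longlonglongrightarrow> expectation (Z 0)"
        by (simp add: k_def diff_divide_distrib)
    qed
    have "(\<lambda>m. Z m x - T m x) \<longlonglongrightarrow> 0"
      using elim(1) by (intro tendsto_eventually) (auto elim: eventually_mono)
    from tendsto_add[OF tendsto_averages[OF this] T_lim] show ?case
      by (simp add: sum_subtractf diff_divide_distrib)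
  qed
qed

section \<open>Regeneration levels of integer paths\<close>

definition first_hit :: "(nat \<Rightarrow> int) \<Rightarrow> nat \<Rightarrow> nat \<Rightarrow> bool" where
  "first_hit x m n \<longleftrightarrow> x n = int m \<and> (\<forall>k<n. x k < int m)"

definition shift :: "nat \<Rightarrow> (nat \<Rightarrow> int) \<Rightarrow> nat \<Rightarrow> int" where
  "shift n x = (\<lambda>k. x (n + k) - x n)"

definition Stay :: "(nat \<Rightarrow> int) set" where
  "Stay = {x. \<forall>k. 0 \<le> x k}"

definition regen :: "(nat \<Rightarrow> int) \<Rightarrow> nat \<Rightarrow> bool" where
  "regen x n \<longleftrightarrow> (\<forall>k<n. x k < x n) \<and> (\<forall>k\<ge>n. x n \<le> x k)"

text \<open>The default 0 makes levels without regeneration contribute nothing, so that sums over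
  all levels telescope to times without singling out the regeneration levels.\<close>

definition gap :: "(nat \<Rightarrow> int) \<Rightarrow> nat" where
  "gap x = (if x \<in> Stay \<and> (\<exists>n>0. regen x n) then LEAST n. 0 < n \<and> regen x n else 0)"

text \<open>Climbing by unit steps keeps \<open>n\<close> a regeneration time if it was one, so the
  regeneration structure up to \<open>n\<close> survives the erasure of the future.\<close>

definition prolong :: "nat \<Rightarrow> (nat \<Rightarrow> int) \<Rightarrow> nat \<Rightarrow> int" where
  "prolong n x k = (if k \<le> n then x k else x n + int (k - n))"

text \<open>A series with at most one nonzero term instead of a description of the hitting time: it
  is visibly measurable, can be exchanged with integrals, and is 0 if the level is never
  hit.\<close>

definition at_level :: "((nat \<Rightarrow> int) \<Rightarrow> ennreal) \<Rightarrow> nat \<Rightarrow> (nat \<Rightarrow> int) \<Rightarrow> ennreal" where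
  "at_level \<phi> m x = (\<Sum>n. indicator {x. first_hit x m n} x * \<phi> (shift n x))"

definition level_gap :: "nat \<Rightarrow> (nat \<Rightarrow> int) \<Rightarrow> nat" where
  "level_gap m x = (if \<exists>n. first_hit x m n then gap (shift (THE n. first_hit x m n) x) else 0)"

lemma first_hit_unique: "first_hit x m n \<Longrightarrow> first_hit x m n' \<Longrightarrow> n = n'"
  unfolding first_hit_def by (metis linorder_neqE_nat order_less_irrefl)

lemma first_hit_THE: "first_hit x m n \<Longrightarrow> (THE n. first_hit x m n) = n"
  by (rule the_equality) (auto intro: first_hit_unique)

lemma suminf_first_hit:
  assumes "first_hit x m n"
  shows "(\<Sum>k. indicator {x. first_hit x m k} x * g k) = (g n :: ennreal)"
proof -
  have "(\<Sum>k. indicator {x. first_hit x m k} x * g k) = (\<Sum>k\<in>{n}. indicator {x. first_hit x m k} x * g k)"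
    by (rule suminf_finite) (auto simp: indicator_def dest: first_hit_unique[OF assms])
  then show ?thesis using assms by simp
qed

lemma suminf_no_first_hit:
  assumes "\<nexists>n. first_hit x m n"
  shows "(\<Sum>k. indicator {x. first_hit x m k} x * g k) = (0 :: ennreal)"
  using assms by simp

lemma at_level_eq: "first_hit x m n \<Longrightarrow> at_level \<phi> m x = \<phi> (shift n x)"
  unfolding at_level_def by (rule suminf_first_hit)

lemma at_level_no_hit: "\<nexists>n. first_hit x m n \<Longrightarrow> at_level \<phi> m x = 0"
  unfolding at_level_def by (rule suminf_no_first_hit)

lemma at_level_nonzeroD:
  "at_level \<phi> m x \<noteq> 0 \<Longrightarrow> \<exists>n. first_hit x m n \<and> \<phi> (shift n x) \<noteq> 0"
  by (metis at_level_eq at_level_no_hit)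

lemma level_gap_eq: "first_hit x m n \<Longrightarrow> level_gap m x = gap (shift n x)"
  unfolding level_gap_def using first_hit_THE by auto

lemma regen_iff_first_hit:
  assumes "0 \<le> x n"
  shows "regen x n \<longleftrightarrow> first_hit x (nat (x n)) n \<and> shift n x \<in> Stay"
  using assms unfolding regen_def first_hit_def Stay_def shift_def
  by (auto simp: le_iff_add[of n])

lemma regen_nonneg: "x 0 = 0 \<Longrightarrow> regen x n \<Longrightarrow> 0 \<le> x n"
  unfolding regen_def by (cases "n = 0") (auto intro: less_imp_le)

lemma regen_shift: "regen x n \<Longrightarrow> regen (shift n x) k \<longleftrightarrow> regen x (n + k)"
proof
  assume n: "regen x n" and k: "regen (shift n x) k"
  show "regen x (n + k)"
    unfolding regen_def
  proof safe
    fix i assume i: "i < n + k"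
    show "x i < x (n + k)"
    proof (cases "i < n")
      case True
      then have "x i < x n" using n by (simp add: regen_def)
      also have "x n \<le> x (n + k)" using n by (simp add: regen_def)
      finally show ?thesis .
    next
      case False
      then show ?thesis using k i by (auto simp: regen_def shift_def dest!: spec[of _ "i - n"])
    qed
  next
    fix i assume "n + k \<le> i"
    then show "x (n + k) \<le> x i"
      using k by (auto simp: regen_def shift_def dest!: spec[of _ "i - n"])
  qed
next
  assume "regen x n" "regen x (n + k)"
  then show "regen (shift n x) k" by (auto simp: regen_def shift_def)
qed

lemma regen_less: "regen x n \<Longrightarrow> regen x n' \<Longrightarrow> n < n' \<longleftrightarrow> x n < x n'"
  unfolding regen_def by (metis linorder_not_less)

lemma regen_Stay: "regen x n \<Longrightarrow> shift n x \<in> Stay"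
  by (auto simp: regen_def Stay_def shift_def)

section \<open>Telescoping of gaps and the speed along a single path\<close>

lemma level_gap_pos_imp_regen:
  assumes "0 < level_gap m x"
  shows "\<exists>n. first_hit x m n \<and> regen x n \<and> x n = int m"
proof -
  from assms obtain n where n: "first_hit x m n" unfolding level_gap_def by (auto split: if_splits)
  with assms have "shift n x \<in> Stay" by (auto simp: level_gap_eq gap_def split: if_splits)
  with n have "regen x n" using regen_iff_first_hit[of x n] by (auto simp: first_hit_def)
  with n show ?thesis by (auto simp: first_hit_def)
qed

lemma level_gap_at_regen:
  assumes "regen x n" "0 \<le> x n" "regen x n'" "n < n'" and no: "\<And>k. n < k \<Longrightarrow> k < n' \<Longrightarrow> \<not> regen x k"
  shows "level_gap (nat (x n)) x = n' - n"
proof -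
  have "first_hit x (nat (x n)) n" using assms regen_iff_first_hit by blast
  then have "level_gap (nat (x n)) x = gap (shift n x)" by (rule level_gap_eq)
  also have "gap (shift n x) = (LEAST k. 0 < k \<and> regen (shift n x) k)"
  proof -
    have "\<exists>k>0. regen (shift n x) k"
      using assms(3,4) regen_shift[OF assms(1), of "n' - n"] by (intro exI[of _ "n' - n"]) auto
    then show ?thesis unfolding gap_def using regen_Stay[OF assms(1)] by simp
  qed
  also have "\<dots> = n' - n"
  proof (rule Least_equality)
    show "0 < n' - n \<and> regen (shift n x) (n' - n)" using assms regen_shift[OF assms(1)] by auto
    show "n' - n \<le> k" if "0 < k \<and> regen (shift n x) k" for k
      using that no[of "n + k"] regen_shift[OF assms(1), of k] by (cases "n + k < n'") auto
  qed
  finally show ?thesis .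
qed

lemma sum_level_gap_between:
  assumes "x 0 = 0" "regen x n" "regen x n'" "n < n'" "\<And>k. n < k \<Longrightarrow> k < n' \<Longrightarrow> \<not> regen x k"
  shows "(\<Sum>m<nat (x n'). level_gap m x) = (\<Sum>m<Suc (nat (x n)). level_gap m x)"
proof (rule sum.mono_neutral_right)
  have lt: "x n < x n'" using regen_less[OF assms(2,3)] assms(4) by simp
  have nn: "0 \<le> x n" using regen_nonneg assms by blast
  show "{..<Suc (nat (x n))} \<subseteq> {..<nat (x n')}" using lt nn by auto
  show "\<forall>m\<in>{..<nat (x n')} - {..<Suc (nat (x n))}. level_gap m x = 0"
  proof
    fix m assume m: "m \<in> {..<nat (x n')} - {..<Suc (nat (x n))}"
    show "level_gap m x = 0"
    proof (rule ccontr)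
      assume "level_gap m x \<noteq> 0"
      then obtain k where k: "regen x k" "x k = int m" using level_gap_pos_imp_regen by blast
      with m nn have "x n < x k" "x k < x n'" by auto
      then have "n < k" "k < n'" using regen_less assms k by blast+
      with assms(5) k show False by blast
    qed
  qed
qed simp

text \<open>Each regeneration level contributes the time to the next regeneration, all other levels
  contribute 0. Strong induction peels off the last regeneration before \<open>n\<close>.\<close>

lemma sum_level_gap_upto_regen:
  assumes x0: "x 0 = 0" and n: "regen x n"
  shows "(LEAST k. regen x k) + (\<Sum>m<nat (x n). level_gap m x) = n"
  using n
proof (induction n rule: less_induct)
  case (less n)
  define t where "t = (LEAST k. regen x k)"
  have t: "regen x t" "t \<le> n" unfolding t_def using less.prems by (auto intro: LeastI Least_le)
  show ?case
  proof (cases "t = n")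
    case True
    have "level_gap m x = 0" if "m < nat (x n)" for m
    proof (rule ccontr)
      assume "level_gap m x \<noteq> 0"
      then obtain k where k: "regen x k" "x k = int m" using level_gap_pos_imp_regen by blast
      with that have "x k < x n" by linarith
      then have "k < n" using regen_less k less.prems by blast
      then show False using True k(1) not_less_Least[of k "regen x"] by (simp add: t_def)
    qed
    then show ?thesis using True by (simp add: t_def)
  next
    case False
    define a where "a = Max {k. k < n \<and> regen x k}"
    have fin: "finite {k. k < n \<and> regen x k}" by simp
    have "a \<in> {k. k < n \<and> regen x k}" unfolding a_def using t False by (intro Max_in fin) (auto intro!: exI[of _ t])
    then have a: "a < n" "regen x a" by auto
    have no: "\<not> regen x k" if "a < k" "k < n" for k
      using Max_ge[OF fin, of k, folded a_def] that by auto
    have "(\<Sum>m<nat (x n). level_gap m x) = (\<Sum>m<nat (x a). level_gap m x) + (n - a)"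
      using sum_level_gap_between[OF x0 a(2) less.prems a(1) no]
        level_gap_at_regen[OF a(2) regen_nonneg[OF x0 a(2)] less.prems a(1) no] by simp
    then show ?thesis using less.IH[OF a] a(1) by simp
  qed
qed

text \<open>All gaps started by time \<open>n\<close> lie inside \<open>[0, n]\<close>, except for
  the one in progress at time \<open>n\<close>; the cap \<open>K\<close> is there for that
  one.\<close>

lemma sum_level_gap_le:
  assumes x0: "x 0 = 0"
  shows "(\<Sum>m\<le>n. if \<exists>k\<le>n. first_hit x m k then min (level_gap m x) K else 0) \<le> n + K"
proof (cases "\<exists>k\<le>n. regen x k")
  case False
  have "(if \<exists>k\<le>n. first_hit x m k then min (level_gap m x) K else 0) = 0" for m
    using level_gap_pos_imp_regen[of m x] first_hit_unique[of x m] False by (smt (verit) min_0L neq0_conv)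
  then show ?thesis by simp
next
  case True
  define a where "a = Max {k. k \<le> n \<and> regen x k}"
  have fin: "finite {k. k \<le> n \<and> regen x k}" by simp
  have "a \<in> {k. k \<le> n \<and> regen x k}" unfolding a_def using True by (intro Max_in fin) auto
  then have a: "a \<le> n" "regen x a" by auto
  have max: "k \<le> a" if "k \<le> n" "regen x k" for k
    using Max_ge[OF fin, of k, folded a_def] that by auto
  let ?f = "\<lambda>m. if \<exists>k\<le>n. first_hit x m k then min (level_gap m x) K else 0"
  have zero: "?f m = 0" if "nat (x a) < m" for m
  proof (rule ccontr)
    assume "?f m \<noteq> 0"
    then have *: "\<exists>k\<le>n. first_hit x m k" "0 < level_gap m x" by (auto split: if_splits)
    from level_gap_pos_imp_regen[OF *(2)] obtain k where k: "first_hit x m k" "regen x k" "x k = int m" by blast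
    with * have "k \<le> n" using first_hit_unique by blast
    then have "k \<le> a" using max k by blast
    then have "x k \<le> x a" using k(2) a(2) by (cases "k = a") (auto simp: regen_less le_less)
    then show False using that k(3) by linarith
  qed
  have "(\<Sum>m\<le>n. ?f m) = (\<Sum>m\<in>{..n} \<inter> {..nat (x a)}. ?f m)"
    by (intro sum.mono_neutral_right ballI zero) auto
  also have "\<dots> \<le> (\<Sum>m\<le>nat (x a). ?f m)" by (rule sum_mono2) auto
  also have "\<dots> = (\<Sum>m<nat (x a). ?f m) + ?f (nat (x a))"
    by (simp only: lessThan_Suc_atMost[symmetric] sum.lessThan_Suc)
  also have "\<dots> \<le> (\<Sum>m<nat (x a). level_gap m x) + K"
    by (intro add_mono sum_mono) auto
  also have "\<dots> \<le> n + K" using sum_level_gap_upto_regen[OF x0 a(2)] a(1) by simp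
  finally show ?thesis .
qed

text \<open>Upward steps have size at most one and skip no level, so all levels
  \<open>0, ..., x n\<close> have been hit by time \<open>n\<close>.\<close>

lemma le_card_hit_levels:
  assumes x0: "x 0 = 0" and step: "\<And>n. x (Suc n) \<le> x n + 1"
  shows "x n \<le> (\<Sum>m\<le>n. if \<exists>k\<le>n. first_hit x m k then 1 else 0)"
proof (cases "0 \<le> x n")
  case True
  have le: "x n \<le> int n" for n
  proof (induction n)
    case (Suc n)
    then show ?case using step[of n] by simp
  qed (use x0 in simp)
  have hit: "\<exists>k\<le>n. first_hit x m k" if "m \<le> nat (x n)" for m
  proof -
    define k where "k = (LEAST k. int m \<le> x k)"
    have ex: "int m \<le> x n" using that True by linarith
    have k: "int m \<le> x k" "k \<le> n" unfolding k_def using ex by (auto intro: LeastI Least_le)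
    have lt: "x i < int m" if "i < k" for i using not_less_Least[of i "\<lambda>k. int m \<le> x k"] that by (simp add: k_def)
    have "x k \<le> int m"
    proof (cases k)
      case 0
      then show ?thesis using x0 by simp
    next
      case (Suc i)
      then show ?thesis using lt[of i] step[of i] by simp
    qed
    then show ?thesis using k lt by (auto simp: first_hit_def)
  qed
  have "x n \<le> (\<Sum>m\<le>nat (x n). 1)" using True by simp
  also have "\<dots> = (\<Sum>m\<le>nat (x n). if \<exists>k\<le>n. first_hit x m k then 1 else 0)"
    by (rule sum.cong) (use hit in auto)
  also have "\<dots> \<le> (\<Sum>m\<le>n. if \<exists>k\<le>n. first_hit x m k then 1 else 0)"
    by (rule sum_mono2) (use le[of n] in auto)
  finally show ?thesis .
next
  case False
  have "0 \<le> (\<Sum>m\<le>n. if \<exists>k\<le>n. first_hit x m k then 1 else 0 :: int)" by (intro sum_nonneg) auto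
  with False show ?thesis by linarith
qed

text \<open>Inversion of a renewal limit. Let \<open>a n \<le> n < a' n\<close> be the neighboring
  regeneration times and \<open>A n\<close>, \<open>A' n\<close> their levels. Then
  \<open>x n / n\<close> lies between \<open>A / a'\<close> and \<open>A' / a\<close>, and both
  quotients tend to \<open>1 / \<gamma>\<close>.\<close>

lemma speed_from_level_gaps:
  assumes x0: "x 0 = 0" and \<gamma>: "0 < \<gamma>"
    and lim: "(\<lambda>n. (\<Sum>m<n. real (level_gap m x)) / real n) \<longlonglongrightarrow> \<gamma>"
  shows "(\<lambda>n. real_of_int (x n) / real n) \<longlonglongrightarrow> 1 / \<gamma>"
proof -
  define Q where "Q n = (\<Sum>m<n. level_gap m x)" for n
  have Q: "(\<lambda>n. real (Q n) / real n) \<longlonglongrightarrow> \<gamma>" using lim by (simp add: Q_def)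
  \<comment> \<open>With boundedly many regeneration levels \<open>Q\<close> would be bounded, and
    \<open>Q n / n\<close> would tend to 0 rather than to \<open>\<gamma> > 0\<close>.\<close>
  have unbounded: "\<exists>k. regen x k \<and> C < x k" for C :: nat
  proof (rule ccontr)
    assume no: "\<nexists>k. regen x k \<and> int C < x k"
    have zero: "level_gap m x = 0" if "C < m" for m
      by (rule ccontr) (use level_gap_pos_imp_regen[of m x] no that in auto)
    have "Q n \<le> Q (Suc C)" for n
    proof (cases "n \<le> Suc C")
      case True
      then show ?thesis unfolding Q_def by (intro sum_mono2) auto
    next
      case False
      then have "Q n = Q (Suc C)" unfolding Q_def by (intro sum.mono_neutral_right) (use zero in auto)
      then show ?thesis by simp
    qed
    then have "real (Q n) / real n \<le> real (Q (Suc C)) / real n" for n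
      by (intro divide_right_mono) auto
    moreover have "(\<lambda>n. real (Q (Suc C)) / real n) \<longlonglongrightarrow> 0"
      by (rule real_tendsto_divide_at_top[OF tendsto_const filterlim_real_sequentially])
    ultimately have "\<gamma> \<le> 0" by (intro LIMSEQ_le[OF Q]) auto
    then show False using \<gamma> by simp
  qed
  define t where "t = (LEAST k. regen x k)"
  have Q_regen: "t + Q (nat (x n)) = n" if "regen x n" for n
    using sum_level_gap_upto_regen[OF x0 that] by (simp add: t_def Q_def)
  define a where "a n = Max {k. k \<le> n \<and> regen x k}" for n
  define a' where "a' n = (LEAST k. n < k \<and> regen x k)" for n
  have t: "regen x t" unfolding t_def using unbounded[of 0] by (meson LeastI)
  have fin: "finite {k. k \<le> n \<and> regen x k}" for n by simp
  have a: "a n \<le> n" "regen x (a n)" if "t \<le> n" for n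
  proof -
    have "a n \<in> {k. k \<le> n \<and> regen x k}" unfolding a_def by (rule Max_in[OF fin]) (use that t in auto)
    then show "a n \<le> n" "regen x (a n)" by auto
  qed
  have a_max: "k \<le> a n" if "k \<le> n" "regen x k" for k n
    using Max_ge[OF fin, of k n, folded a_def] that by auto
  have a': "n < a' n" "regen x (a' n)" for n
  proof -
    have "\<exists>k. n < k \<and> regen x k"
    proof -
      define C where "C = nat (Max (x ` {..n}))"
      obtain k where k: "regen x k" "int C < x k" using unbounded by blast
      have "n < k"
      proof (rule ccontr)
        assume "\<not> n < k"
        then have "x k \<le> Max (x ` {..n})" by (intro Max_ge) auto
        then show False using k(2) unfolding C_def by linarith
      qed
      with k show ?thesis by blast
    qed
    from LeastI_ex[OF this] show "n < a' n" "regen x (a' n)" by (auto simp: a'_def)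
  qed
  have a'_min: "\<not> regen x k" if "n < k" "k < a' n" for k n
    using not_less_Least[of k "\<lambda>k. n < k \<and> regen x k"] that by (auto simp: a'_def)
  define A where "A n = nat (x (a n))" for n
  define A' where "A' n = nat (x (a' n))" for n
  have Qa: "real (a n) = t + Q (A n)" if "t \<le> n" for n
    using Q_regen[OF a(2)[OF that]] by (simp add: A_def flip: of_nat_add)
  have Qa': "real (a' n) = t + Q (A' n)" for n
    using Q_regen[OF a'(2)[of n]] by (simp add: A'_def flip: of_nat_add)
  \<comment> \<open>The levels \<open>A n\<close> and \<open>A' n\<close> may be far apart, but
    \<open>Q\<close> is constant between them. Hence \<open>a' n\<close> can be compared with
    \<open>A n\<close> as well as with \<open>A' n\<close>.\<close>
  have QA': "Q (A' n) = Q (Suc (A n))" if "t \<le> n" for n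
    unfolding Q_def A_def A'_def
  proof (rule sum_level_gap_between[OF x0 a(2)[OF that] a'(2)])
    show "a n < a' n" using a(1)[OF that] a'(1)[of n] by simp
    show "\<not> regen x k" if "a n < k" "k < a' n" for k
      using that a_max[of k n] a'_min[of n k] by (cases "k \<le> n") auto
  qed
  have A_le: "int (A n) \<le> x n" if "t \<le> n" for n
    using a[OF that] regen_nonneg[OF x0 a(2)[OF that]] by (auto simp: A_def regen_def)
  have le_A': "x n \<le> int (A' n)" for n
    using a'[of n] by (auto simp: A'_def regen_def)
  have A_less: "A n < A' n" if "t \<le> n" for n
    using regen_less[OF a(2)[OF that] a'(2), of n] a(1)[OF that] a'(1)[of n] regen_nonneg[OF x0 a(2)[OF that]]
    by (auto simp: A_def A'_def)
  have A_top: "filterlim A at_top sequentially"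
    unfolding filterlim_at_top
  proof
    fix C
    obtain k where k: "regen x k" "int C < x k" using unbounded by blast
    show "eventually (\<lambda>n. C \<le> A n) sequentially"
      using eventually_ge_at_top[of "max k t"]
    proof eventually_elim
      case (elim n)
      then have "k \<le> a n" using a_max k by auto
      then have "x k \<le> x (a n)" using k by (auto simp: regen_def)
      then show ?case using k(2) by (simp add: A_def)
    qed
  qed
  have A'_top: "filterlim A' at_top sequentially"
    by (rule filterlim_at_top_mono[OF A_top])
       (use A_less in \<open>auto simp: eventually_sequentially intro!: exI[of _ t] less_imp_le\<close>)
  have A_real: "filterlim (\<lambda>n. real (A n)) at_top sequentially" "filterlim (\<lambda>n. real (A' n)) at_top sequentially"
    using filterlim_compose[OF filterlim_real_sequentially] A_top A'_top by auto
  have ev_t: "eventually (\<lambda>n. t \<le> n) sequentially" by (rule eventually_ge_at_top)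
  have ev_A: "eventually (\<lambda>n. 0 < A n) sequentially"
    using A_top[unfolded filterlim_at_top, rule_format, of 1] by eventually_elim simp
  have 1: "(\<lambda>n. real (a n) / A n) \<longlonglongrightarrow> \<gamma>"
  proof -
    have "(\<lambda>n. t / A n + Q (A n) / A n) \<longlonglongrightarrow> 0 + \<gamma>"
      by (intro tendsto_add filterlim_compose[OF Q A_top] real_tendsto_divide_at_top[OF tendsto_const] A_real)
    moreover have "eventually (\<lambda>n. t / A n + Q (A n) / A n = real (a n) / A n) sequentially"
      using ev_t by eventually_elim (simp add: Qa add_divide_distrib)
    ultimately have "(\<lambda>n. real (a n) / A n) \<longlonglongrightarrow> 0 + \<gamma>" by (rule Lim_transform_eventually)
    then show ?thesis by simp
  qed
  have 2: "(\<lambda>n. real (a' n) / A n) \<longlonglongrightarrow> \<gamma>"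
  proof -
    have "(\<lambda>n. t / A n + (Q (Suc (A n)) / Suc (A n)) * (1 + 1 / A n)) \<longlonglongrightarrow> 0 + \<gamma> * (1 + 0)"
      by (intro tendsto_intros filterlim_compose[OF Q] filterlim_compose[OF filterlim_Suc] A_top
            real_tendsto_divide_at_top[OF tendsto_const] A_real)
    moreover have "eventually (\<lambda>n. t / A n + (Q (Suc (A n)) / Suc (A n)) * (1 + 1 / A n) = real (a' n) / A n) sequentially"
      using ev_t ev_A by eventually_elim (simp add: Qa' QA' divide_simps, simp add: algebra_simps)
    ultimately have "(\<lambda>n. real (a' n) / A n) \<longlonglongrightarrow> 0 + \<gamma> * (1 + 0)" by (rule Lim_transform_eventually)
    then show ?thesis by simp
  qed
  have 3: "(\<lambda>n. real (a' n) / A' n) \<longlonglongrightarrow> \<gamma>"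
  proof -
    have "(\<lambda>n. t / A' n + Q (A' n) / A' n) \<longlonglongrightarrow> 0 + \<gamma>"
      by (intro tendsto_add filterlim_compose[OF Q A'_top] real_tendsto_divide_at_top[OF tendsto_const] A_real)
    then show ?thesis by (simp add: Qa' add_divide_distrib)
  qed
  have pos: "eventually (\<lambda>n. 0 < a n) sequentially"
    using order_tendstoD(1)[OF 1 \<gamma>] by eventually_elim (auto intro: gr0I)
  have lower: "(\<lambda>n. real (A n) / a' n) \<longlonglongrightarrow> 1 / \<gamma>"
    using tendsto_divide[OF tendsto_const[of 1] 2] \<gamma> by simp
  \<comment> \<open>\<open>A'\<close> and \<open>A\<close> are compared only through the times:
    \<open>A' / a\<close> is a quotient of the three ratios whose limits are known.\<close>
  have upper: "(\<lambda>n. real (A' n) / a n) \<longlonglongrightarrow> 1 / \<gamma>"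
  proof -
    have "(\<lambda>n. (real (a' n) / A n) / ((real (a n) / A n) * (real (a' n) / A' n))) \<longlonglongrightarrow> \<gamma> / (\<gamma> * \<gamma>)"
      using \<gamma> by (intro tendsto_intros 1 2 3) auto
    moreover have "eventually (\<lambda>n. (real (a' n) / A n) / ((real (a n) / A n) * (real (a' n) / A' n)) = real (A' n) / a n) sequentially"
      using ev_t ev_A pos
    proof eventually_elim
      case (elim n)
      have "0 < a' n" using a'(1)[of n] by simp
      then show ?case using elim A_less[of n] by (simp add: field_simps)
    qed
    ultimately have "(\<lambda>n. real (A' n) / a n) \<longlonglongrightarrow> \<gamma> / (\<gamma> * \<gamma>)" by (rule Lim_transform_eventually)
    then show ?thesis using \<gamma> by simp
  qed
  show ?thesis
  proof (rule tendsto_sandwich[OF _ _ lower upper])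
    show "eventually (\<lambda>n. real (A n) / real (a' n) \<le> real_of_int (x n) / real n) sequentially"
      using ev_t pos
    proof eventually_elim
      case (elim n)
      have "real (A n) \<le> real_of_int (x n)" using A_le[of n] elim by linarith
      then show ?case using elim a(1)[of n] a'(1)[of n] by (intro frac_le) auto
    qed
    show "eventually (\<lambda>n. real_of_int (x n) / real n \<le> real (A' n) / real (a n)) sequentially"
      using ev_t pos
    proof eventually_elim
      case (elim n)
      have "real_of_int (x n) \<le> real (A' n)" using le_A'[of n] by linarith
      then show ?case using elim a(1)[of n] by (intro frac_le) auto
    qed
  qed
qed

section \<open>Measurability of path functionals\<close>

abbreviation int_paths :: "(nat \<Rightarrow> int) measure" where
  "int_paths \<equiv> PiM UNIV (\<lambda>_. count_space UNIV)"

lemma measurable_coord [measurable]: "(\<lambda>x. x n) \<in> measurable int_paths (count_space UNIV)"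
  by (rule measurable_component_singleton) simp

lemma measurable_coord2: "(\<lambda>x. h (x n) (x k)) \<in> measurable int_paths (count_space UNIV)"
  by (rule measurable_compose_countable[where f = "\<lambda>i x. h i (x k)" and g = "\<lambda>x. x n"])
     (auto intro: measurable_compose[OF measurable_coord])

lemma pred_coord [measurable]:
  "Measurable.pred int_paths (\<lambda>x. x n < c)" "Measurable.pred int_paths (\<lambda>x. c \<le> x n)"
  "Measurable.pred int_paths (\<lambda>x. x n < x k)" "Measurable.pred int_paths (\<lambda>x. x n \<le> x k)"
  "Measurable.pred int_paths (\<lambda>x. x n = c)" "Measurable.pred int_paths (\<lambda>x. x n \<le> x k + c)"
  using measurable_coord2[of "\<lambda>a b. a < c" n n] measurable_coord2[of "\<lambda>a b. c \<le> a" n n]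
    measurable_coord2[of "\<lambda>a b. a < b" n k] measurable_coord2[of "\<lambda>a b. a \<le> b" n k]
    measurable_coord2[of "\<lambda>a b. a = c" n n] measurable_coord2[of "\<lambda>a b. a \<le> b + c" n k]
  by simp_all

lemma sets_negative [measurable, simp]: "{x. x n < 0} \<in> sets int_paths"
  using pred_coord(1)[of n 0] by (simp add: pred_def space_PiM)

lemma measurable_first_hit [measurable]: "Measurable.pred int_paths (\<lambda>x. first_hit x m n)"
  unfolding first_hit_def by measurable

lemma measurable_Stay [measurable]: "Stay \<in> sets int_paths"
proof -
  have "{x \<in> space int_paths. \<forall>k. 0 \<le> x k} \<in> sets int_paths" by measurable
  then show ?thesis by (simp add: Stay_def space_PiM)
qed

lemma measurable_shift [measurable]: "shift n \<in> measurable int_paths int_paths"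
  unfolding shift_def[abs_def] by (intro measurable_abs_UNIV measurable_coord2)

lemma measurable_prolong [measurable]: "prolong n \<in> measurable int_paths int_paths"
  unfolding prolong_def[abs_def]
proof (rule measurable_abs_UNIV)
  fix k
  show "(\<lambda>x. if k \<le> n then x k else x n + int (k - n)) \<in> measurable int_paths (count_space UNIV)"
    using measurable_coord2[of "\<lambda>a b. if k \<le> n then a else b + int (k - n)" k n] by (simp cong: if_cong)
qed

lemma measurable_regen [measurable]: "Measurable.pred int_paths (\<lambda>x. regen x n)"
  unfolding regen_def by measurable

lemma measurable_gap [measurable]: "gap \<in> measurable int_paths (count_space UNIV)"
  unfolding gap_def[abs_def] by measurable

lemma measurable_at_level [measurable]:
  assumes [measurable]: "\<phi> \<in> borel_measurable int_paths"
  shows "at_level \<phi> m \<in> borel_measurable int_paths"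
  unfolding at_level_def[abs_def] by measurable

lemma measurable_level_gap [measurable]: "level_gap m \<in> measurable int_paths (count_space UNIV)"
proof -
  have "Measurable.pred int_paths (\<lambda>x. level_gap m x = g)" for g
  proof -
    have "(\<lambda>x. level_gap m x = g) =
       (\<lambda>x. (\<exists>n. first_hit x m n \<and> gap (shift n x) = g) \<or> ((\<forall>n. \<not> first_hit x m n) \<and> g = 0))"
      by (auto simp: fun_eq_iff level_gap_eq) (auto simp: level_gap_def)
    then show ?thesis by simp
  qed
  then show ?thesis by (subst measurable_count_space_eq2_countable) (auto simp: pred_def vimage_def Int_def conj_commute)
qed

text \<open>\<open>prolong n x\<close> forgets what \<open>x\<close> does after time \<open>n\<close>, so \<open>\<phi>\<close> only depends on the path up to
  any of its positive regeneration times.\<close>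

definition gap_determined :: "((nat \<Rightarrow> int) \<Rightarrow> ennreal) \<Rightarrow> bool" where
  "gap_determined \<phi> \<longleftrightarrow> (\<forall>x n. x \<in> Stay \<longrightarrow> 0 < n \<longrightarrow> regen x n \<longrightarrow> \<phi> (prolong n x) = \<phi> x)"

section \<open>Locality of gap functionals before a regeneration\<close>

lemma first_hit_prolong:
  assumes j: "first_hit x j n" and ij: "i \<le> j"
  shows "first_hit (prolong n x) i k \<longleftrightarrow> first_hit x i k"
proof -
  have 1: "k \<le> n" if "first_hit x i k"
    using that j ij unfolding first_hit_def by (metis le_less_linear linorder_not_less of_nat_mono)
  have 2: "k \<le> n" if "first_hit (prolong n x) i k"
  proof (rule ccontr)
    assume "\<not> k \<le> n"
    then have "prolong n x n < int i" using that by (simp add: first_hit_def)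
    then show False using j ij by (simp add: first_hit_def prolong_def)
  qed
  show ?thesis
  proof (cases "k \<le> n")
    case True
    then show ?thesis by (auto simp: first_hit_def prolong_def)
  qed (use 1 2 in blast)
qed

lemma first_hit_le:
  assumes "first_hit x i k" "first_hit x j n" "i \<le> j"
  shows "k \<le> n"
  using assms unfolding first_hit_def by (metis le_less_linear linorder_not_less of_nat_mono)

lemma first_hit_shift:
  assumes i: "first_hit x i k" and ij: "i \<le> j"
  shows "first_hit (shift k x) (j - i) n \<longleftrightarrow> first_hit x j (k + n)"
proof
  assume h: "first_hit (shift k x) (j - i) n"
  show "first_hit x j (k + n)"
    unfolding first_hit_def
  proof safe
    show "x (k + n) = int j" using h i ij by (simp add: first_hit_def shift_def)
    fix l assume "l < k + n"
    then show "x l < int j"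
    proof (cases "l < k")
      case True
      then have "x l < int i" using i by (simp add: first_hit_def)
      then show ?thesis using ij by simp
    next
      case False
      then show ?thesis
        using h i ij \<open>l < k + n\<close> by (auto simp: first_hit_def shift_def dest!: spec[of _ "l - k"])
    qed
  qed
next
  assume "first_hit x j (k + n)"
  then show "first_hit (shift k x) (j - i) n"
    using i ij by (auto simp: first_hit_def shift_def)
qed

lemma shift_shift: "shift n (shift k x) = shift (k + n) x"
  by (simp add: shift_def add.assoc)

lemma at_level_at_level:
  assumes i: "first_hit x i k" and ij: "i \<le> j"
  shows "at_level \<psi> j x = at_level \<psi> (j - i) (shift k x)"
proof (cases "\<exists>n. first_hit x j n")
  case True
  then obtain n where n: "first_hit x j n" by blast
  then have "k \<le> n" using first_hit_le i ij by blast
  then have "first_hit (shift k x) (j - i) (n - k)" using first_hit_shift[OF i ij, of "n - k"] n by simp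
  then show ?thesis using \<open>k \<le> n\<close> by (simp add: at_level_eq n shift_shift)
next
  case False
  then have "\<nexists>n. first_hit (shift k x) (j - i) n" using first_hit_shift[OF i ij] by blast
  then show ?thesis using False by (simp add: at_level_no_hit)
qed

lemma regen_if_first_hit: "first_hit x j n \<Longrightarrow> shift n x \<in> Stay \<Longrightarrow> regen x n"
  using regen_iff_first_hit[of x n] by (auto simp: first_hit_def)

text \<open>If level \<open>j\<close> regenerates, what happens at a lower level \<open>i\<close>
  can be read off the path up to the hitting time \<open>n\<close> of \<open>j\<close>. Either the
  path seen from \<open>i\<close> lies in \<open>Stay\<close>, and then \<open>n\<close> is one of
  its positive regeneration times; or it drops below its start, which must happen before
  \<open>n\<close>, and both sides vanish.\<close>

lemma at_level_gap_determined:
  assumes \<phi>: "gap_determined \<phi>" "\<And>x. \<phi> x \<noteq> 0 \<Longrightarrow> x \<in> Stay"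
    and i: "i < j" and j: "first_hit x j n" "shift n x \<in> Stay"
  shows "at_level \<phi> i (prolong n x) = at_level \<phi> i x"
proof (cases "\<exists>k. first_hit x i k")
  case True
  then obtain k where k: "first_hit x i k" by blast
  then have k': "first_hit (prolong n x) i k" using first_hit_prolong[OF j(1)] i by simp
  have "k \<le> n" using first_hit_le[OF k j(1)] i by simp
  moreover have "k \<noteq> n" using k j(1) i by (auto simp: first_hit_def)
  ultimately have kn: "k < n" by simp
  have x_n: "regen x n" by (rule regen_if_first_hit[OF j])
  have eq: "shift k (prolong n x) = prolong (n - k) (shift k x)"
    using kn by (auto simp: fun_eq_iff shift_def prolong_def)
  have "\<phi> (prolong (n - k) (shift k x)) = \<phi> (shift k x)"
  proof (cases "shift k x \<in> Stay")
    case True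
    have "regen (shift k x) (n - k)"
      using regen_shift[OF regen_if_first_hit[OF k True], of "n - k"] x_n kn by simp
    then show ?thesis using \<phi>(1) True kn by (simp add: gap_determined_def)
  next
    case False
    have "prolong (n - k) (shift k x) \<notin> Stay"
    proof
      assume *: "prolong (n - k) (shift k x) \<in> Stay"
      have "0 \<le> shift k x l" for l
      proof (cases "l \<le> n - k")
        case True
        then show ?thesis using * by (auto simp: Stay_def prolong_def dest!: spec[of _ l])
      next
        case False
        then have "x n \<le> x (k + l)" using x_n kn by (auto simp: regen_def)
        moreover have "x k < x n" using k j(1) i by (simp add: first_hit_def)
        ultimately show ?thesis by (simp add: shift_def)
      qed
      then show False using False by (simp add: Stay_def)
    qed
    then show ?thesis using False \<phi>(2) by metis
  qed
  then show ?thesis by (simp add: at_level_eq[OF k] at_level_eq[OF k'] eq)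
next
  case False
  then show ?thesis using first_hit_prolong[OF j(1)] i by (simp add: at_level_no_hit)
qed

lemma regen_prolong:
  assumes "regen x n" "k \<le> n"
  shows "regen (prolong n x) k \<longleftrightarrow> regen x k"
proof -
  have "x k \<le> x l" if "n \<le> l" "\<And>l. k \<le> l \<Longrightarrow> x k \<le> prolong n x l" for l
    using that(2)[of n] assms that(1) by (auto simp: prolong_def regen_def intro: order_trans)
  moreover have "x k \<le> prolong n x l" if "\<And>l. k \<le> l \<Longrightarrow> x k \<le> x l" "k \<le> l" for l
    using that(1)[of n] that(1)[of l] assms that(2) by (auto simp: prolong_def)
  ultimately show ?thesis
    using assms unfolding regen_def by (auto simp: prolong_def)
      (metis le_cases order_trans)+
qed

lemma prolong_Stay_iff:
  assumes "regen x n" "0 \<le> x n"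
  shows "prolong n x \<in> Stay \<longleftrightarrow> x \<in> Stay"
  using assms unfolding Stay_def regen_def
  by (auto simp: prolong_def) (metis le_cases order_trans)

lemma gap_prolong:
  assumes "x \<in> Stay" "0 < n" "regen x n"
  shows "gap (prolong n x) = gap x" and "0 < gap x" and "gap x \<le> n" and "regen x (gap x)"
proof -
  have S: "prolong n x \<in> Stay" using prolong_Stay_iff[of x n] assms by (auto simp: Stay_def)
  have n: "regen (prolong n x) n" using regen_prolong[OF assms(3), of n] assms by simp
  have "\<exists>n>0. regen x n" using assms by blast
  then have g: "gap x = (LEAST n. 0 < n \<and> regen x n)" using assms(1) by (simp add: gap_def)
  have *: "0 < gap x \<and> regen x (gap x)" unfolding g by (rule LeastI[of _ n]) (use assms in auto)
  then show "0 < gap x" "regen x (gap x)" by auto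
  show le: "gap x \<le> n" unfolding g by (rule Least_le) (use assms in auto)
  have "\<exists>k>0. regen (prolong n x) k" using n assms(2) by blast
  then have "gap (prolong n x) = (LEAST k. 0 < k \<and> regen (prolong n x) k)" using S by (simp add: gap_def)
  also have "\<dots> = gap x"
  proof (rule Least_equality)
    show "0 < gap x \<and> regen (prolong n x) (gap x)" using * regen_prolong[OF assms(3) le] by simp
    fix k assume k: "0 < k \<and> regen (prolong n x) k"
    show "gap x \<le> k"
    proof (cases "k \<le> n")
      case True
      then have "0 < k \<and> regen x k" using k regen_prolong[OF assms(3)] by simp
      then show ?thesis unfolding g by (rule Least_le)
    qed (use le in simp)
  qed
  finally show "gap (prolong n x) = gap x" .
qed

definition gap_fun :: "(nat \<Rightarrow> real) \<Rightarrow> (nat \<Rightarrow> int) \<Rightarrow> ennreal" where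
  "gap_fun f x = ennreal (f (gap x))"

text \<open>Splits \<open>gap_fun\<close> by the level of the next regeneration, as needed for a
  renewal decomposition in levels.\<close>

definition gap_fun_lev :: "(nat \<Rightarrow> real) \<Rightarrow> nat \<Rightarrow> (nat \<Rightarrow> int) \<Rightarrow> ennreal" where
  "gap_fun_lev f l x = (if x (gap x) = int l then ennreal (f (gap x)) else 0)"

lemma measurable_gap_fun [measurable]: "gap_fun f \<in> borel_measurable int_paths"
  unfolding gap_fun_def[abs_def]
  by (rule measurable_compose[OF measurable_gap]) simp

lemma measurable_gap_fun_lev [measurable]: "gap_fun_lev f l \<in> borel_measurable int_paths"
proof -
  have "(\<lambda>x. if x g = int l then ennreal (f g) else 0) \<in> borel_measurable int_paths" for g
    by measurable
  then show ?thesis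
    unfolding gap_fun_lev_def[abs_def]
    by (rule measurable_compose_countable[where g = gap and f = "\<lambda>g x. if x g = int l then ennreal (f g) else 0", OF _ measurable_gap])
qed

lemma gap_posD: "0 < gap x \<Longrightarrow> x \<in> Stay" "0 < gap x \<Longrightarrow> regen x (gap x)"
proof -
  assume g: "0 < gap x"
  then have ex: "x \<in> Stay" "\<exists>n>0. regen x n" by (auto simp: gap_def split: if_splits)
  then show "x \<in> Stay" by simp
  from ex show "regen x (gap x)" using gap_prolong(4) by blast
qed

lemma gap_fun_Stay: "f 0 = 0 \<Longrightarrow> gap_fun f x \<noteq> 0 \<Longrightarrow> x \<in> Stay"
  and gap_fun_lev_Stay: "f 0 = 0 \<Longrightarrow> gap_fun_lev f l x \<noteq> 0 \<Longrightarrow> x \<in> Stay"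
  using gap_posD(1)[of x] by (cases "gap x = 0"; auto simp: gap_fun_def gap_fun_lev_def split: if_splits)+

lemma gap_determined_gap_fun: "gap_determined (gap_fun f)"
  unfolding gap_determined_def gap_fun_def using gap_prolong(1) by simp

lemma gap_determined_gap_fun_lev: "gap_determined (gap_fun_lev f l)"
  unfolding gap_determined_def gap_fun_lev_def using gap_prolong by (auto simp: prolong_def)

lemma at_level_gap_fun: "f 0 = 0 \<Longrightarrow> at_level (gap_fun f) m x = ennreal (f (level_gap m x))"
  by (cases "\<exists>n. first_hit x m n") (auto simp: at_level_eq at_level_no_hit level_gap_eq gap_fun_def, simp add: level_gap_def)

lemma first_hit_0_iff: "x 0 = 0 \<Longrightarrow> first_hit x 0 n \<longleftrightarrow> n = 0"
  by (auto simp: first_hit_def intro: gr0I)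

lemma at_level_0: "x 0 = 0 \<Longrightarrow> at_level \<phi> 0 x = \<phi> x"
  by (subst at_level_eq[of x 0 0]) (auto simp: first_hit_0_iff shift_def)

lemma first_hit_ge:
  assumes "x 0 = 0" "\<And>n. x (Suc n) \<le> x n + 1" "first_hit x m n"
  shows "m \<le> n"
proof -
  have "x n \<le> int n"
  proof (induction n)
    case (Suc n)
    then show ?case using assms(2)[of n] by simp
  qed (use assms in simp)
  then show ?thesis using assms(3) by (simp add: first_hit_def)
qed

text \<open>Averaging over the environment destroys the Markov property;
  \<open>factorization\<close> is what remains of it. \<open>H\<close> depends on the path up to the
  first visit to level \<open>m\<close>, and \<open>\<phi>\<close> charges only futures that never
  go below that level. \<open>returns\<close> and \<open>growth\<close> are the quantitative inputs,
  for the decay of correlations and for the finiteness of the mean gap.\<close>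

locale regenerative_walk = prob_space M for M :: "(nat \<Rightarrow> int) measure" +
  assumes sets_M [measurable_cong]: "sets M = sets int_paths"
    and start: "AE x in M. x 0 = 0"
    and step: "AE x in M. \<forall>n. x (Suc n) \<le> x n + 1"
    and hits: "AE x in M. \<forall>m. \<exists>n. first_hit x m n"
    and factorization: "\<And>H \<phi> m. H \<in> borel_measurable int_paths \<Longrightarrow> \<phi> \<in> borel_measurable int_paths \<Longrightarrow>
      (\<And>x. \<phi> x \<noteq> 0 \<Longrightarrow> x \<in> Stay) \<Longrightarrow>
      (\<And>x x' n. first_hit x m n \<Longrightarrow> (\<And>k. k \<le> n \<Longrightarrow> x' k = x k) \<Longrightarrow> H x' = H x) \<Longrightarrow>
      (\<integral>\<^sup>+x. H x * at_level \<phi> m x \<partial>M) = (\<integral>\<^sup>+x. H x \<partial>M) * (\<integral>\<^sup>+x. \<phi> x \<partial>M)"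
    and stay_pos: "0 < prob Stay"
    and returns: "summable (\<lambda>n. real (Suc n) * prob {x. x n < 0})"
    and growth: "\<exists>c>0. \<exists>n0. \<forall>n\<ge>n0. ennreal (c * n) \<le> (\<integral>\<^sup>+x. ennreal (real_of_int (x n)) \<partial>M)"
begin

lemma space_M [simp]: "space M = UNIV"
  using sets_eq_imp_space_eq[OF sets_M] by (simp add: space_PiM)

abbreviation p0 :: real where "p0 \<equiv> prob Stay"

lemma nn_integral_Stay: "(\<integral>\<^sup>+x. indicator Stay x \<partial>M) = ennreal p0"
  by (simp add: emeasure_eq_measure)

lemma nn_integral_at_level:
  assumes "\<phi> \<in> borel_measurable int_paths" "\<And>x. \<phi> x \<noteq> 0 \<Longrightarrow> x \<in> Stay"
  shows "(\<integral>\<^sup>+x. at_level \<phi> m x \<partial>M) = (\<integral>\<^sup>+x. \<phi> x \<partial>M)"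
  using factorization[of "\<lambda>_. 1" \<phi> m] assms by (simp add: emeasure_space_1[unfolded space_M])

text \<open>If \<open>j\<close> is a regeneration level, the past at \<open>i\<close> does not
  interact with the future at \<open>j\<close>: evaluated on the prolonged path,
  \<open>at_level \<phi> i\<close> becomes a functional \<open>H\<close> of the path up to the
  hitting of \<open>j\<close>. Applying \<open>factorization\<close> to \<open>H\<close> both with
  \<open>\<psi>\<close> and with the indicator of \<open>Stay\<close> eliminates the integral of
  \<open>H\<close>. Keeping \<open>p0\<close> as a factor avoids a quotient.\<close>

lemma at_level_correlation:
  assumes [measurable]: "\<phi> \<in> borel_measurable int_paths" "\<psi> \<in> borel_measurable int_paths"
    and S: "\<And>x. \<phi> x \<noteq> 0 \<Longrightarrow> x \<in> Stay" "\<And>x. \<psi> x \<noteq> 0 \<Longrightarrow> x \<in> Stay"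
    and det: "gap_determined \<phi>" and ij: "i < j"
  shows "ennreal p0 * (\<integral>\<^sup>+x. at_level \<phi> i x * at_level \<psi> j x \<partial>M) =
    (\<integral>\<^sup>+x. at_level \<phi> i x * at_level (indicator Stay) j x \<partial>M) * (\<integral>\<^sup>+x. \<psi> x \<partial>M)"
proof -
  define H where "H x = (\<Sum>n. indicator {x. first_hit x j n} x * at_level \<phi> i (prolong n x))" for x
  have [measurable]: "H \<in> borel_measurable int_paths" unfolding H_def[abs_def] by measurable
  have H_eq: "H x = at_level \<phi> i (prolong n x)" if "first_hit x j n" for x n
    unfolding H_def by (rule suminf_first_hit[OF that])
  have H_adapted: "H x' = H x" if "first_hit x j n" "\<And>k. k \<le> n \<Longrightarrow> x' k = x k" for x x' n
  proof -
    have "first_hit x' j n" using that by (auto simp: first_hit_def)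
    moreover have "prolong n x' = prolong n x" using that(2) by (auto simp: prolong_def fun_eq_iff)
    ultimately show ?thesis using that(1) by (simp add: H_eq)
  qed
  have swap: "(\<integral>\<^sup>+x. at_level \<phi> i x * at_level \<theta> j x \<partial>M) = (\<integral>\<^sup>+x. H x \<partial>M) * (\<integral>\<^sup>+x. \<theta> x \<partial>M)"
    if [measurable]: "\<theta> \<in> borel_measurable int_paths" and \<theta>: "\<And>x. \<theta> x \<noteq> 0 \<Longrightarrow> x \<in> Stay" for \<theta>
  proof -
    have "at_level \<phi> i x * at_level \<theta> j x = H x * at_level \<theta> j x" for x
    proof (cases "at_level \<theta> j x = 0")
      case False
      then obtain n where n: "first_hit x j n" "shift n x \<in> Stay" using at_level_nonzeroD \<theta> by blast
      then show ?thesis using at_level_gap_determined[OF det S(1) ij n] H_eq[OF n(1)] by simp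
    qed simp
    then have "(\<integral>\<^sup>+x. at_level \<phi> i x * at_level \<theta> j x \<partial>M) = (\<integral>\<^sup>+x. H x * at_level \<theta> j x \<partial>M)" by simp
    also have "\<dots> = (\<integral>\<^sup>+x. H x \<partial>M) * (\<integral>\<^sup>+x. \<theta> x \<partial>M)"
      by (intro factorization \<theta> H_adapted) measurable
    finally show ?thesis .
  qed
  have "indicator Stay x \<noteq> (0::ennreal) \<Longrightarrow> x \<in> Stay" for x by (auto split: split_indicator_asm)
  with swap[of "indicator Stay"] have A:
    "(\<integral>\<^sup>+x. at_level \<phi> i x * at_level (indicator Stay) j x \<partial>M) = (\<integral>\<^sup>+x. H x \<partial>M) * ennreal p0"
    unfolding nn_integral_Stay by measurable
  have B: "(\<integral>\<^sup>+x. at_level \<phi> i x * at_level \<psi> j x \<partial>M) = (\<integral>\<^sup>+x. H x \<partial>M) * (\<integral>\<^sup>+x. \<psi> x \<partial>M)"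
    by (rule swap[OF assms(2)]) (rule S(2))
  show ?thesis unfolding A B by (simp only: mult_ac)
qed

text \<open>Stationarity in the level: the product is itself a functional of the path seen from
  level \<open>i\<close>, supported on \<open>Stay\<close>.\<close>

lemma at_level_correlation_shift:
  assumes [measurable]: "\<phi> \<in> borel_measurable int_paths" "\<psi> \<in> borel_measurable int_paths"
    and S: "\<And>x. \<phi> x \<noteq> 0 \<Longrightarrow> x \<in> Stay" and ij: "i \<le> j"
  shows "(\<integral>\<^sup>+x. at_level \<phi> i x * at_level \<psi> j x \<partial>M) = (\<integral>\<^sup>+x. \<phi> x * at_level \<psi> (j - i) x \<partial>M)"
proof -
  have "at_level \<phi> i x * at_level \<psi> j x = at_level (\<lambda>y. \<phi> y * at_level \<psi> (j - i) y) i x" for x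
  proof (cases "\<exists>k. first_hit x i k")
    case True
    then obtain k where k: "first_hit x i k" by blast
    then show ?thesis by (simp add: at_level_eq[OF k] at_level_at_level[OF k ij])
  qed (simp add: at_level_no_hit)
  then have "(\<integral>\<^sup>+x. at_level \<phi> i x * at_level \<psi> j x \<partial>M) =
      (\<integral>\<^sup>+x. at_level (\<lambda>y. \<phi> y * at_level \<psi> (j - i) y) i x \<partial>M)" by simp
  also have "\<dots> = (\<integral>\<^sup>+x. \<phi> x * at_level \<psi> (j - i) x \<partial>M)"
    using S by (intro nn_integral_at_level) auto
  finally show ?thesis .
qed

section \<open>Returns to the left half plane and decoupling of levels\<close>

definition ret :: "nat \<Rightarrow> real" where
  "ret k = (\<Sum>n. if k \<le> n then prob {x. x n < 0} else 0)"

lemma summable_ret: "summable (\<lambda>n. if k \<le> n then prob {x. x n < 0} else 0)"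
  by (rule summable_comparison_test'[OF returns, of 0]) (auto simp: distrib_right)

lemma ret_nonneg: "0 \<le> ret k"
  unfolding ret_def by (intro suminf_nonneg summable_ret) auto

text \<open>\<open>ret k\<close> is the union bound for being negative at some time from
  \<open>k\<close> on. In the sum over \<open>k\<close> the time \<open>n\<close> is counted at most
  \<open>n + 1\<close> times, which explains the weight in \<open>returns\<close>.\<close>

lemma sum_ret_le: "(\<Sum>k<n. ret k) \<le> (\<Sum>n. real (Suc n) * prob {x. x n < 0})"
proof -
  have "(\<Sum>k<n. ret k) = (\<Sum>i. \<Sum>k<n. if k \<le> i then prob {x. x i < 0} else 0)"
    unfolding ret_def by (rule suminf_sum[symmetric]) (rule summable_ret)
  also have "\<dots> \<le> (\<Sum>i. real (Suc i) * prob {x. x i < 0})"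
  proof (intro suminf_le returns summable_sum summable_ret)
    fix i
    have "(\<Sum>k<n. if k \<le> i then prob {x. x i < 0} else 0) = (\<Sum>k\<in>{..<n} \<inter> {..i}. prob {x. x i < 0})"
      by (subst sum.inter_restrict) auto
    also have "\<dots> \<le> (\<Sum>k\<le>i. prob {x. x i < 0})" by (rule sum_mono2) auto
    finally show "(\<Sum>k<n. if k \<le> i then prob {x. x i < 0} else 0) \<le> real (Suc i) * prob {x. x i < 0}"
      by simp
  qed
  finally show ?thesis .
qed

text \<open>If level \<open>k\<close> regenerates, staying nonnegative forever means staying
  nonnegative until \<open>k\<close> is hit. This event \<open>H\<close> is decided at the hitting
  time and contains \<open>Stay\<close> up to a null set. It exceeds \<open>Stay\<close> only if the
  path becomes negative after that time, which is at least \<open>k\<close>, so the excess costs at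
  most \<open>ret k\<close>.\<close>

lemma Stay_at_level_bounds:
  "ennreal (p0 * p0) \<le> (\<integral>\<^sup>+x. indicator Stay x * at_level (indicator Stay) k x \<partial>M)" (is ?lower)
  "(\<integral>\<^sup>+x. indicator Stay x * at_level (indicator Stay) k x \<partial>M) \<le> ennreal ((p0 + ret k) * p0)" (is ?upper)
proof -
  define H :: "(nat \<Rightarrow> int) \<Rightarrow> ennreal" where
    "H x = (\<Sum>n. indicator {x. first_hit x k n} x * indicator {x. \<forall>i<n. 0 \<le> x i} x)" for x
  have [measurable]: "H \<in> borel_measurable int_paths" unfolding H_def[abs_def] by measurable
  have H_eq: "H x = indicator {x. \<forall>i<n. 0 \<le> x i} x" if "first_hit x k n" for x n
    unfolding H_def by (rule suminf_first_hit[OF that])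
  have H_adapted: "H x' = H x" if "first_hit x k n" "\<And>k. k \<le> n \<Longrightarrow> x' k = x k" for x x' n
  proof -
    have "first_hit x' k n" using that by (auto simp: first_hit_def)
    then show ?thesis using that by (simp add: H_eq indicator_def)
  qed
  have S: "indicator Stay x \<noteq> (0::ennreal) \<Longrightarrow> x \<in> Stay" for x by (auto split: split_indicator_asm)
  have "indicator Stay x * at_level (indicator Stay) k x = H x * at_level (indicator Stay) k x" for x
  proof (cases "at_level (indicator Stay) k x = 0")
    case False
    then obtain n where n: "first_hit x k n" "shift n x \<in> Stay" using at_level_nonzeroD S by blast
    have "x \<in> Stay \<longleftrightarrow> (\<forall>i<n. 0 \<le> x i)"
    proof safe
      assume *: "\<forall>i<n. 0 \<le> x i"
      have "0 \<le> x i" for i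
      proof (cases "i < n")
        case False
        then have "x n \<le> x i" using regen_if_first_hit[OF n] by (simp add: regen_def)
        then show ?thesis using n(1) by (simp add: first_hit_def)
      qed (use * in simp)
      then show "x \<in> Stay" by (simp add: Stay_def)
    qed (simp add: Stay_def)
    then show ?thesis by (simp add: H_eq[OF n(1)] indicator_def)
  qed simp
  then have "(\<integral>\<^sup>+x. indicator Stay x * at_level (indicator Stay) k x \<partial>M) =
      (\<integral>\<^sup>+x. H x * at_level (indicator Stay) k x \<partial>M)" by simp
  also have "\<dots> = (\<integral>\<^sup>+x. H x \<partial>M) * ennreal p0"
    unfolding nn_integral_Stay[symmetric] by (intro factorization S H_adapted) measurable
  finally have eq: "(\<integral>\<^sup>+x. indicator Stay x * at_level (indicator Stay) k x \<partial>M) = (\<integral>\<^sup>+x. H x \<partial>M) * ennreal p0" .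
  have "(\<integral>\<^sup>+x. indicator Stay x \<partial>M) \<le> (\<integral>\<^sup>+x. H x \<partial>M)"
  proof (rule nn_integral_mono_AE)
    show "AE x in M. indicator Stay x \<le> H x"
      using hits
    proof eventually_elim
      case (elim x)
      then obtain n where "first_hit x k n" by blast
      then show ?case by (auto simp: H_eq Stay_def split: split_indicator)
    qed
  qed
  then have "ennreal p0 * ennreal p0 \<le> (\<integral>\<^sup>+x. H x \<partial>M) * ennreal p0"
    unfolding nn_integral_Stay by (intro mult_right_mono) auto
  then show ?lower unfolding eq by (simp add: ennreal_mult)
  have "(\<integral>\<^sup>+x. H x \<partial>M) \<le> (\<integral>\<^sup>+x. indicator Stay x + (\<Sum>n. (if k \<le> n then indicator {x. x n < 0} x else 0)) \<partial>M)"
  proof (rule nn_integral_mono_AE)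
    show "AE x in M. H x \<le> indicator Stay x + (\<Sum>n. if k \<le> n then indicator {x. x n < 0} x else 0)"
      using start step hits
    proof eventually_elim
      case (elim x)
      then obtain n where n: "first_hit x k n" by blast
      have kn: "k \<le> n" using first_hit_ge n elim by blast
      show ?case
      proof (cases "x \<in> Stay \<or> \<not> (\<forall>i<n. 0 \<le> x i)")
        case True
        then show ?thesis by (auto simp: H_eq[OF n] split: split_indicator)
      next
        case False
        then obtain i where i: "x i < 0" "n \<le> i" by (auto simp: Stay_def not_le) (metis linorder_not_le)
        have "(1::ennreal) = (\<Sum>n\<in>{i}. if k \<le> n then indicator {x. x n < 0} x else 0)" using i kn by simp
        also have "\<dots> \<le> (\<Sum>n. if k \<le> n then indicator {x. x n < 0} x else 0)"
          by (rule sum_le_suminf) (auto intro: summableI)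
        finally show ?thesis using H_eq[OF n] by (auto simp: add_increasing split: split_indicator)
      qed
    qed
  qed
  also have "\<dots> = ennreal p0 + (\<Sum>n. \<integral>\<^sup>+x. (if k \<le> n then indicator {x. x n < 0} x else 0) \<partial>M)"
    by (subst nn_integral_add) (auto simp: nn_integral_Stay nn_integral_suminf)
  also have "(\<Sum>n. \<integral>\<^sup>+x. (if k \<le> n then indicator {x. x n < 0} x else 0) \<partial>M) =
      (\<Sum>n. ennreal (if k \<le> n then prob {x. x n < 0} else 0))"
    by (intro suminf_cong) (auto simp: emeasure_eq_measure sets_M)
  also have "\<dots> = ennreal (ret k)"
    unfolding ret_def by (intro suminf_ennreal_eq summable_sums summable_ret) auto
  finally have "(\<integral>\<^sup>+x. H x \<partial>M) \<le> ennreal (p0 + ret k)" by (simp add: ret_nonneg)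
  then show ?upper unfolding eq by (simp add: ennreal_mult ret_nonneg mult_right_mono)
qed

section \<open>The mean gap and its finiteness\<close>

definition mean_gap :: "(nat \<Rightarrow> real) \<Rightarrow> ennreal" where
  "mean_gap f = (\<integral>\<^sup>+x. gap_fun f x \<partial>M)"

lemma nn_integral_level_gap:
  assumes "f 0 = 0"
  shows "(\<integral>\<^sup>+x. ennreal (f (level_gap m x)) \<partial>M) = mean_gap f"
  unfolding mean_gap_def at_level_gap_fun[of f, OF assms, symmetric]
  using gap_fun_Stay[of f, OF assms] by (intro nn_integral_at_level) auto

text \<open>If \<open>k\<close> is a regeneration level of a path in \<open>Stay\<close>, then the first positive regeneration level
  \<open>l\<close> is at most \<open>k\<close>, and the path starts afresh there.\<close>

lemma gap_fun_at_level_le: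
  assumes f: "f 0 = 0" and k: "0 < k"
  shows "(\<integral>\<^sup>+x. gap_fun f x * at_level (indicator Stay) k x \<partial>M) \<le>
    (\<Sum>l=1..k. (\<integral>\<^sup>+x. gap_fun_lev f l x \<partial>M) * ennreal (p0 + ret (k - l)))"
proof -
  have S: "indicator Stay x \<noteq> (0::ennreal) \<Longrightarrow> x \<in> Stay" for x by (auto split: split_indicator_asm)
  have p0: "ennreal p0 \<noteq> 0" using stay_pos by simp
  let ?\<psi> = "\<lambda>l x. indicator Stay x * at_level (indicator Stay) (k - l) x"
  have *: "(\<integral>\<^sup>+x. gap_fun_lev f l x * at_level (indicator Stay) k x \<partial>M) \<le>
      (\<integral>\<^sup>+x. gap_fun_lev f l x \<partial>M) * ennreal (p0 + ret (k - l))" if l: "l \<in> {1..k}" for l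
  proof -
    have reach: "first_hit x l (gap x)" "shift (gap x) x \<in> Stay" if "gap_fun_lev f l x \<noteq> 0" for x
    proof -
      have "0 < gap x" "x (gap x) = int l"
        using that f by (auto simp: gap_fun_lev_def split: if_splits intro: gr0I)
      then show "first_hit x l (gap x)" "shift (gap x) x \<in> Stay"
        using gap_posD(2)[of x] regen_iff_first_hit[of x "gap x"] by auto
    qed
    \<comment> \<open>On the support of \<open>gap_fun_lev f l\<close> the path regenerates at level
      \<open>l\<close>, from where \<open>k\<close> is level \<open>k - l\<close>. Writing the
      factors at levels 0 and \<open>l\<close> brings the integral into the form of
      \<open>at_level_correlation\<close>.\<close>
    have 1: "(\<integral>\<^sup>+x. gap_fun_lev f l x * at_level (indicator Stay) k x \<partial>M) =
        (\<integral>\<^sup>+x. at_level (gap_fun_lev f l) 0 x * at_level (?\<psi> l) l x \<partial>M)"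
    proof (rule nn_integral_cong_AE)
      show "AE x in M. gap_fun_lev f l x * at_level (indicator Stay) k x =
          at_level (gap_fun_lev f l) 0 x * at_level (?\<psi> l) l x"
        using start
      proof eventually_elim
        case (elim x)
        show ?case
        proof (cases "gap_fun_lev f l x = 0")
          case False
          note r = reach[OF False]
          show ?thesis using r(2) l
            by (simp add: at_level_0[of x "gap_fun_lev f l", OF elim] at_level_eq[OF r(1)] at_level_at_level[OF r(1)])
        qed (simp add: at_level_0[of x "gap_fun_lev f l", OF elim])
      qed
    qed
    \<comment> \<open>The factor for regeneration at level \<open>l\<close> equals 1 on the support
      of \<open>gap_fun_lev f l\<close>.\<close>
    have 2: "(\<integral>\<^sup>+x. at_level (gap_fun_lev f l) 0 x * at_level (indicator Stay) l x \<partial>M) =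
        (\<integral>\<^sup>+x. gap_fun_lev f l x \<partial>M)"
    proof (rule nn_integral_cong_AE)
      show "AE x in M. at_level (gap_fun_lev f l) 0 x * at_level (indicator Stay) l x = gap_fun_lev f l x"
        using start
      proof eventually_elim
        case (elim x)
        show ?case
        proof (cases "gap_fun_lev f l x = 0")
          case False
          note r = reach[OF False]
          show ?thesis using r(2) by (simp add: at_level_0[of x "gap_fun_lev f l", OF elim] at_level_eq[OF r(1)])
        qed (simp add: at_level_0[of x "gap_fun_lev f l", OF elim])
      qed
    qed
    have "ennreal p0 * (\<integral>\<^sup>+x. gap_fun_lev f l x * at_level (indicator Stay) k x \<partial>M) =
        (\<integral>\<^sup>+x. gap_fun_lev f l x \<partial>M) * (\<integral>\<^sup>+x. ?\<psi> l x \<partial>M)"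
      unfolding 1 2[symmetric]
    proof (rule at_level_correlation)
      show "gap_fun_lev f l x \<noteq> 0 \<Longrightarrow> x \<in> Stay" for x by (rule gap_fun_lev_Stay[of f, OF f])
      show "?\<psi> l x \<noteq> 0 \<Longrightarrow> x \<in> Stay" for x by (auto split: split_indicator_asm)
      show "gap_determined (gap_fun_lev f l)" by (rule gap_determined_gap_fun_lev)
      show "0 < l" using l by simp
    qed measurable
    also have "\<dots> \<le> (\<integral>\<^sup>+x. gap_fun_lev f l x \<partial>M) * ennreal ((p0 + ret (k - l)) * p0)"
      by (intro mult_left_mono Stay_at_level_bounds) auto
    also have "\<dots> = ennreal p0 * ((\<integral>\<^sup>+x. gap_fun_lev f l x \<partial>M) * ennreal (p0 + ret (k - l)))"
      by (simp add: ennreal_mult ret_nonneg mult_ac del: ennreal_plus)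
    finally show ?thesis using p0 by (simp add: ennreal_mult_le_mult_iff)
  qed
  have "(\<integral>\<^sup>+x. gap_fun f x * at_level (indicator Stay) k x \<partial>M) \<le>
      (\<integral>\<^sup>+x. (\<Sum>l=1..k. gap_fun_lev f l x * at_level (indicator Stay) k x) \<partial>M)"
  proof (rule nn_integral_mono_AE)
    show "AE x in M. gap_fun f x * at_level (indicator Stay) k x \<le>
        (\<Sum>l=1..k. gap_fun_lev f l x * at_level (indicator Stay) k x)"
      using start
    proof eventually_elim
      case (elim x)
      show ?case
      proof (cases "gap_fun f x * at_level (indicator Stay) k x = 0")
        case False
        then have "x \<in> Stay" using gap_fun_Stay[of f x, OF f] by auto
        from False have "at_level (indicator Stay) k x \<noteq> 0" by (metis mult_zero_right)
        from at_level_nonzeroD[OF this] obtain n where n: "first_hit x k n" "shift n x \<in> Stay" using S by blast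
        have "0 < n" using n(1) k elim by (auto simp: first_hit_def intro: gr0I)
        note g = gap_prolong(2-4)[OF \<open>x \<in> Stay\<close> \<open>0 < n\<close> regen_if_first_hit[OF n]]
        define l where "l = nat (x (gap x))"
        have "x 0 < x (gap x)" using g(1,3) by (simp add: regen_def)
        moreover have "x (gap x) \<le> x n" using g(2,3) by (simp add: regen_def)
        ultimately have l: "l \<in> {1..k}" "x (gap x) = int l" using elim n(1) by (auto simp: l_def first_hit_def)
        have "gap_fun f x * at_level (indicator Stay) k x =
            (\<Sum>l\<in>{l}. gap_fun_lev f l x * at_level (indicator Stay) k x)"
          using l by (simp add: gap_fun_def gap_fun_lev_def)
        also have "\<dots> \<le> (\<Sum>l=1..k. gap_fun_lev f l x * at_level (indicator Stay) k x)"
          by (rule sum_mono2) (use l in auto)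
        finally show ?thesis .
      next
        case True
        show ?thesis unfolding True by simp
      qed
    qed
  qed
  also have "\<dots> = (\<Sum>l=1..k. \<integral>\<^sup>+x. gap_fun_lev f l x * at_level (indicator Stay) k x \<partial>M)"
    by (rule nn_integral_sum) measurable
  also have "\<dots> \<le> (\<Sum>l=1..k. (\<integral>\<^sup>+x. gap_fun_lev f l x \<partial>M) * ennreal (p0 + ret (k - l)))"
    by (intro sum_mono *)
  finally show ?thesis .
qed

lemma sum_gap_fun_lev_le:
  assumes "f 0 = 0" "\<And>n. 0 \<le> f n"
  shows "(\<Sum>l=1..k. \<integral>\<^sup>+x. gap_fun_lev f l x \<partial>M) \<le> mean_gap f"
proof -
  have "(\<Sum>l=1..k. gap_fun_lev f l x) \<le> gap_fun f x" for x
  proof (cases "\<exists>l\<in>{1..k}. x (gap x) = int l")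
    case True
    then obtain l where l: "l \<in> {1..k}" "x (gap x) = int l" by blast
    have "(\<Sum>l=1..k. gap_fun_lev f l x) = (\<Sum>l\<in>{l}. gap_fun_lev f l x)"
      by (rule sum.mono_neutral_right) (use l in \<open>auto simp: gap_fun_lev_def\<close>)
    then show ?thesis by (simp add: gap_fun_lev_def gap_fun_def)
  next
    case False
    then have "(\<Sum>l=1..k. gap_fun_lev f l x) = 0" by (intro sum.neutral) (auto simp: gap_fun_lev_def)
    then show ?thesis by simp
  qed
  then have "(\<integral>\<^sup>+x. (\<Sum>l=1..k. gap_fun_lev f l x) \<partial>M) \<le> mean_gap f"
    unfolding mean_gap_def by (rule nn_integral_mono)
  then show ?thesis by (subst (asm) nn_integral_sum) auto
qed

text \<open>Whether level \<open>m\<close> is hit by time \<open>n\<close> is decided when it is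
  hit, so by \<open>factorization\<close> every such level contributes the full mean of the gap
  capped at \<open>K\<close>. The expected number of these levels is at least \<open>c * n\<close>,
  while their capped gaps add up to at most \<open>n + K\<close>. Hence the capped mean is at most
  \<open>2 / c\<close>, uniformly in \<open>K\<close>.\<close>

lemma mean_gap_finite: "mean_gap real < \<infinity>"
proof -
  from growth obtain c n0 where c: "0 < c"
    "\<And>n. n \<ge> n0 \<Longrightarrow> ennreal (c * n) \<le> (\<integral>\<^sup>+x. ennreal (real_of_int (x n)) \<partial>M)" by blast
  define f where "f K n = real (min n K)" for K n
  have f0: "f K 0 = 0" for K by (simp add: f_def)
  have fin: "mean_gap (f K) \<le> ennreal K" for K
  proof -
    have "mean_gap (f K) \<le> (\<integral>\<^sup>+x. ennreal K \<partial>M)"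
      unfolding mean_gap_def gap_fun_def f_def by (intro nn_integral_mono ennreal_leI) auto
    then show ?thesis by (simp add: emeasure_space_1[unfolded space_M])
  qed
  have bound: "ennreal (c * n) * mean_gap (f K) \<le> ennreal (n + K)" if n: "n \<ge> n0" for n K
  proof -
    define H :: "nat \<Rightarrow> (nat \<Rightarrow> int) \<Rightarrow> ennreal" where
      "H m = indicator {x. \<exists>k\<le>n. first_hit x m k}" for m
    have [measurable]: "H m \<in> borel_measurable int_paths" for m
    proof -
      have "Measurable.pred int_paths (\<lambda>x. \<exists>k\<le>n. first_hit x m k)" by measurable
      then have "{x. \<exists>k\<le>n. first_hit x m k} \<in> sets int_paths" by (simp add: pred_def space_PiM)
      then show ?thesis unfolding H_def by simp
    qed
    have H_adapted: "H m x' = H m x" if "first_hit x m i" "\<And>k. k \<le> i \<Longrightarrow> x' k = x k" for x x' m i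
    proof -
      have "first_hit x' m i" using that by (auto simp: first_hit_def)
      with that(1) have "(\<exists>k\<le>n. first_hit x m k) \<longleftrightarrow> i \<le> n" "(\<exists>k\<le>n. first_hit x' m k) \<longleftrightarrow> i \<le> n"
        by (blast dest: first_hit_unique)+
      then show ?thesis by (simp add: H_def indicator_def)
    qed
    have "ennreal (c * n) \<le> (\<integral>\<^sup>+x. ennreal (real_of_int (x n)) \<partial>M)" by (rule c(2)[OF n])
    also have "(\<integral>\<^sup>+x. ennreal (real_of_int (x n)) \<partial>M) \<le> (\<integral>\<^sup>+x. (\<Sum>m\<le>n. H m x) \<partial>M)"
    proof (rule nn_integral_mono_AE)
      show "AE x in M. ennreal (real_of_int (x n)) \<le> (\<Sum>m\<le>n. H m x)"
        using start step
      proof eventually_elim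
        case (elim x)
        have "real_of_int (x n) \<le> real_of_int (\<Sum>m\<le>n. if \<exists>k\<le>n. first_hit x m k then 1 else 0)"
          using le_card_hit_levels[of x n] elim by (intro of_int_le_iff[THEN iffD2]) auto
        also have "\<dots> = (\<Sum>m\<le>n. if \<exists>k\<le>n. first_hit x m k then 1 else 0)"
          by (simp add: of_int_sum if_distrib cong: if_cong)
        finally have "ennreal (real_of_int (x n)) \<le> ennreal (\<Sum>m\<le>n. if \<exists>k\<le>n. first_hit x m k then 1 else 0)"
          by (rule ennreal_leI)
        also have "\<dots> = (\<Sum>m\<le>n. ennreal (if \<exists>k\<le>n. first_hit x m k then 1 else 0))"
          by (rule sum_ennreal[symmetric]) auto
        also have "\<dots> = (\<Sum>m\<le>n. H m x)"
          by (intro sum.cong refl) (auto simp: H_def)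
        finally show ?case .
      qed
    qed
    finally have "ennreal (c * n) * mean_gap (f K) \<le> (\<integral>\<^sup>+x. (\<Sum>m\<le>n. H m x) \<partial>M) * mean_gap (f K)"
      by (rule mult_right_mono) simp
    also have "\<dots> =
        (\<Sum>m\<le>n. (\<integral>\<^sup>+x. H m x \<partial>M) * mean_gap (f K))"
      by (subst nn_integral_sum) (auto simp: sum_distrib_right)
    also have "\<dots> = (\<Sum>m\<le>n. \<integral>\<^sup>+x. H m x * at_level (gap_fun (f K)) m x \<partial>M)"
      unfolding mean_gap_def
      by (intro sum.cong refl factorization[symmetric] H_adapted gap_fun_Stay[of "f K", OF f0]) measurable
    also have "\<dots> = (\<integral>\<^sup>+x. (\<Sum>m\<le>n. H m x * at_level (gap_fun (f K)) m x) \<partial>M)"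
      by (rule nn_integral_sum[symmetric]) measurable
    also have "\<dots> \<le> (\<integral>\<^sup>+x. ennreal (n + K) \<partial>M)"
    proof (rule nn_integral_mono_AE)
      show "AE x in M. (\<Sum>m\<le>n. H m x * at_level (gap_fun (f K)) m x) \<le> ennreal (n + K)"
        using start
      proof eventually_elim
        case (elim x)
        have "(\<Sum>m\<le>n. H m x * at_level (gap_fun (f K)) m x) =
            (\<Sum>m\<le>n. ennreal (real (if \<exists>k\<le>n. first_hit x m k then min (level_gap m x) K else 0)))"
          by (intro sum.cong refl) (auto simp: H_def at_level_gap_fun[of "f K", OF f0] f_def)
        also have "\<dots> = ennreal (real (\<Sum>m\<le>n. if \<exists>k\<le>n. first_hit x m k then min (level_gap m x) K else 0))"
          by (subst sum_ennreal) (auto simp: of_nat_sum)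
        also have "\<dots> \<le> ennreal (n + K)"
          using sum_level_gap_le[of x n K, OF elim] by (intro ennreal_leI of_nat_mono)
        finally show ?case .
      qed
    qed
    also have "\<dots> = ennreal (n + K)" by (simp add: emeasure_space_1[unfolded space_M])
    finally show ?thesis .
  qed
  have "mean_gap (f K) \<le> ennreal (2 / c)" for K
  proof -
    \<comment> \<open>Large enough for \<open>growth\<close>, positive, and at least
      \<open>K\<close>, so that \<open>n + K \<le> 2 * n\<close>.\<close>
    define n where "n = Suc (max n0 K)"
    define y where "y = enn2real (mean_gap (f K))"
    have y: "mean_gap (f K) = ennreal y" "0 \<le> y"
      using fin[of K] le_less_trans[OF fin[of K] ennreal_less_top] by (auto simp: y_def)
    have "ennreal (c * n * y) \<le> ennreal (n + K)"
      using bound[of n K] c(1) y by (simp add: n_def ennreal_mult)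
    then have "c * n * y \<le> n + K" by (subst (asm) ennreal_le_iff) auto
    also have "\<dots> \<le> real n * 2" by (simp add: n_def)
    finally have "real n * (c * y) \<le> real n * 2" by (simp add: mult_ac)
    then have "c * y \<le> 2" by (subst (asm) mult_le_cancel_left_pos) (auto simp: n_def)
    then show ?thesis using c(1) y by (auto intro!: ennreal_leI simp: field_simps)
  qed
  note fK = this
  have "mean_gap real = (\<integral>\<^sup>+x. (SUP K. gap_fun (f K) x) \<partial>M)"
    unfolding mean_gap_def
  proof (rule nn_integral_cong)
    fix x
    show "gap_fun real x = (SUP K. gap_fun (f K) x)"
    proof (rule antisym)
      have "gap_fun real x = gap_fun (f (gap x)) x" by (simp add: gap_fun_def f_def)
      then show "gap_fun real x \<le> (SUP K. gap_fun (f K) x)" by (auto intro: SUP_upper)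
      show "(SUP K. gap_fun (f K) x) \<le> gap_fun real x"
        by (rule SUP_least) (auto simp: gap_fun_def f_def intro!: ennreal_leI)
    qed
  qed
  also have "\<dots> = (SUP K. mean_gap (f K))"
    unfolding mean_gap_def
    by (rule nn_integral_monotone_convergence_SUP)
       (auto simp: incseq_def le_fun_def gap_fun_def f_def intro!: ennreal_leI)
  also have "\<dots> \<le> ennreal (2 / c)" by (rule SUP_least) (rule fK)
  finally show ?thesis by (rule le_less_trans) simp
qed

text \<open>Levels 0 and 1 both regenerate with probability at least \<open>p0 * p0\<close>, and
  then the gap at 0 is at least one.\<close>

lemma mean_gap_pos: "0 < mean_gap real"
proof -
  have "ennreal (p0 * p0) \<le> (\<integral>\<^sup>+x. indicator Stay x * at_level (indicator Stay) 1 x \<partial>M)"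
    by (rule Stay_at_level_bounds)
  also have "\<dots> \<le> mean_gap real"
    unfolding mean_gap_def
  proof (rule nn_integral_mono_AE)
    have S: "indicator Stay x \<noteq> (0::ennreal) \<Longrightarrow> x \<in> Stay" for x by (auto split: split_indicator_asm)
    show "AE x in M. indicator Stay x * at_level (indicator Stay) 1 x \<le> gap_fun real x"
      using start
    proof eventually_elim
      case (elim x)
      show ?case
      proof (cases "indicator Stay x * at_level (indicator Stay) 1 x = 0")
        case False
        then have xS: "x \<in> Stay" by (auto split: split_indicator_asm)
        from False have "at_level (indicator Stay) 1 x \<noteq> 0" by (metis mult_zero_right)
        from at_level_nonzeroD[OF this] obtain n where n: "first_hit x 1 n" "shift n x \<in> Stay" using S by blast
        have "0 < n" using n(1) elim by (auto simp: first_hit_def intro: gr0I)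
        then have "0 < gap x" by (rule gap_prolong(2)[OF xS _ regen_if_first_hit[OF n]])
        then have "ennreal 1 \<le> gap_fun real x" unfolding gap_fun_def by (intro ennreal_leI) simp
        then show ?thesis unfolding at_level_eq[OF n(1)] using xS n by simp
      next
        case True
        show ?thesis unfolding True by simp
      qed
    qed
  qed
  finally have "ennreal (p0 * p0) \<le> mean_gap real" .
  moreover have "0 < ennreal (p0 * p0)" using stay_pos by simp
  ultimately show ?thesis by (rule less_le_trans[rotated])
qed

section \<open>Covariances of the gaps and the law of large numbers\<close>

definition gap_lev_mean :: "nat \<Rightarrow> real" where
  "gap_lev_mean l = enn2real (\<integral>\<^sup>+x. gap_fun_lev real l x \<partial>M)"

definition trunc :: "nat \<Rightarrow> nat \<Rightarrow> real" where
  "trunc m n = (if n \<le> m then real n else 0)"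

lemma trunc_simps [simp]: "trunc m 0 = 0" "0 \<le> trunc m n" "trunc m n \<le> real n" "trunc m n \<le> real m"
  by (auto simp: trunc_def)

lemma mean_gap_trunc_le: "mean_gap (trunc m) \<le> mean_gap real"
  unfolding mean_gap_def gap_fun_def by (intro nn_integral_mono ennreal_leI) simp

lemma mean_gap_trunc: "mean_gap (trunc m) = ennreal (expectation (\<lambda>x. trunc m (level_gap k x)))"
proof -
  have "(\<integral>\<^sup>+x. ennreal (trunc m (level_gap k x)) \<partial>M) = ennreal (expectation (\<lambda>x. trunc m (level_gap k x)))"
    by (intro nn_integral_eq_integral integrable_const_bound[of _ "real m"])
       (auto intro!: measurable_compose[OF measurable_level_gap])
  then show ?thesis by (simp add: nn_integral_level_gap)
qed

lemma gap_fun_lev_trunc_le: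
  "(\<integral>\<^sup>+x. gap_fun_lev (trunc m) l x \<partial>M) \<le> ennreal (gap_lev_mean l)"
proof -
  have "(\<integral>\<^sup>+x. gap_fun_lev real l x \<partial>M) \<le> mean_gap real"
    unfolding mean_gap_def by (intro nn_integral_mono) (auto simp: gap_fun_lev_def gap_fun_def)
  then have "(\<integral>\<^sup>+x. gap_fun_lev real l x \<partial>M) < \<infinity>" using mean_gap_finite by (rule le_less_trans)
  then have "ennreal (gap_lev_mean l) = (\<integral>\<^sup>+x. gap_fun_lev real l x \<partial>M)"
    by (simp add: gap_lev_mean_def)
  moreover have "(\<integral>\<^sup>+x. gap_fun_lev (trunc m) l x \<partial>M) \<le> (\<integral>\<^sup>+x. gap_fun_lev real l x \<partial>M)"
    by (intro nn_integral_mono) (auto simp: gap_fun_lev_def intro!: ennreal_leI)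
  ultimately show ?thesis by simp
qed

lemma gap_lev_mean_nonneg: "0 \<le> gap_lev_mean l"
  by (simp add: gap_lev_mean_def)

lemma sum_gap_lev_mean_le: "(\<Sum>l=1..k. gap_lev_mean l) \<le> enn2real (mean_gap real)"
proof -
  have fin: "(\<integral>\<^sup>+x. gap_fun_lev real l x \<partial>M) < \<infinity>" for l
  proof -
    have "(\<integral>\<^sup>+x. gap_fun_lev real l x \<partial>M) \<le> mean_gap real"
      unfolding mean_gap_def by (intro nn_integral_mono) (auto simp: gap_fun_lev_def gap_fun_def)
    then show ?thesis using mean_gap_finite by (rule le_less_trans)
  qed
  have "ennreal (\<Sum>l=1..k. gap_lev_mean l) = (\<Sum>l=1..k. ennreal (gap_lev_mean l))"
    by (rule sum_ennreal[symmetric]) (rule gap_lev_mean_nonneg)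
  also have "\<dots> = (\<Sum>l=1..k. \<integral>\<^sup>+x. gap_fun_lev real l x \<partial>M)"
    using fin by (intro sum.cong refl) (simp add: gap_lev_mean_def)
  also have "\<dots> \<le> mean_gap real" by (rule sum_gap_fun_lev_le) auto
  finally have "enn2real (ennreal (\<Sum>l=1..k. gap_lev_mean l)) \<le> enn2real (mean_gap real)"
    using mean_gap_finite by (intro enn2real_mono) auto
  then show ?thesis by (simp add: sum_nonneg gap_lev_mean_nonneg)
qed

text \<open>After shifting \<open>i\<close> to 0, let the next regeneration be at level
  \<open>l\<close>. Seen from there, the conditional probability that \<open>j\<close> regenerates
  is at most \<open>p0 + ret (j - i - l)\<close>. The term \<open>p0\<close> reproduces at most the
  product of the means, so only the convolution of \<open>gap_lev_mean\<close> with
  \<open>ret\<close> is left.\<close>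

lemma covariance_bound:
  assumes ij: "i < j"
  shows "expectation (\<lambda>x. trunc i (level_gap i x) * trunc j (level_gap j x))
      - expectation (\<lambda>x. trunc i (level_gap i x)) * expectation (\<lambda>x. trunc j (level_gap j x))
    \<le> (\<Sum>l=1..j - i. gap_lev_mean l * ret (j - i - l)) * (enn2real (mean_gap real) / p0)"
proof -
  define k where "k = j - i"
  define mi where "mi = expectation (\<lambda>x. trunc i (level_gap i x))"
  define mj where "mj = expectation (\<lambda>x. trunc j (level_gap j x))"
  define e where "e = expectation (\<lambda>x. trunc i (level_gap i x) * trunc j (level_gap j x))"
  define w where "w = (\<Sum>l=1..k. gap_lev_mean l * ret (k - l))"
  have [measurable]: "(\<lambda>x. trunc m (level_gap m' x)) \<in> borel_measurable int_paths" for m m'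
    by (rule measurable_compose[OF measurable_level_gap]) simp
  have w: "0 \<le> w" unfolding w_def by (intro sum_nonneg mult_nonneg_nonneg gap_lev_mean_nonneg ret_nonneg)
  have nn: "0 \<le> mi" "0 \<le> mj" "0 \<le> e"
    unfolding mi_def mj_def e_def by (auto intro!: integral_nonneg_AE)
  have mj_le: "mj \<le> enn2real (mean_gap real)"
  proof -
    have "ennreal mj \<le> mean_gap real" using mean_gap_trunc_le[of j] by (simp add: mean_gap_trunc[of j j] mj_def)
    then have "enn2real (ennreal mj) \<le> enn2real (mean_gap real)" using mean_gap_finite by (intro enn2real_mono) auto
    then show ?thesis using nn by simp
  qed
  have "ennreal e = (\<integral>\<^sup>+x. ennreal (trunc i (level_gap i x) * trunc j (level_gap j x)) \<partial>M)"
    unfolding e_def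
    by (intro nn_integral_eq_integral[symmetric] integrable_const_bound[of _ "real i * real j"])
       (auto intro!: mult_mono)
  also have "\<dots> = (\<integral>\<^sup>+x. at_level (gap_fun (trunc i)) i x * at_level (gap_fun (trunc j)) j x \<partial>M)"
    by (simp add: at_level_gap_fun ennreal_mult)
  finally have e_eq: "ennreal e = \<dots>" .
  have "ennreal p0 * ennreal e =
      (\<integral>\<^sup>+x. at_level (gap_fun (trunc i)) i x * at_level (indicator Stay) j x \<partial>M) * (\<integral>\<^sup>+x. gap_fun (trunc j) x \<partial>M)"
    unfolding e_eq
    by (rule at_level_correlation[OF _ _ gap_fun_Stay gap_fun_Stay gap_determined_gap_fun ij]) auto
  also have "(\<integral>\<^sup>+x. at_level (gap_fun (trunc i)) i x * at_level (indicator Stay) j x \<partial>M) =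
      (\<integral>\<^sup>+x. gap_fun (trunc i) x * at_level (indicator Stay) k x \<partial>M)"
    unfolding k_def using ij by (intro at_level_correlation_shift gap_fun_Stay) auto
  also have "(\<integral>\<^sup>+x. gap_fun (trunc j) x \<partial>M) = ennreal mj"
    using mean_gap_trunc[of j j] by (simp add: mj_def mean_gap_def)
  also have "(\<integral>\<^sup>+x. gap_fun (trunc i) x * at_level (indicator Stay) k x \<partial>M) \<le>
      (\<Sum>l=1..k. (\<integral>\<^sup>+x. gap_fun_lev (trunc i) l x \<partial>M) * ennreal (p0 + ret (k - l)))"
    using ij by (intro gap_fun_at_level_le) (auto simp: k_def)
  also have "\<dots> = (\<Sum>l=1..k. \<integral>\<^sup>+x. gap_fun_lev (trunc i) l x \<partial>M) * ennreal p0
      + (\<Sum>l=1..k. (\<integral>\<^sup>+x. gap_fun_lev (trunc i) l x \<partial>M) * ennreal (ret (k - l)))"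
    by (simp add: ret_nonneg distrib_left sum.distrib sum_distrib_right)
  also have "\<dots> \<le> ennreal mi * ennreal p0 + (\<Sum>l=1..k. ennreal (gap_lev_mean l) * ennreal (ret (k - l)))"
  proof (intro add_mono mult_right_mono sum_mono gap_fun_lev_trunc_le)
    show "(\<Sum>l=1..k. \<integral>\<^sup>+x. gap_fun_lev (trunc i) l x \<partial>M) \<le> ennreal mi"
      using sum_gap_fun_lev_le[of "trunc i" k] mean_gap_trunc[of i i] by (simp add: mi_def)
  qed auto
  also have "\<dots> = ennreal (mi * p0 + w)"
    unfolding w_def using nn
    by (simp add: ennreal_mult[symmetric] gap_lev_mean_nonneg ret_nonneg sum_nonneg)
  finally have "ennreal (p0 * e) \<le> ennreal ((mi * p0 + w) * mj)"
    using nn w by (simp add: ennreal_mult mult_right_mono)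
  then have "p0 * e \<le> (mi * p0 + w) * mj" using nn w by (subst (asm) ennreal_le_iff) auto
  then have "p0 * (e - mi * mj) \<le> w * mj" by (simp add: algebra_simps)
  also have "\<dots> \<le> w * enn2real (mean_gap real)" by (intro mult_left_mono mj_le w)
  finally have "e - mi * mj \<le> w * (enn2real (mean_gap real) / p0)"
    using stay_pos by (simp add: field_simps)
  then show ?thesis unfolding e_def mi_def mj_def w_def k_def .
qed

text \<open>The sum of a convolution is at most the product of the sums. The bound does not depend
  on \<open>j\<close>, so the total covariance of \<open>n\<close> levels grows at most
  linearly.\<close>

lemma sum_covariance_weights_le:
  "(\<Sum>i<j. \<Sum>l=1..j - i. gap_lev_mean l * ret (j - i - l)) \<le>
    enn2real (mean_gap real) * (\<Sum>n. real (Suc n) * prob {x. x n < 0})"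
proof -
  have "(\<Sum>i<j. \<Sum>l=1..j - i. gap_lev_mean l * ret (j - i - l)) =
      (\<Sum>k=1..j. \<Sum>l=1..k. gap_lev_mean l * ret (k - l))"
    by (rule sum.reindex_bij_witness[of _ "\<lambda>k. j - k" "\<lambda>i. j - i"]) auto
  also have "\<dots> = (\<Sum>k=1..j. \<Sum>l=1..j. if l \<le> k then gap_lev_mean l * ret (k - l) else 0)"
  proof (rule sum.cong[OF refl])
    fix k assume "k \<in> {1..j}"
    then show "(\<Sum>l=1..k. gap_lev_mean l * ret (k - l)) = (\<Sum>l=1..j. if l \<le> k then gap_lev_mean l * ret (k - l) else 0)"
      by (intro sum.mono_neutral_cong_left) auto
  qed
  also have "\<dots> = (\<Sum>l=1..j. \<Sum>k=1..j. if l \<le> k then gap_lev_mean l * ret (k - l) else 0)"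
    by (rule sum.swap)
  also have "\<dots> \<le> (\<Sum>l=1..j. gap_lev_mean l * (\<Sum>n. real (Suc n) * prob {x. x n < 0}))"
  proof (intro sum_mono)
    fix l assume l: "l \<in> {1..j}"
    have "(\<Sum>k=1..j. if l \<le> k then gap_lev_mean l * ret (k - l) else 0) = (\<Sum>k=l..j. gap_lev_mean l * ret (k - l))"
      using l by (intro sum.mono_neutral_cong_right) auto
    also have "\<dots> = gap_lev_mean l * (\<Sum>k=l..j. ret (k - l))" by (rule sum_distrib_left[symmetric])
    also have "(\<Sum>k=l..j. ret (k - l)) = (\<Sum>k\<in>(\<lambda>k. k - l) ` {l..j}. ret k)"
      by (subst sum.reindex) (auto simp: inj_on_def)
    also have "\<dots> \<le> (\<Sum>k<j. ret k)"
      using l by (intro sum_mono2) (auto simp: ret_nonneg)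
    also have "\<dots> \<le> (\<Sum>n. real (Suc n) * prob {x. x n < 0})" by (rule sum_ret_le)
    finally show "(\<Sum>k=1..j. if l \<le> k then gap_lev_mean l * ret (k - l) else 0) \<le>
        gap_lev_mean l * (\<Sum>n. real (Suc n) * prob {x. x n < 0})"
      by (simp add: mult_left_mono gap_lev_mean_nonneg)
  qed
  also have "\<dots> = (\<Sum>l=1..j. gap_lev_mean l) * (\<Sum>n. real (Suc n) * prob {x. x n < 0})"
    by (rule sum_distrib_right[symmetric])
  also have "\<dots> \<le> enn2real (mean_gap real) * (\<Sum>n. real (Suc n) * prob {x. x n < 0})"
    by (intro mult_right_mono sum_gap_lev_mean_le suminf_nonneg returns) auto
  finally show ?thesis .
qed

theorem law_of_large_numbers:
  "\<exists>v. AE x in M. (\<lambda>n. real_of_int (x n) / real n) \<longlonglongrightarrow> v"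
proof -
  have [measurable]: "(\<lambda>x. real (level_gap m x)) \<in> borel_measurable M" for m
    by (rule measurable_compose[OF measurable_level_gap[unfolded measurable_cong_sets[OF sets_M[symmetric] refl]]]) simp
  define \<gamma> where "\<gamma> = expectation (\<lambda>x. real (level_gap 0 x))"
  have mean: "(\<integral>\<^sup>+x. ennreal (real (level_gap m x)) \<partial>M) = mean_gap real" for m
    by (rule nn_integral_level_gap) simp
  have int: "integrable M (\<lambda>x. real (level_gap 0 x))"
    using mean[of 0] mean_gap_finite by (intro integrableI_bounded) auto
  have "ennreal \<gamma> = mean_gap real"
    unfolding \<gamma>_def mean[of 0, symmetric] by (intro nn_integral_eq_integral[symmetric] int) auto
  then have \<gamma>: "0 < \<gamma>" using mean_gap_pos by (metis ennreal_less_zero_iff)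
  define D where "D = enn2real (mean_gap real) * (\<Sum>n. real (Suc n) * prob {x. x n < 0}) * (enn2real (mean_gap real) / p0)"
  have "AE x in M. (\<lambda>n. (\<Sum>m<n. real (level_gap m x)) / n) \<longlonglongrightarrow> expectation (\<lambda>x. real (level_gap 0 x))"
  proof (rule strong_law_weakly_correlated[where D = D and Z = "\<lambda>m x. real (level_gap m x)"])
    \<comment> \<open>\<open>nn_integral_level_gap\<close> requires \<open>f 0 = 0\<close> and thus
      covers only sets without 0. Since both laws have mass one, sets containing 0 follow by taking
      complements.\<close>
    show "distr M borel (\<lambda>x. real (level_gap m x)) = distr M borel (\<lambda>x. real (level_gap 0 x))" for m
    proof (rule measure_eqI)
      have no_zero: "emeasure M ((\<lambda>x. real (level_gap m x)) -` A \<inter> space M) = mean_gap (\<lambda>n. indicator A (real n))"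
        if [measurable]: "A \<in> sets borel" and "0 \<notin> A" for A m
      proof -
        have "emeasure M ((\<lambda>x. real (level_gap m x)) -` A \<inter> space M) =
            (\<integral>\<^sup>+x. indicator ((\<lambda>x. real (level_gap m x)) -` A \<inter> space M) x \<partial>M)"
          by (rule nn_integral_indicator[symmetric]) measurable
        also have "\<dots> = (\<integral>\<^sup>+x. ennreal (indicator A (real (level_gap m x))) \<partial>M)"
          by (intro nn_integral_cong) (auto split: split_indicator)
        also have "\<dots> = mean_gap (\<lambda>n. indicator A (real n))"
          using that(2) by (intro nn_integral_level_gap) auto
        finally show ?thesis .
      qed
      have D: "emeasure (distr M borel (\<lambda>x. real (level_gap m x))) A = emeasure (distr M borel (\<lambda>x. real (level_gap 0 x))) A"
        if [measurable]: "A \<in> sets borel" and "0 \<notin> A" for A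
        using no_zero[OF that, of m] no_zero[OF that, of 0] by (simp add: emeasure_distr)
      fix A assume "A \<in> sets (distr M borel (\<lambda>x. real (level_gap m x)))"
      then have A [measurable]: "A \<in> sets borel" by simp
      interpret D1: prob_space "distr M borel (\<lambda>x. real (level_gap m x))" by (rule prob_space_distr) measurable
      interpret D2: prob_space "distr M borel (\<lambda>x. real (level_gap 0 x))" by (rule prob_space_distr) measurable
      show "emeasure (distr M borel (\<lambda>x. real (level_gap m x))) A = emeasure (distr M borel (\<lambda>x. real (level_gap 0 x))) A"
      proof (cases "0 \<in> A")
        case True
        have "emeasure (distr M borel (\<lambda>x. real (level_gap m x))) (UNIV - A) = emeasure (distr M borel (\<lambda>x. real (level_gap 0 x))) (UNIV - A)"
          using True by (intro D) auto
        then have "D1.prob (UNIV - A) = D2.prob (UNIV - A)"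
          by (simp add: D1.emeasure_eq_measure D2.emeasure_eq_measure)
        then show ?thesis using D1.prob_compl[of A] D2.prob_compl[of A]
          by (simp add: D1.emeasure_eq_measure D2.emeasure_eq_measure)
      qed (rule D[OF A])
    qed simp
    fix n
    let ?t = "\<lambda>i x. if real (level_gap i x) \<le> real i then real (level_gap i x) else 0"
    have t: "?t i x = trunc i (level_gap i x)" for i x by (simp add: trunc_def)
    have "(\<Sum>j<n. \<Sum>i<j. expectation (\<lambda>x. ?t i x * ?t j x) - expectation (?t i) * expectation (?t j)) \<le>
        (\<Sum>j<n. \<Sum>i<j. (\<Sum>l=1..j - i. gap_lev_mean l * ret (j - i - l)) * (enn2real (mean_gap real) / p0))"
      unfolding t by (intro sum_mono covariance_bound) simp
    also have "\<dots> = (\<Sum>j<n. (\<Sum>i<j. \<Sum>l=1..j - i. gap_lev_mean l * ret (j - i - l)) * (enn2real (mean_gap real) / p0))"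
      by (intro sum.cong refl sum_distrib_right[symmetric])
    also have "\<dots> \<le> (\<Sum>j<n. D)"
      unfolding D_def by (intro sum_mono mult_right_mono sum_covariance_weights_le) simp
    also have "\<dots> = D * n" by simp
    finally show "(\<Sum>j<n. \<Sum>i<j. expectation (\<lambda>x. ?t i x * ?t j x) - expectation (?t i) * expectation (?t j)) \<le> D * n" .
  qed (use int in auto)
  then have "AE x in M. (\<lambda>n. real_of_int (x n) / real n) \<longlonglongrightarrow> 1 / \<gamma>"
    using start
  proof eventually_elim
    case (elim x)
    then show ?case using speed_from_level_gaps \<gamma> by (simp add: \<gamma>_def)
  qed
  then show ?thesis ..
qed

end

section \<open>Green functions and the color of a site\<close>

locale two_vertex =
  fixes \<delta> :: real and b r :: "nat \<Rightarrow> real"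
  assumes \<delta>: "0 \<le> \<delta>" "\<delta> \<le> 1/2"
    and b: "b 1 = 0.3" "b 2 = 1/4" "b 3 = 0.2" "b 4 = 1/4"
    and r: "r 1 = \<delta>" "r 2 = 1/4" "r 3 = 1/2 - \<delta>" "r 4 = 1/4"
begin

section \<open>One-step averages and the minimum principle\<close>

definition jump :: "color \<Rightarrow> nat \<Rightarrow> real" where
  "jump a = (case a of Blue \<Rightarrow> b | Red \<Rightarrow> r)"

definition step_avg :: "(int \<times> int \<Rightarrow> color) \<Rightarrow> (int \<times> int \<Rightarrow> real) \<Rightarrow> int \<times> int \<Rightarrow> real" where
  "step_avg c f z = (\<Sum>i=1..4. jump (c z) i * f (z + axis_unit i))"

lemma axis_unit_simps [simp]:
  "axis_unit 1 = (1, 0)" "axis_unit (Suc 0) = (1, 0)" "axis_unit 2 = (0, 1)"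
  "axis_unit 3 = (-1, 0)" "axis_unit 4 = (0, -1)"
  by (simp_all add: axis_unit_def)

lemma sum_1_4: "(\<Sum>i=1..4. h i) = h 1 + h 2 + h 3 + h (4::nat)" for h :: "nat \<Rightarrow> 'a::comm_monoid_add"
  by (simp add: numeral_eq_Suc add.assoc)

lemma step_avg_eq:
  "step_avg c f z = jump (c z) 1 * f (z + (1, 0)) + f (z + (0, 1)) / 4
     + jump (c z) 3 * f (z + (-1, 0)) + f (z + (0, -1)) / 4"
  unfolding step_avg_def sum_1_4 by (cases "c z") (simp_all add: jump_def b r)

lemma jump_nonneg: "i \<in> {1..4} \<Longrightarrow> 0 \<le> jump a i"
  and jump_sum: "(\<Sum>i=1..4. jump a i) = 1"
proof -
  have I: "{1..4} = {1, 2, 3, 4::nat}" by auto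
  show "i \<in> {1..4} \<Longrightarrow> 0 \<le> jump a i"
    unfolding I using b r \<delta> by (cases a) (auto simp: jump_def)
  show "(\<Sum>i=1..4. jump a i) = 1"
    unfolding sum_1_4 using b r by (cases a) (auto simp: jump_def)
qed

lemma jump_1_3: "0 \<le> jump a 1" "0 \<le> jump a 3" "jump a 1 + jump a 3 = 1/2"
  by (rule jump_nonneg, simp)+ (use b r in \<open>cases a; simp add: jump_def field_simps\<close>)

lemma step_avg_mono:
  assumes "\<And>y. f y \<le> g y"
  shows "step_avg c f z \<le> step_avg c g z"
  unfolding step_avg_def by (intro sum_mono mult_left_mono assms jump_nonneg)

lemma step_avg_const [simp]: "step_avg c (\<lambda>_. k) z = k"
proof -
  have "jump (c z) 1 * k + jump (c z) 3 * k = k / 2"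
    by (metis distrib_right jump_1_3(3) mult.commute times_divide_eq_right mult.right_neutral)
  then show ?thesis by (simp add: step_avg_eq)
qed

lemma step_avg_add: "step_avg c (\<lambda>y. f y + g y) z = step_avg c f z + step_avg c g z"
  by (simp add: step_avg_eq field_simps)

lemma step_avg_diff: "step_avg c (\<lambda>y. f y - g y) z = step_avg c f z - step_avg c g z"
  by (simp add: step_avg_eq field_simps)

lemma step_avg_cmult: "step_avg c (\<lambda>y. k * f y) z = k * step_avg c f z"
  by (simp add: step_avg_eq field_simps)

lemma step_avg_nonneg: "(\<And>y. 0 \<le> f y) \<Longrightarrow> 0 \<le> step_avg c f z"
  using step_avg_mono[of "\<lambda>_. 0" f] by simp

text \<open>A negative infimum \<open>I\<close> would satisfy \<open>s * I \<le> v\<close>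
  everywhere, hence \<open>s * I \<le> I\<close>, which is impossible for \<open>s < 1\<close>: the
  discount plays the part of compactness. The first alternative exempts points where the sign of
  \<open>v\<close> is already known, such as a site at which the equation fails.\<close>

lemma minimum_principle:
  assumes s: "0 \<le> s" "s < 1"
    and bdd: "\<And>y. - B \<le> v y"
    and super: "\<And>y. 0 \<le> v y \<or> s * step_avg c v y \<le> v y"
  shows "0 \<le> v y"
proof -
  define I where "I = (INF y. v y)"
  have below: "bdd_below (range v)" using bdd by (auto intro!: bdd_belowI)
  have I: "I \<le> v y" for y unfolding I_def by (rule cINF_lower[OF below]) simp
  have "0 \<le> I"
  proof (rule ccontr)
    assume neg: "\<not> 0 \<le> I"
    have "s * I \<le> v y" for y
    proof (cases "0 \<le> v y")
      case True
      then show ?thesis using s neg by (meson mult_nonneg_nonpos nle_le order_trans)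
    next
      case False
      have "I \<le> step_avg c v y" using step_avg_mono[of "\<lambda>_. I" v c y] I by simp
      then show ?thesis using super[of y] False s by (meson mult_left_mono order_trans)
    qed
    then have "s * I \<le> I" unfolding I_def by (intro cINF_greatest) auto
    then show False using s neg by (simp add: mult_le_cancel_right1)
  qed
  then show ?thesis using I[of y] by simp
qed

lemma solution_nonneg:
  assumes s: "0 \<le> s" "s < 1" and bdd: "\<And>y. \<bar>u y\<bar> \<le> B" and g: "\<And>y. 0 \<le> g y"
    and eq: "\<And>y. u y = g y + s * step_avg c u y"
  shows "0 \<le> u y"
proof (rule minimum_principle[OF s, of B u c])
  show "- B \<le> u y" for y using bdd[of y] by auto
  show "0 \<le> u y \<or> s * step_avg c u y \<le> u y" for y using eq[of y] g[of y] by auto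
qed

text \<open>In \<open>trans_prob\<close> and the Green functions the target \<open>x\<close> precedes the starting point \<open>y\<close>.\<close>

primrec trans_prob :: "(int \<times> int \<Rightarrow> color) \<Rightarrow> nat \<Rightarrow> int \<times> int \<Rightarrow> int \<times> int \<Rightarrow> real" where
  "trans_prob c 0 x y = (if y = x then 1 else 0)"
| "trans_prob c (Suc n) x y = step_avg c (trans_prob c n x) y"

definition green :: "real \<Rightarrow> (int \<times> int \<Rightarrow> color) \<Rightarrow> int \<times> int \<Rightarrow> int \<times> int \<Rightarrow> real" where
  "green s c x y = (\<Sum>n. s ^ n * trans_prob c n x y)"

text \<open>The kernel of the squared resolvent: \<open>(n + 1) * s ^ n\<close> are the coefficients
  of \<open>1 / (1 - s)^2\<close>. Accordingly it solves the equation of \<open>green\<close> with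
  \<open>green\<close> itself as the source.\<close>

definition green2 :: "real \<Rightarrow> (int \<times> int \<Rightarrow> color) \<Rightarrow> int \<times> int \<Rightarrow> int \<times> int \<Rightarrow> real" where
  "green2 s c x y = (\<Sum>n. real (Suc n) * s ^ n * trans_prob c n x y)"

lemma trans_prob_nonneg: "0 \<le> trans_prob c n x y"
  by (induction n arbitrary: y) (auto intro: step_avg_nonneg)

lemma trans_prob_le_1: "trans_prob c n x y \<le> 1"
proof (induction n arbitrary: y)
  case (Suc n)
  show ?case using step_avg_mono[of "trans_prob c n x" "\<lambda>_. 1" c y] Suc by simp
qed auto

section \<open>Discounted Green functions\<close>

context
  fixes s :: real
  assumes s: "0 \<le> s" "s < 1"
begin

lemma summable_green: "summable (\<lambda>n. s ^ n * trans_prob c n x y)"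
  using s by (intro summable_comparison_test'[OF summable_geometric[of s], of 0])
    (auto simp: abs_mult trans_prob_nonneg trans_prob_le_1 intro!: mult_left_le)

lemma summable_Suc_power: "summable (\<lambda>n. real (Suc n) * s ^ n)"
  using geometric_deriv_sums[of s] s by (simp add: sums_iff)

lemma summable_green2: "summable (\<lambda>n. real (Suc n) * s ^ n * trans_prob c n x y)"
  using s by (intro summable_comparison_test'[OF summable_Suc_power, of 0])
    (auto simp: abs_mult trans_prob_nonneg trans_prob_le_1 intro!: mult_left_le)

lemma green_eq: "green s c x y = (if y = x then 1 else 0) + s * step_avg c (green s c x) y"
proof -
  have "green s c x y = (if y = x then 1 else 0) + (\<Sum>n. s ^ Suc n * trans_prob c (Suc n) x y)"
    unfolding green_def using suminf_split_head[OF summable_green[of c x y]] by simp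
  also have "(\<Sum>n. s ^ Suc n * trans_prob c (Suc n) x y) =
      (\<Sum>n. s * (\<Sum>i=1..4. jump (c y) i * (s ^ n * trans_prob c n x (y + axis_unit i))))"
    by (simp add: step_avg_def sum_distrib_left mult_ac)
  also have "\<dots> = s * (\<Sum>i=1..4. jump (c y) i * green s c x (y + axis_unit i))"
    unfolding green_def
    by (subst suminf_mult)
       (auto simp: suminf_sum suminf_mult summable_green intro!: summable_sum summable_mult)
  finally show ?thesis by (simp add: step_avg_def)
qed

lemma green2_eq: "green2 s c x y = green s c x y + s * step_avg c (green2 s c x) y"
proof -
  have sm: "summable (\<lambda>n. real n * s ^ n * trans_prob c n x y)" for y
    using summable_diff[OF summable_green2[of c x y] summable_green[of c x y]] by (simp add: algebra_simps)
  have "green2 s c x y = (\<Sum>n. s ^ n * trans_prob c n x y + real n * s ^ n * trans_prob c n x y)"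
    unfolding green2_def by (simp add: algebra_simps)
  also have "\<dots> = green s c x y + (\<Sum>n. real n * s ^ n * trans_prob c n x y)"
    unfolding green_def by (rule suminf_add[OF summable_green sm, symmetric])
  also have "(\<Sum>n. real n * s ^ n * trans_prob c n x y) =
      (\<Sum>n. real (Suc n) * s ^ Suc n * trans_prob c (Suc n) x y)"
    using suminf_split_head[OF sm[of y]] by simp
  also have "\<dots> = (\<Sum>n. s * (\<Sum>i=1..4. jump (c y) i * (real (Suc n) * s ^ n * trans_prob c n x (y + axis_unit i))))"
    by (simp add: step_avg_def sum_distrib_left mult_ac del: of_nat_Suc)
  also have "\<dots> = s * (\<Sum>i=1..4. jump (c y) i * green2 s c x (y + axis_unit i))"
    unfolding green2_def
    by (subst suminf_mult)
       (auto simp: suminf_sum suminf_mult summable_green2 simp del: of_nat_Suc intro!: summable_sum summable_mult)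
  finally show ?thesis by (simp add: step_avg_def)
qed

lemma green_bounds: "0 \<le> green s c x y" "green s c x y \<le> 1 / (1 - s)"
proof -
  show "0 \<le> green s c x y"
    unfolding green_def using s by (intro suminf_nonneg summable_green) (auto simp: trans_prob_nonneg)
  have "green s c x y \<le> (\<Sum>n. s ^ n)"
    unfolding green_def using s
    by (intro suminf_le summable_green summable_geometric) (auto simp: trans_prob_le_1 intro!: mult_left_le)
  then show "green s c x y \<le> 1 / (1 - s)" using s by (simp add: suminf_geometric)
qed

lemma green2_bounds: "0 \<le> green2 s c x y" "green2 s c x y \<le> 1 / (1 - s)\<^sup>2"
proof -
  show "0 \<le> green2 s c x y"
    unfolding green2_def using s by (intro suminf_nonneg summable_green2) (auto simp: trans_prob_nonneg)
  have "green2 s c x y \<le> (\<Sum>n. real (Suc n) * s ^ n)"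
    unfolding green2_def using s
    by (intro suminf_le summable_green2 summable_Suc_power) (auto simp: trans_prob_le_1 intro!: mult_left_le)
  then show "green2 s c x y \<le> 1 / (1 - s)\<^sup>2" using geometric_deriv_sums[of s] s by (simp add: sums_iff)
qed

lemma green_diag_ge_1: "1 \<le> green s c x x"
  using green_eq[of c x x] step_avg_nonneg[of "green s c x" c x] green_bounds s by simp

end

text \<open>The solution \<open>u'\<close> splits as \<open>A + u' z * H\<close>, where \<open>H\<close> is the probability of hitting \<open>z\<close>
  and \<open>A\<close> the part accumulated before that; neither depends on the color of \<open>z\<close>. A blue neighbor
  above \<open>z\<close> offers a way around \<open>z\<close> to either horizontal neighbor, so that escaping from \<open>z\<close> is
  at most a constant factor harder when \<open>z\<close> is red.\<close>

lemma flip_comparison: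
  assumes s: "1/2 \<le> s" "s < 1"
    and up: "c (z + (0, 1)) = Blue"
    and g: "\<And>y. 0 \<le> g y"
    and bdd: "\<And>y. \<bar>u y\<bar> \<le> B" "\<And>y. \<bar>u' y\<bar> \<le> B"
    and u: "\<And>y. u y \<le> g y + s * step_avg c u y"
    and u': "\<And>y. u' y = g y + s * step_avg (c(z := Blue)) u' y"
  shows "u y \<le> 330 * u' y"
proof -
  define c' where "c' = c(z := Blue)"
  have s0: "0 \<le> s" using s by simp
  have off: "step_avg c f y = step_avg c' f y" if "y \<noteq> z" for f y
    using that by (simp add: step_avg_eq c'_def)
  have u'_nonneg: "0 \<le> u' y" for y
    by (rule solution_nonneg[OF s0 s(2) bdd(2) g u'])
  let ?G = "green s c' z"
  have Gz: "1 \<le> ?G z" by (rule green_diag_ge_1[OF s0 s(2)])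
  define H where "H y = ?G y / ?G z" for y
  have Hz: "H z = 1" using Gz by (simp add: H_def)
  have H_nonneg: "0 \<le> H y" for y using green_bounds(1)[OF s0 s(2)] Gz by (simp add: H_def)
  have H_eq: "H y = s * step_avg c' H y" if "y \<noteq> z" for y
    using green_eq[OF s0 s(2), of c' z y] that step_avg_cmult[of c' "inverse (?G z)" ?G y]
    by (simp add: H_def[abs_def] divide_inverse mult_ac)
  have H_bdd: "\<bar>H y\<bar> \<le> 1 / (1 - s)" for y
  proof -
    have "?G y / ?G z \<le> ?G y" using Gz mult_left_mono[OF Gz green_bounds(1)[OF s0 s(2), of c' z y]] by (simp add: divide_le_eq)
    then show ?thesis using H_nonneg[of y] green_bounds(2)[OF s0 s(2), of c' z y] by (simp add: H_def)
  qed
  \<comment> \<open>The discounted probability of never reaching \<open>z\<close>, with killing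
    counted as an escape; it is superharmonic away from \<open>z\<close>.\<close>
  define \<beta> where "\<beta> y = 1 - H y" for y
  have \<beta>_avg: "step_avg a \<beta> y = 1 - step_avg a H y" for a y
    unfolding \<beta>_def by (simp add: step_avg_diff)
  have \<beta>_super: "s * step_avg c' \<beta> y \<le> \<beta> y" if "y \<noteq> z" for y
    using H_eq[OF that] s by (simp add: \<beta>_avg algebra_simps \<beta>_def)
  have \<beta>_nonneg: "0 \<le> \<beta> y" for y
  proof (rule minimum_principle[OF s0 s(2)])
    show "- (1 / (1 - s)) \<le> \<beta> y" for y using H_bdd[of y] by (auto simp: \<beta>_def abs_le_iff)
    show "0 \<le> \<beta> y \<or> s * step_avg c' \<beta> y \<le> \<beta> y" for y
      using \<beta>_super[of y] Hz by (cases "y = z") (auto simp: \<beta>_def)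
  qed
  define A where "A y = u' y - u' z * H y" for y
  have A_eq: "A y = g y + s * step_avg c' A y" if "y \<noteq> z" for y
    using u'[of y] H_eq[OF that] unfolding A_def c'_def[symmetric] step_avg_diff step_avg_cmult
    by (simp add: algebra_simps)
  have A_bdd: "\<bar>A y\<bar> \<le> B + B * (1 / (1 - s))" for y
  proof -
    have "\<bar>u' z * H y\<bar> \<le> B * (1 / (1 - s))"
      unfolding abs_mult using bdd(2)[of z] H_bdd[of y] by (intro mult_mono) auto
    then show ?thesis using bdd(2)[of y] by (simp add: A_def)
  qed
  have A_nonneg: "0 \<le> A y" for y
  proof (rule minimum_principle[OF s0 s(2)])
    show "- (B + B * (1 / (1 - s))) \<le> A y" for y using A_bdd[of y] by (simp add: abs_le_iff)
    show "0 \<le> A y \<or> s * step_avg c' A y \<le> A y" for y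
      using A_eq[of y] g[of y] Hz by (cases "y = z") (auto simp: A_def)
  qed
  \<comment> \<open>From the blue site above \<open>z\<close>, step sideways and then down. The
    sideways step has probability \<open>3/10\<close> or \<open>1/5\<close>, the downward one
    \<open>1/4\<close> whatever the color of its site, and two discounts contribute at least
    \<open>1/4\<close>.\<close>
  have around: "\<beta> (z + (0, 1)) \<ge> 3/160 * \<beta> (z + (1, 0))" "\<beta> (z + (0, 1)) \<ge> 1/80 * \<beta> (z + (-1, 0))"
  proof -
    have ss: "1/4 \<le> s * s" using mult_mono[of "1/2" s "1/2" s] s by simp
    have jb: "jump Blue 1 = 3/10" "jump Blue 3 = 1/5" using b by (simp_all add: jump_def)
    have c'up: "c' (z + (0, 1)) = Blue" using up by (simp add: c'_def)
    have lower: "s * (jump (c' y) 1 * \<beta> (y + (1, 0))) \<le> \<beta> y"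
        "s * (jump (c' y) 3 * \<beta> (y + (-1, 0))) \<le> \<beta> y"
        "s * (\<beta> (y + (0, -1)) / 4) \<le> \<beta> y" if "y \<noteq> z" for y
    proof -
      have *: "s * (jump (c' y) 1 * \<beta> (y + (1, 0)) + \<beta> (y + (0, 1)) / 4
          + jump (c' y) 3 * \<beta> (y + (-1, 0)) + \<beta> (y + (0, -1)) / 4) \<le> \<beta> y"
        using \<beta>_super[OF that] by (simp add: step_avg_eq)
      have nn: "0 \<le> jump (c' y) 1 * \<beta> (y + (1, 0))" "0 \<le> jump (c' y) 3 * \<beta> (y + (-1, 0))"
          "0 \<le> \<beta> (y + (0, 1)) / 4" "0 \<le> \<beta> (y + (0, -1)) / 4"
        using \<beta>_nonneg jump_1_3 by simp_all
      show "s * (jump (c' y) 1 * \<beta> (y + (1, 0))) \<le> \<beta> y"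
        by (rule order_trans[OF mult_left_mono *]) (use nn s0 in auto)
      show "s * (jump (c' y) 3 * \<beta> (y + (-1, 0))) \<le> \<beta> y"
        by (rule order_trans[OF mult_left_mono *]) (use nn s0 in auto)
      show "s * (\<beta> (y + (0, -1)) / 4) \<le> \<beta> y"
        by (rule order_trans[OF mult_left_mono *]) (use nn s0 in auto)
    qed
    have ne: "z + (0, 1) \<noteq> z" "z + (1, 1) \<noteq> z" "z + (-1, 1) \<noteq> z"
      by (cases z, simp)+
    have e: "z + (0, 1) + (1, 0) = z + (1, 1)" "z + (0, 1) + (-1, 0) = z + (-1, 1)"
        "z + (1, 1) + (0, -1) = z + (1, 0)" "z + (-1, 1) + (0, -1) = z + (-1, 0)"
      by (cases z, simp)+
    have "s * (3/10 * (s * (\<beta> (z + (1, 0)) / 4))) \<le> s * (3/10 * \<beta> (z + (1, 1)))"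
      using lower(3)[OF ne(2)] s0 by (intro mult_left_mono) (auto simp: e)
    also have "\<dots> \<le> \<beta> (z + (0, 1))"
      using lower(1)[OF ne(1)] unfolding c'up e jb by simp
    finally have 1: "s * s * (3/40 * \<beta> (z + (1, 0))) \<le> \<beta> (z + (0, 1))" by simp
    have "1/4 * (3/40 * \<beta> (z + (1, 0))) \<le> s * s * (3/40 * \<beta> (z + (1, 0)))"
      using ss \<beta>_nonneg by (intro mult_right_mono) auto
    with 1 show "\<beta> (z + (0, 1)) \<ge> 3/160 * \<beta> (z + (1, 0))" by simp
    have "s * (1/5 * (s * (\<beta> (z + (-1, 0)) / 4))) \<le> s * (1/5 * \<beta> (z + (-1, 1)))"
      using lower(3)[OF ne(3)] s0 by (intro mult_left_mono) (auto simp: e)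
    also have "\<dots> \<le> \<beta> (z + (0, 1))"
      using lower(2)[OF ne(1)] unfolding c'up e jb by simp
    finally have 1: "s * s * (1/20 * \<beta> (z + (-1, 0))) \<le> \<beta> (z + (0, 1))" by simp
    have "1/4 * (1/20 * \<beta> (z + (-1, 0))) \<le> s * s * (1/20 * \<beta> (z + (-1, 0)))"
      using ss \<beta>_nonneg by (intro mult_right_mono) auto
    with 1 show "\<beta> (z + (0, 1)) \<ge> 1/80 * \<beta> (z + (-1, 0))" by simp
  qed
  \<comment> \<open>A solution takes the value \<open>N / D\<close> at \<open>z\<close>:
    \<open>N\<close> collects the source until the return to \<open>z\<close>, and \<open>D\<close>
    is the discounted probability of no return. The color of \<open>z\<close> enters only through
    the first step.\<close>
  define D D' N N' where defs: "D = 1 - s * step_avg c H z" "D' = 1 - s * step_avg c' H z"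
    "N = g z + s * step_avg c A z" "N' = g z + s * step_avg c' A z"
  have D_eq: "D = (1 - s) + s * step_avg c \<beta> z" "D' = (1 - s) + s * step_avg c' \<beta> z"
    by (simp_all add: defs \<beta>_avg algebra_simps)
  have D_pos: "0 < D" "0 < D'"
    using step_avg_nonneg[of \<beta> c z] step_avg_nonneg[of \<beta> c' z] \<beta>_nonneg s by (simp_all add: D_eq add_pos_nonneg)
  have jz: "jump (c' z) 1 = 3/10" "jump (c' z) 3 = 1/5" using b by (simp_all add: jump_def c'_def)
  \<comment> \<open>By \<open>around\<close>, each horizontal term on the left is at most 16 times
    \<open>\<beta>\<close> at the upper neighbor. With the vertical term this makes
    \<open>32 + 1/4\<close>, while the right side offers \<open>132/4 = 33\<close>.\<close>
  have "step_avg c' \<beta> z \<le> 132 * step_avg c \<beta> z"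
    using around \<beta>_nonneg[of "z + (0, 1)"] \<beta>_nonneg[of "z + (1, 0)"] \<beta>_nonneg[of "z + (-1, 0)"] \<beta>_nonneg[of "z + (0, -1)"]
      mult_nonneg_nonneg[OF jump_1_3(1)[of "c z"] \<beta>_nonneg[of "z + (1, 0)"]]
      mult_nonneg_nonneg[OF jump_1_3(2)[of "c z"] \<beta>_nonneg[of "z + (-1, 0)"]]
    unfolding step_avg_eq jz by (simp only: distrib_left)
  then have "s * step_avg c' \<beta> z \<le> s * (132 * step_avg c \<beta> z)"
    using s0 by (rule mult_left_mono)
  then have "s * step_avg c' \<beta> z \<le> 132 * (s * step_avg c \<beta> z)"
    by (subst mult.left_commute)
  then have D: "D' \<le> 132 * D" unfolding D_eq distrib_left using s by (intro add_mono) auto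
  \<comment> \<open>\<open>2/5\<close> is the worst ratio of a blue to a red jump probability:
    \<open>1/5\<close> against \<open>1/2\<close>, for the left step with
    \<open>\<delta> = 0\<close>. This direction of the comparison tolerates a red entry 0.\<close>
  have "2/5 * step_avg c A z \<le> step_avg c' A z"
  proof (cases "c z")
    case Blue
    then have "c' = c" by (auto simp: c'_def)
    then show ?thesis using step_avg_nonneg[of A c z] A_nonneg by simp
  next
    case Red
    have jr: "jump (c z) 1 = \<delta>" "jump (c z) 3 = 1/2 - \<delta>" using Red r by (simp_all add: jump_def)
    have "2/5 * \<delta> * A (z + (1, 0)) \<le> 3/10 * A (z + (1, 0))"
      "2/5 * (1/2 - \<delta>) * A (z + (-1, 0)) \<le> 1/5 * A (z + (-1, 0))"
      using \<delta> A_nonneg by (intro mult_right_mono; simp)+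
    then show ?thesis
      using A_nonneg[of "z + (0, 1)"] A_nonneg[of "z + (0, -1)"]
      unfolding step_avg_eq jz jr by (simp add: algebra_simps)
  qed
  then have "s * (2/5 * step_avg c A z) \<le> s * step_avg c' A z"
    using s0 by (rule mult_left_mono)
  then have N: "2/5 * N \<le> N'" using g[of z] by (simp add: defs)
  have N_nonneg: "0 \<le> N" using g[of z] step_avg_nonneg[of A c z] A_nonneg s0 by (simp add: defs)
  have u'z: "u' z * D' = N'"
    using u'[of z] unfolding defs A_def c'_def[symmetric] step_avg_diff step_avg_cmult
    by (simp add: algebra_simps)
  \<comment> \<open>The value at \<open>z\<close> for the original color; the two comparisons
    combine to \<open>330 = 132 * 5/2\<close>.\<close>
  define t where "t = N / D"
  have t_nonneg: "0 \<le> t" using N_nonneg D_pos by (simp add: t_def)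
  have "t * D' \<le> t * (132 * D)" using D t_nonneg by (rule mult_left_mono)
  also have "\<dots> = 132 * N" using D_pos by (simp add: t_def)
  also have "\<dots> \<le> 330 * u' z * D'" using N unfolding u'z[symmetric] by (simp add: mult_ac)
  finally have t: "t \<le> 330 * u' z" using D_pos by simp
  \<comment> \<open>The solution for \<open>c\<close>, assembled from the same \<open>A\<close> and
    \<open>H\<close> with \<open>t\<close> in place of \<open>u' z\<close>. It dominates
    \<open>u\<close>, which is only assumed to be a subsolution.\<close>
  define v where "v y = A y + t * H y" for y
  have "v y = g y + s * step_avg c v y" for y
  proof (cases "y = z")
    case True
    have "A z = 0" using Hz by (simp add: A_def)
    then have "v z = t" using Hz by (simp add: v_def)
    moreover have "t * D = N" using D_pos by (simp add: t_def)
    ultimately show ?thesis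
      using True unfolding defs v_def step_avg_add step_avg_cmult by (simp add: algebra_simps)
  next
    case False
    then show ?thesis using A_eq[OF False] H_eq[OF False] unfolding off[OF False]
      unfolding v_def step_avg_add step_avg_cmult by (simp add: algebra_simps)
  qed
  note v_eq = this
  have "0 \<le> v y - u y" for y
  proof (rule minimum_principle[OF s0 s(2)])
    show "- (B + (B + B * (1 / (1 - s)) + t * (1 / (1 - s)))) \<le> v y - u y" for y
    proof -
      have "\<bar>v y\<bar> \<le> \<bar>A y\<bar> + \<bar>t * H y\<bar>" by (simp add: v_def)
      also have "\<bar>t * H y\<bar> \<le> t * (1 / (1 - s))"
        unfolding abs_mult using t_nonneg H_bdd[of y] by (intro mult_mono) auto
      finally show ?thesis using A_bdd[of y] bdd(1)[of y] by linarith
    qed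
    show "0 \<le> v y - u y \<or> s * step_avg c (\<lambda>y. v y - u y) y \<le> v y - u y" for y
      using u[of y] v_eq[of y] by (simp add: step_avg_diff right_diff_distrib)
  qed
  then have "u y \<le> v y" by simp
  also have "\<dots> \<le> A y + 330 * u' z * H y"
    unfolding v_def using t H_nonneg by (simp add: mult_right_mono)
  also have "\<dots> \<le> 330 * u' y"
    using A_nonneg[of y] by (simp add: A_def mult.commute)
  finally show ?thesis .
qed

lemma green_flip:
  assumes s: "1/2 \<le> s" "s < 1" and up: "c (z + (0, 1)) = Blue"
  shows "green s c x y \<le> 330 * green s (c(z := Blue)) x y"
proof (rule flip_comparison[where c = c and z = z, OF s up, where u = "green s c x" and u' = "green s (c(z := Blue)) x"])
  have s0: "0 \<le> s" using s by simp
  show "\<bar>green s c x y\<bar> \<le> 1 / (1 - s)" "\<bar>green s (c(z := Blue)) x y\<bar> \<le> 1 / (1 - s)" for y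
    using green_bounds[OF s0 s(2)] by (simp_all add: abs_of_nonneg)
  show "green s c x y \<le> (if y = x then 1 else 0) + s * step_avg c (green s c x) y"
    "green s (c(z := Blue)) x y = (if y = x then 1 else 0) + s * step_avg (c(z := Blue)) (green s (c(z := Blue)) x) y" for y
    using green_eq[OF s0 s(2)] by (simp_all only: order_refl)
qed simp

text \<open>The source \<open>green\<close> also changes with the color. By
  \<open>green_flip\<close>, dividing by 330 turns \<open>green2\<close> into a subsolution for the
  source of the flipped coloring; \<open>flip_comparison\<close> then costs another 330, and
  \<open>108900 = 330 * 330\<close>.\<close>

lemma green2_flip:
  assumes s: "1/2 \<le> s" "s < 1" and up: "c (z + (0, 1)) = Blue"
  shows "green2 s c x y \<le> 108900 * green2 s (c(z := Blue)) x y"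
proof -
  have s0: "0 \<le> s" using s by simp
  let ?c = "c(z := Blue)"
  have "1/330 * green2 s c x y \<le> 330 * green2 s ?c x y"
  proof (rule flip_comparison[where c = c and z = z, OF s up, where u = "\<lambda>y. 1/330 * green2 s c x y" and u' = "green2 s ?c x"])
    show "0 \<le> green s ?c x y" for y by (rule green_bounds[OF s0 s(2)])
    show "\<bar>green2 s ?c x y\<bar> \<le> 1 / (1 - s)\<^sup>2" for y
      using green2_bounds[OF s0 s(2), of ?c x y] by simp
    show "\<bar>1/330 * green2 s c x y\<bar> \<le> 1 / (1 - s)\<^sup>2" for y
      using green2_bounds[OF s0 s(2), of c x y] by simp
    show "1/330 * green2 s c x y \<le> green s ?c x y + s * step_avg c (\<lambda>y. 1/330 * green2 s c x y) y" for y
      using green2_eq[OF s0 s(2), of c x y] green_flip[where c = c and z = z, OF s up, of x y] by (subst step_avg_cmult) simp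
    show "green2 s ?c x y = green s ?c x y + s * step_avg ?c (green2 s ?c x) y" for y
      by (rule green2_eq[OF s0 s(2)])
  qed
  then show ?thesis by simp
qed

end

section \<open>Random colorings\<close>

text \<open>Splicing two independent samples along \<open>J\<close> does not change the product law,
  as can be checked on finite cylinders. Independence of functions of complementary, possibly
  infinite, sets of coordinates thereby becomes Fubini's theorem.\<close>

lemma distr_merge_PiM:
  fixes N :: "'i \<Rightarrow> 'a measure"
  assumes N: "\<And>i. prob_space (N i)"
  defines "P \<equiv> PiM UNIV N"
  shows "distr (P \<Otimes>\<^sub>M P) P (\<lambda>(x, y) i. if i \<in> J then x i else y i) = P"
    and "(\<lambda>(x, y) i. if i \<in> J then x i else y i) \<in> measurable (P \<Otimes>\<^sub>M P) P"
proof -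
  interpret N: prob_space "N i" for i by (rule N)
  interpret product_prob_space N UNIV by unfold_locales
  interpret Q: prob_space P unfolding P_def by (rule prob_space_PiM[OF N])
  let ?T = "\<lambda>(x, y) i. if i \<in> J then x i else y i"
  show T: "?T \<in> measurable (P \<Otimes>\<^sub>M P) P"
    unfolding P_def case_prod_beta
  proof (rule measurable_abs_UNIV)
    fix i show "(\<lambda>z. if i \<in> J then fst z i else snd z i) \<in> measurable (PiM UNIV N \<Otimes>\<^sub>M PiM UNIV N) (N i)"
      by (cases "i \<in> J") auto
  qed
  show "distr (P \<Otimes>\<^sub>M P) P ?T = P"
    unfolding P_def
  proof (rule PiM_eq)
    fix K F assume K: "finite K" "K \<subseteq> UNIV" and F: "\<And>i. i \<in> K \<Longrightarrow> F i \<in> sets (N i)"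
    have emb: "prod_emb UNIV N L (Pi\<^sub>E L F) \<in> sets P" if "L \<subseteq> K" for L
      unfolding P_def using that K F by (intro sets_PiM_I) (auto intro: finite_subset)
    have "emeasure (distr (P \<Otimes>\<^sub>M P) P ?T) (prod_emb UNIV N K (Pi\<^sub>E K F)) =
        emeasure (P \<Otimes>\<^sub>M P) (?T -` prod_emb UNIV N K (Pi\<^sub>E K F) \<inter> space (P \<Otimes>\<^sub>M P))"
      by (rule emeasure_distr[OF T emb]) simp
    also have "?T -` prod_emb UNIV N K (Pi\<^sub>E K F) \<inter> space (P \<Otimes>\<^sub>M P) =
        prod_emb UNIV N (K \<inter> J) (Pi\<^sub>E (K \<inter> J) F) \<times> prod_emb UNIV N (K - J) (Pi\<^sub>E (K - J) F)"
      by (auto simp: P_def prod_emb_def space_pair_measure space_PiM PiE_iff restrict_def extensional_def split: if_splits)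
    also have "emeasure (P \<Otimes>\<^sub>M P) \<dots> =
        emeasure P (prod_emb UNIV N (K \<inter> J) (Pi\<^sub>E (K \<inter> J) F)) * emeasure P (prod_emb UNIV N (K - J) (Pi\<^sub>E (K - J) F))"
      by (intro Q.emeasure_pair_measure_Times emb) auto
    also have "\<dots> = (\<Prod>i\<in>K \<inter> J. emeasure (N i) (F i)) * (\<Prod>i\<in>K - J. emeasure (N i) (F i))"
      unfolding P_def using K F by (subst (1 2) emeasure_PiM_emb) auto
    also have "\<dots> = (\<Prod>i\<in>K. emeasure (N i) (F i))"
      using K by (simp add: prod.Int_Diff[of K _ J])
    finally show "emeasure (distr (Pi\<^sub>M UNIV N \<Otimes>\<^sub>M Pi\<^sub>M UNIV N) (Pi\<^sub>M UNIV N) ?T) (prod_emb UNIV N K (Pi\<^sub>E K F)) =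
        (\<Prod>i\<in>K. emeasure (N i) (F i))" unfolding P_def .
  qed simp
qed

lemma nn_integral_PiM_independent:
  fixes N :: "'i \<Rightarrow> 'a measure" and f g :: "('i \<Rightarrow> 'a) \<Rightarrow> ennreal"
  assumes N: "\<And>i. prob_space (N i)"
    and [measurable]: "f \<in> borel_measurable (PiM UNIV N)" "g \<in> borel_measurable (PiM UNIV N)"
    and f: "\<And>x y. (\<And>i. i \<in> J \<Longrightarrow> x i = y i) \<Longrightarrow> f x = f y"
    and g: "\<And>x y. (\<And>i. i \<notin> J \<Longrightarrow> x i = y i) \<Longrightarrow> g x = g y"
  shows "(\<integral>\<^sup>+x. f x * g x \<partial>PiM UNIV N) = (\<integral>\<^sup>+x. f x \<partial>PiM UNIV N) * (\<integral>\<^sup>+x. g x \<partial>PiM UNIV N)"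
proof -
  define P where "P = PiM UNIV N"
  interpret P: prob_space P unfolding P_def by (rule prob_space_PiM[OF N])
  let ?T = "\<lambda>(x, y) i. if i \<in> J then x i else y i"
  have T: "distr (P \<Otimes>\<^sub>M P) P ?T = P" "?T \<in> measurable (P \<Otimes>\<^sub>M P) P"
    unfolding P_def by (rule distr_merge_PiM[OF N])+
  have [measurable]: "f \<in> borel_measurable P" "g \<in> borel_measurable P" by (simp_all add: P_def)
  have "(\<integral>\<^sup>+x. f x * g x \<partial>P) = (\<integral>\<^sup>+x. f x * g x \<partial>distr (P \<Otimes>\<^sub>M P) P ?T)" by (simp only: T(1))
  also have "\<dots> = (\<integral>\<^sup>+z. f (?T z) * g (?T z) \<partial>(P \<Otimes>\<^sub>M P))"
    by (intro nn_integral_distr T) simp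
  also have "\<dots> = (\<integral>\<^sup>+z. f (fst z) * g (snd z) \<partial>(P \<Otimes>\<^sub>M P))"
  proof (rule nn_integral_cong)
    fix z
    have "f (?T z) = f (fst z)" by (rule f) (simp add: case_prod_beta)
    moreover have "g (?T z) = g (snd z)" by (rule g) (simp add: case_prod_beta)
    ultimately show "f (?T z) * g (?T z) = f (fst z) * g (snd z)" by simp
  qed
  also have "\<dots> = (\<integral>\<^sup>+x. \<integral>\<^sup>+y. f x * g y \<partial>P \<partial>P)"
    by (subst P.nn_integral_fst[symmetric]) auto
  also have "\<dots> = (\<integral>\<^sup>+x. f x \<partial>P) * (\<integral>\<^sup>+x. g x \<partial>P)"
    by (simp add: nn_integral_cmult nn_integral_multc)
  finally show ?thesis by (simp add: P_def)
qed

section \<open>The law of the coloring: independence and translation invariance\<close>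

definition color_pmf :: "real \<Rightarrow> color pmf" where
  "color_pmf p = map_pmf (\<lambda>t. if t then Blue else Red) (bernoulli_pmf p)"

lemma coloring_law_eq: "coloring_law p = PiM UNIV (\<lambda>_. measure_pmf (color_pmf p))"
  by (simp add: coloring_law_def color_pmf_def)

lemma sets_coloring_law [measurable_cong]: "sets (coloring_law p) = sets coloring_space"
  unfolding coloring_law_def by (intro sets_PiM_cong) auto

lemma space_coloring_law [simp]: "space (coloring_law p) = UNIV"
  using sets_eq_imp_space_eq[OF sets_coloring_law] by (simp add: space_PiM)

lemma prob_space_coloring_law: "prob_space (coloring_law p)"
  unfolding coloring_law_def by (intro prob_space_PiM prob_space_measure_pmf)

lemma measurable_coloring_law_iff: "measurable (coloring_law p) N = measurable coloring_space N"
  by (rule measurable_cong_sets) (simp_all add: sets_coloring_law)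

lemma pmf_color_pmf:
  assumes "0 \<le> p" "p \<le> 1"
  shows "pmf (color_pmf p) Blue = p" "pmf (color_pmf p) Red = 1 - p"
proof -
  have "inj (\<lambda>t. if t then Blue else Red)" by (auto simp: inj_on_def)
  note * = pmf_map_inj'[OF this, of "bernoulli_pmf p", folded color_pmf_def]
  show "pmf (color_pmf p) Blue = p" "pmf (color_pmf p) Red = 1 - p"
    using *[of True] *[of False] assms by simp_all
qed

lemma measurable_color [measurable]: "(\<lambda>c. c z) \<in> measurable coloring_space (count_space UNIV)"
  by (rule measurable_component_singleton) simp

lemma color_not_Blue: "a \<noteq> Blue \<longleftrightarrow> a = Red" by (cases a) auto

lemma nn_integral_coloring_independent:
  assumes "f \<in> borel_measurable coloring_space" "g \<in> borel_measurable coloring_space"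
    and "\<And>c c'. (\<And>z. z \<in> J \<Longrightarrow> c z = c' z) \<Longrightarrow> f c = f c'"
    and "\<And>c c'. (\<And>z. z \<notin> J \<Longrightarrow> c z = c' z) \<Longrightarrow> g c = g c'"
  shows "(\<integral>\<^sup>+c. f c * g c \<partial>coloring_law p) = (\<integral>\<^sup>+c. f c \<partial>coloring_law p) * (\<integral>\<^sup>+c. g c \<partial>coloring_law p)"
  unfolding coloring_law_eq
proof (rule nn_integral_PiM_independent[OF prob_space_measure_pmf])
  show "f \<in> borel_measurable (PiM UNIV (\<lambda>_. measure_pmf (color_pmf p)))"
    "g \<in> borel_measurable (PiM UNIV (\<lambda>_. measure_pmf (color_pmf p)))"
    using assms(1,2) unfolding coloring_law_eq[symmetric] measurable_coloring_law_iff .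
qed (use assms(3,4) in blast)+

lemma distr_coloring_shift:
  "distr (coloring_law p) coloring_space (\<lambda>c z. c (z + y)) = coloring_law p"
proof -
  have "distr (coloring_law p) (coloring_law p) (\<lambda>c. \<lambda>z\<in>UNIV. c (z + y)) = coloring_law p"
    unfolding coloring_law_eq
    by (rule distr_PiM_reindex[where K = UNIV and I = UNIV and f = "\<lambda>z. z + y" and M = "\<lambda>_. measure_pmf (color_pmf p)"])
       (auto simp: prob_space_measure_pmf)
  moreover have "distr (coloring_law p) coloring_space (\<lambda>c z. c (z + y)) =
      distr (coloring_law p) (coloring_law p) (\<lambda>c. \<lambda>z\<in>UNIV. c (z + y))"
    by (intro distr_cong) (auto simp: sets_coloring_law)
  ultimately show ?thesis by simp
qed

lemma measurable_color_shift [measurable]: "(\<lambda>c z. c (z + y)) \<in> measurable coloring_space coloring_space"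
  by (intro measurable_abs_UNIV measurable_color)

lemma nn_integral_coloring_shift:
  assumes [measurable]: "f \<in> borel_measurable coloring_space"
  shows "(\<integral>\<^sup>+c. f (\<lambda>z. c (z + y)) \<partial>coloring_law p) = (\<integral>\<^sup>+c. f c \<partial>coloring_law p)"
proof -
  have "(\<integral>\<^sup>+c. f c \<partial>coloring_law p) = (\<integral>\<^sup>+c. f c \<partial>distr (coloring_law p) coloring_space (\<lambda>c z. c (z + y)))"
    by (simp only: distr_coloring_shift)
  also have "\<dots> = (\<integral>\<^sup>+c. f (\<lambda>z. c (z + y)) \<partial>coloring_law p)"
    by (rule nn_integral_distr) (auto simp: measurable_coloring_law_iff)
  finally show ?thesis by simp
qed

lemma measurable_color_update [measurable]: "(\<lambda>c. c(z := a)) \<in> measurable coloring_space coloring_space"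
  unfolding fun_upd_def
proof (rule measurable_abs_UNIV)
  fix y show "(\<lambda>c. if y = z then a else c y) \<in> measurable coloring_space (count_space UNIV)"
    by (cases "y = z") auto
qed

lemma measurable_color_indicator:
  "Measurable.pred coloring_space Q \<Longrightarrow> (\<lambda>c. indicator {c. Q c} c :: ennreal) \<in> borel_measurable coloring_space"
  by (rule borel_measurable_indicator) (simp add: pred_def space_PiM)

lemma pred_color [measurable]: "Measurable.pred coloring_space (\<lambda>c. c z = a)"
  by (rule measurable_compose[OF measurable_color]) simp

section \<open>Weight of colorings with a given red site\<close>

context
  fixes p :: real
  assumes p: "0 < p" "p < 1"
begin

lemma nn_integral_coloring_color:
  "(\<integral>\<^sup>+c. indicator {c. c z = a} c \<partial>coloring_law p) = ennreal (pmf (color_pmf p) a)"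
proof -
  interpret product_prob_space "\<lambda>_. measure_pmf (color_pmf p)" UNIV by unfold_locales
  have "(\<integral>\<^sup>+c. indicator {c. c z = a} c \<partial>coloring_law p) = emeasure (coloring_law p) {c. c z = a}"
    by (rule nn_integral_indicator) (use pred_color[of z a] in \<open>simp add: pred_def space_PiM sets_coloring_law\<close>)
  also have "\<dots> = emeasure (measure_pmf (color_pmf p)) {a}"
    using emeasure_PiM_Collect_single[of z "{a}"] by (simp add: coloring_law_eq space_PiM)
  finally show ?thesis by (simp add: emeasure_pmf_single)
qed

text \<open>Once \<open>\<Phi>\<close> is evaluated with \<open>z\<close> made blue, the integrand
  no longer depends on the color of \<open>z\<close>, which integrates out to \<open>1 - p\<close>
  for red and \<open>p\<close> for blue. The factor \<open>g\<close> carries conditions on the other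
  sites that justify the flip.\<close>

lemma flip_one_site:
  fixes K :: real
  assumes [measurable]: "\<Phi> \<in> borel_measurable coloring_space" "g \<in> borel_measurable coloring_space"
    and K: "0 \<le> K"
    and flip: "\<And>c. g c \<noteq> 0 \<Longrightarrow> \<Phi> c \<le> ennreal K * \<Phi> (c(z := Blue))"
    and g: "\<And>c a. g (c(z := a)) = g c"
  shows "(\<integral>\<^sup>+c. \<Phi> c * indicator {c. c z = Red} c * g c \<partial>coloring_law p) \<le>
    ennreal (K * (1 - p) / p) * (\<integral>\<^sup>+c. \<Phi> c * indicator {c. c z = Blue} c * g c \<partial>coloring_law p)"
proof -
  define I where "I = (\<integral>\<^sup>+c. \<Phi> (c(z := Blue)) * g c \<partial>coloring_law p)"
  have g': "g c = g c'" if "\<And>y. y \<noteq> z \<Longrightarrow> c y = c' y" for c c'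
  proof -
    have "c(z := Red) = c'(z := Red)" using that by (auto simp: fun_eq_iff)
    then show ?thesis by (metis g)
  qed
  have I: "(\<integral>\<^sup>+c. indicator {c. c z = a} c * (\<Phi> (c(z := Blue)) * g c) \<partial>coloring_law p) =
      ennreal (pmf (color_pmf p) a) * I" for a
    unfolding I_def nn_integral_coloring_color[of z a, symmetric]
  proof (rule nn_integral_coloring_independent[where J = "{z}"])
    show "\<Phi> (c(z := Blue)) * g c = \<Phi> (c'(z := Blue)) * g c'" if "\<And>y. y \<notin> {z} \<Longrightarrow> c y = c' y" for c c'
    proof -
      have "c(z := Blue) = c'(z := Blue)" using that by (auto simp: fun_eq_iff)
      then show ?thesis using g'[of c c'] that by simp
    qed
    show "(\<lambda>c. indicator {c. c z = a} c :: ennreal) \<in> borel_measurable coloring_space"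
      by (intro measurable_color_indicator pred_color)
  qed (auto simp: indicator_def)
  have [measurable]: "(\<lambda>c. indicator {c. c z = a} c :: ennreal) \<in> borel_measurable coloring_space" for a
    by (intro measurable_color_indicator pred_color)
  have "(\<integral>\<^sup>+c. \<Phi> c * indicator {c. c z = Red} c * g c \<partial>coloring_law p) \<le>
      (\<integral>\<^sup>+c. ennreal K * (indicator {c. c z = Red} c * (\<Phi> (c(z := Blue)) * g c)) \<partial>coloring_law p)"
  proof (rule nn_integral_mono)
    fix c
    show "\<Phi> c * indicator {c. c z = Red} c * g c \<le> ennreal K * (indicator {c. c z = Red} c * (\<Phi> (c(z := Blue)) * g c))"
    proof (cases "g c = 0 \<or> c z \<noteq> Red")
      case False
      then have "\<Phi> c * g c \<le> ennreal K * \<Phi> (c(z := Blue)) * g c"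
        using flip[of c] by (intro mult_right_mono) auto
      then show ?thesis using False by (simp add: mult.assoc)
    qed auto
  qed
  also have "\<dots> = ennreal K * (ennreal (1 - p) * I)"
    using p I[of Red] by (subst nn_integral_cmult) (auto simp: pmf_color_pmf measurable_coloring_law_iff)
  also have "\<dots> = ennreal (K * (1 - p) / p) * (ennreal p * I)"
    using p K by (simp add: mult.assoc[symmetric] ennreal_mult[symmetric])
  also have "ennreal p * I = (\<integral>\<^sup>+c. \<Phi> c * indicator {c. c z = Blue} c * g c \<partial>coloring_law p)"
  proof -
    have "(\<integral>\<^sup>+c. \<Phi> c * indicator {c. c z = Blue} c * g c \<partial>coloring_law p) =
        (\<integral>\<^sup>+c. indicator {c. c z = Blue} c * (\<Phi> (c(z := Blue)) * g c) \<partial>coloring_law p)"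
    proof (rule nn_integral_cong)
      fix c
      have "c z = Blue \<Longrightarrow> c(z := Blue) = c" by auto
      then show "\<Phi> c * indicator {c. c z = Blue} c * g c = indicator {c. c z = Blue} c * (\<Phi> (c(z := Blue)) * g c)"
        by (auto split: split_indicator)
    qed
    then show ?thesis using I[of Blue] p by (simp add: pmf_color_pmf)
  qed
  finally show ?thesis .
qed

text \<open>Split according to the first blue site above \<open>x\<close> and flip the red sites below it one after the
  other, starting from the top.\<close>

lemma red_weight_bound:
  fixes K B :: real
  assumes [measurable]: "\<Phi> \<in> borel_measurable coloring_space"
    and K: "0 \<le> K" and t: "K * (1 - p) / p < 1"
    and B: "0 \<le> B" "\<And>c. \<Phi> c \<le> ennreal B"
    and flip: "\<And>c z. c (z + (0, 1)) = Blue \<Longrightarrow> \<Phi> c \<le> ennreal K * \<Phi> (c(z := Blue))"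
  shows "(\<integral>\<^sup>+c. \<Phi> c * indicator {c. c x = Red} c \<partial>coloring_law p) \<le>
    ennreal (K * (1 - p) / p / (1 - K * (1 - p) / p)) * (\<integral>\<^sup>+c. \<Phi> c \<partial>coloring_law p)"
proof -
  define t where "t = K * (1 - p) / p"
  have t: "0 \<le> t" "t < 1" using t K p by (auto simp: t_def)
  define up where "up k = x + (0, int k)" for k
  have up_eq: "up k + (0, 1) = up (Suc k)" "up 0 = x" for k by (cases x, simp add: up_def)+
  have up_inj: "up j = up k \<longleftrightarrow> j = k" for j k by (cases x) (simp add: up_def)
  define R :: "nat \<Rightarrow> (int \<times> int \<Rightarrow> color) \<Rightarrow> ennreal" where "R k = indicator {c. \<forall>j<k. c (up j) = Red}" for k
  define I :: "nat \<Rightarrow> color \<Rightarrow> (int \<times> int \<Rightarrow> color) \<Rightarrow> ennreal" where "I k a = indicator {c. c (up k) = a}" for k a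
  have [measurable]: "R k \<in> borel_measurable coloring_space" for k
  proof -
    have "Measurable.pred coloring_space (\<lambda>c. \<forall>j<k. c (up j) = Red)" by measurable
    from measurable_color_indicator[OF this] show ?thesis by (simp add: R_def)
  qed
  have [measurable]: "I k a \<in> borel_measurable coloring_space" for k a
    using measurable_color_indicator[OF pred_color[of "up k" a]] by (simp add: I_def)
  define a where "a k = (\<integral>\<^sup>+c. \<Phi> c * (R k c * I k Blue c) \<partial>coloring_law p)" for k
  \<comment> \<open>The highest red site \<open>up k\<close> has a blue upper neighbor and may be
    flipped. Forgetting the condition on that neighbor afterwards leaves \<open>a k\<close>.\<close>
  have a_Suc: "a (Suc k) \<le> ennreal t * a k" for k
  proof -
    have "a (Suc k) = (\<integral>\<^sup>+c. \<Phi> c * indicator {c. c (up k) = Red} c * (R k c * I (Suc k) Blue c) \<partial>coloring_law p)"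
      unfolding a_def
      by (intro nn_integral_cong) (auto simp: R_def I_def less_Suc_eq split: split_indicator)
    also have "\<dots> \<le> ennreal t * (\<integral>\<^sup>+c. \<Phi> c * indicator {c. c (up k) = Blue} c * (R k c * I (Suc k) Blue c) \<partial>coloring_law p)"
      unfolding t_def
    proof (rule flip_one_site)
      show "\<Phi> c \<le> ennreal K * \<Phi> (c(up k := Blue))" if "R k c * I (Suc k) Blue c \<noteq> 0" for c
      proof -
        have "c (up k + (0, 1)) = Blue" using that by (auto simp: I_def up_eq split: split_indicator_asm)
        then show ?thesis by (rule flip)
      qed
      show "R k (c(up k := a)) * I (Suc k) Blue (c(up k := a)) = R k c * I (Suc k) Blue c" for c a
        by (auto simp: R_def I_def up_inj indicator_def)
    qed (use K in measurable)
    also have "\<dots> \<le> ennreal t * a k"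
      unfolding a_def
      by (intro mult_left_mono nn_integral_mono) (auto simp: I_def split: split_indicator)
    finally show ?thesis .
  qed
  have a_le: "a k \<le> ennreal (t ^ k) * (\<integral>\<^sup>+c. \<Phi> c \<partial>coloring_law p)" for k
  proof (induction k)
    case 0
    show ?case unfolding a_def
      by (auto intro!: nn_integral_mono simp: R_def I_def split: split_indicator)
  next
    case (Suc k)
    have "a (Suc k) \<le> ennreal t * (ennreal (t ^ k) * (\<integral>\<^sup>+c. \<Phi> c \<partial>coloring_law p))"
      using a_Suc[of k] mult_left_mono[OF Suc, of "ennreal t"] by auto
    then show ?case using t by (simp add: ennreal_mult mult.assoc)
  qed
  \<comment> \<open>The part on which no blue site has been found up to height \<open>k\<close>. As
    \<open>\<Phi>\<close> is bounded, which is where the discount enters, it vanishes in the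
    limit.\<close>
  define rem where "rem k = (\<integral>\<^sup>+c. \<Phi> c * R (Suc k) c \<partial>coloring_law p)" for k
  have R_integral: "(\<integral>\<^sup>+c. R k c \<partial>coloring_law p) = ennreal ((1 - p) ^ k)" for k
  proof (induction k)
    case 0
    interpret prob_space "coloring_law p" by (rule prob_space_coloring_law)
    show ?case using emeasure_space_1 by (simp add: R_def)
  next
    case (Suc k)
    have "(\<integral>\<^sup>+c. R (Suc k) c \<partial>coloring_law p) = (\<integral>\<^sup>+c. I k Red c * R k c \<partial>coloring_law p)"
      by (intro nn_integral_cong) (auto simp: R_def I_def less_Suc_eq split: split_indicator)
    also have "\<dots> = (\<integral>\<^sup>+c. I k Red c \<partial>coloring_law p) * (\<integral>\<^sup>+c. R k c \<partial>coloring_law p)"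
    proof (rule nn_integral_coloring_independent[where J = "{up k}"])
      show "I k Red c = I k Red c'" if "\<And>z. z \<in> {up k} \<Longrightarrow> c z = c' z" for c c'
        using that by (simp add: I_def indicator_def)
      show "R k c = R k c'" if "\<And>z. z \<notin> {up k} \<Longrightarrow> c z = c' z" for c c'
      proof -
        have "c (up j) = c' (up j)" if "j < k" for j using that \<open>\<And>z. z \<notin> {up k} \<Longrightarrow> c z = c' z\<close>[of "up j"] by (simp add: up_inj)
        then show ?thesis by (simp add: R_def indicator_def)
      qed
    qed measurable
    also have "(\<integral>\<^sup>+c. I k Red c \<partial>coloring_law p) = ennreal (1 - p)"
      using nn_integral_coloring_color[of "up k" Red] p by (simp add: I_def pmf_color_pmf)
    finally show ?case using Suc p by (simp add: ennreal_mult)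
  qed
  have rem_le: "rem k \<le> ennreal (B * (1 - p) ^ k)" for k
  proof -
    have "rem k \<le> (\<integral>\<^sup>+c. ennreal B * R k c \<partial>coloring_law p)"
      unfolding rem_def using B
      by (intro nn_integral_mono mult_mono) (auto simp: R_def split: split_indicator)
    also have "\<dots> = ennreal B * ennreal ((1 - p) ^ k)"
      by (subst nn_integral_cmult) (auto simp: R_integral measurable_coloring_law_iff)
    finally show ?thesis using B p by (simp add: ennreal_mult)
  qed
  define S where "S = (\<integral>\<^sup>+c. \<Phi> c \<partial>coloring_law p)"
  \<comment> \<open>The sum starts at \<open>k = 1\<close> because \<open>x\<close> itself is red;
    hence the geometric series is \<open>t / (1 - t)\<close>, without its constant term.\<close>
  have decomp: "(\<integral>\<^sup>+c. \<Phi> c * indicator {c. c x = Red} c \<partial>coloring_law p) = (\<Sum>k=1..n. a k) + rem n" for n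
  proof (induction n)
    case 0
    show ?case by (simp add: rem_def R_def up_eq)
  next
    case (Suc n)
    have "rem n = (\<integral>\<^sup>+c. \<Phi> c * (R (Suc n) c * I (Suc n) Blue c) + \<Phi> c * R (Suc (Suc n)) c \<partial>coloring_law p)"
      unfolding rem_def
    proof (rule nn_integral_cong)
      fix c
      show "\<Phi> c * R (Suc n) c = \<Phi> c * (R (Suc n) c * I (Suc n) Blue c) + \<Phi> c * R (Suc (Suc n)) c"
        by (cases "c (up (Suc n))") (auto simp: R_def I_def less_Suc_eq split: split_indicator)
    qed
    also have "\<dots> = a (Suc n) + rem (Suc n)"
      unfolding rem_def a_def by (rule nn_integral_add) (auto simp: measurable_coloring_law_iff)
    finally show ?case using Suc by (simp add: add.assoc)
  qed
  have S_le: "S \<le> ennreal B"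
  proof -
    interpret prob_space "coloring_law p" by (rule prob_space_coloring_law)
    have "S \<le> (\<integral>\<^sup>+c. ennreal B \<partial>coloring_law p)" unfolding S_def by (intro nn_integral_mono B)
    then show ?thesis using emeasure_space_1 by simp
  qed
  define s where "s = enn2real S"
  have s: "S = ennreal s" "0 \<le> s" using S_le le_less_trans[OF S_le ennreal_less_top] by (auto simp: s_def)
  have main: "(\<integral>\<^sup>+c. \<Phi> c * indicator {c. c x = Red} c \<partial>coloring_law p) \<le> ennreal (t / (1 - t) * s + B * (1 - p) ^ n)" for n
  proof -
    have "(\<Sum>k=1..n. a k) \<le> (\<Sum>k=1..n. ennreal (t ^ k * s))"
      using a_le s t by (intro sum_mono) (simp add: S_def[symmetric] ennreal_mult)
    also have "\<dots> = ennreal (\<Sum>k=1..n. t ^ k * s)"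
      using t s by (intro sum_ennreal) auto
    also have "(\<Sum>k=1..n. t ^ k * s) \<le> t / (1 - t) * s"
    proof -
      have "(\<Sum>k=1..n. t ^ k) = (\<Sum>k<n. t * t ^ k)"
        by (rule sum.reindex_bij_witness[of _ Suc "\<lambda>k. k - 1"]) (auto simp: power_Suc[symmetric] simp del: power_Suc)
      also have "\<dots> = t * (\<Sum>k<n. t ^ k)" by (simp add: sum_distrib_left)
      also have "\<dots> \<le> t * (1 / (1 - t))"
        using t by (intro mult_left_mono) (auto simp: sum_gp_strict divide_simps)
      finally have "(\<Sum>k=1..n. t ^ k) \<le> t / (1 - t)" by simp
      from mult_right_mono[OF this s(2)] show ?thesis by (simp only: sum_distrib_right)
    qed
    finally have "(\<Sum>k=1..n. a k) \<le> ennreal (t / (1 - t) * s)" by (simp add: ennreal_leI)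
    then have "(\<Sum>k=1..n. a k) + rem n \<le> ennreal (t / (1 - t) * s) + ennreal (B * (1 - p) ^ n)"
      by (intro add_mono rem_le)
    also have "\<dots> = ennreal (t / (1 - t) * s + B * (1 - p) ^ n)"
      using t s B p by (intro ennreal_plus[symmetric]) auto
    finally show ?thesis unfolding decomp[of n] .
  qed
  have "(\<lambda>n. ennreal (t / (1 - t) * s + B * (1 - p) ^ n)) \<longlonglongrightarrow> ennreal (t / (1 - t) * s + B * 0)"
    using p by (intro tendsto_ennrealI tendsto_intros LIMSEQ_power_zero) auto
  then have "(\<integral>\<^sup>+c. \<Phi> c * indicator {c. c x = Red} c \<partial>coloring_law p) \<le> ennreal (t / (1 - t) * s + B * 0)"
    by (rule LIMSEQ_le_const) (use main in auto)
  also have "\<dots> = ennreal (t / (1 - t)) * S"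
    unfolding s(1) using s(2) t by (subst ennreal_mult[symmetric]) auto
  finally show ?thesis by (simp add: t_def S_def)
qed

end

section \<open>The walk as a function of coloring and noise\<close>

type_synonym site = "int \<times> int"

definition move :: "color \<Rightarrow> site \<times> site \<Rightarrow> site" where
  "move a u = (case a of Blue \<Rightarrow> fst u | Red \<Rightarrow> snd u)"

text \<open>The stream consists of pairs: the step to take from a blue and the step to take from a red site.
  The walk is thus a function of coloring and noise, and walks with the same noise coincide as long as the
  colors they see coincide.\<close>

primrec walk :: "(site \<Rightarrow> color) \<Rightarrow> site \<Rightarrow> (site \<times> site) stream \<Rightarrow> nat \<Rightarrow> site" where
  "walk c z \<omega> 0 = z"
| "walk c z \<omega> (Suc n) = walk c (z + move (c z) (shd \<omega>)) (stl \<omega>) n"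

definition noise :: "(nat \<Rightarrow> real) \<Rightarrow> (nat \<Rightarrow> real) \<Rightarrow> (site \<times> site) stream measure" where
  "noise b r = stream_space (measure_pmf (pair_pmf (step_pmf b) (step_pmf r)))"

abbreviation noise_space :: "(site \<times> site) stream measure" where
  "noise_space \<equiv> stream_space (count_space UNIV)"

lemma sets_noise [measurable_cong]: "sets (noise b r) = sets noise_space"
  unfolding noise_def by (rule sets_stream_space_cong) simp

lemma space_noise [simp]: "space (noise b r) = UNIV"
  by (simp add: noise_def space_stream_space)

lemma prob_space_noise: "prob_space (noise b r)"
  unfolding noise_def by (rule prob_space.prob_space_stream_space[OF prob_space_measure_pmf])

lemma nn_integral_noise:
  assumes "f \<in> borel_measurable noise_space"
  shows "(\<integral>\<^sup>+\<omega>. f \<omega> \<partial>noise b r) = (\<integral>\<^sup>+u. \<integral>\<^sup>+\<omega>. f (u ## \<omega>) \<partial>noise b r \<partial>pair_pmf (step_pmf b) (step_pmf r))"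
proof -
  have "f \<in> borel_measurable (noise b r)"
    using assms by (simp add: measurable_cong_sets[OF sets_noise refl])
  then show ?thesis unfolding noise_def by (rule prob_space.nn_integral_stream_space[OF prob_space_measure_pmf])
qed

lemma emeasure_noise_UNIV [simp]: "emeasure (noise b r) UNIV = 1"
  using prob_space.emeasure_space_1[OF prob_space_noise[of b r]] by simp

lemma nn_integral_noise_split:
  fixes f g :: "(site \<times> site) stream \<Rightarrow> ennreal"
  assumes "f \<in> borel_measurable noise_space" and [measurable]: "g \<in> borel_measurable noise_space"
    and "\<And>\<omega> \<omega>'. stake n \<omega> = stake n \<omega>' \<Longrightarrow> f \<omega> = f \<omega>'"
  shows "(\<integral>\<^sup>+\<omega>. f \<omega> * g (sdrop n \<omega>) \<partial>noise b r) = (\<integral>\<^sup>+\<omega>. f \<omega> \<partial>noise b r) * (\<integral>\<^sup>+\<omega>. g \<omega> \<partial>noise b r)"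
  using assms(1,3)
proof (induction n arbitrary: f)
  case 0
  define k where "k = f undefined"
  have "f \<omega> = k" for \<omega> using 0(2)[of \<omega> undefined] by (simp add: k_def)
  then show ?case by (simp add: nn_integral_cmult measurable_cong_sets[OF sets_noise refl])
next
  case (Suc n)
  have [measurable]: "f \<in> borel_measurable noise_space" by fact
  have "(\<integral>\<^sup>+\<omega>. f \<omega> * g (sdrop (Suc n) \<omega>) \<partial>noise b r) =
      (\<integral>\<^sup>+u. \<integral>\<^sup>+\<omega>. f (u ## \<omega>) * g (sdrop n \<omega>) \<partial>noise b r \<partial>pair_pmf (step_pmf b) (step_pmf r))"
    by (subst nn_integral_noise) auto
  also have "\<dots> = (\<integral>\<^sup>+u. (\<integral>\<^sup>+\<omega>. f (u ## \<omega>) \<partial>noise b r) * (\<integral>\<^sup>+\<omega>. g \<omega> \<partial>noise b r) \<partial>pair_pmf (step_pmf b) (step_pmf r))"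
  proof (rule nn_integral_cong)
    fix u
    show "(\<integral>\<^sup>+\<omega>. f (u ## \<omega>) * g (sdrop n \<omega>) \<partial>noise b r) = (\<integral>\<^sup>+\<omega>. f (u ## \<omega>) \<partial>noise b r) * (\<integral>\<^sup>+\<omega>. g \<omega> \<partial>noise b r)"
      by (rule Suc.IH) (auto intro!: Suc.prems(2))
  qed
  also have "\<dots> = (\<integral>\<^sup>+u. (\<integral>\<^sup>+\<omega>. f (u ## \<omega>) \<partial>noise b r) \<partial>pair_pmf (step_pmf b) (step_pmf r)) * (\<integral>\<^sup>+\<omega>. g \<omega> \<partial>noise b r)"
    by (rule nn_integral_multc) simp
  also have "\<dots> = (\<integral>\<^sup>+\<omega>. f \<omega> \<partial>noise b r) * (\<integral>\<^sup>+\<omega>. g \<omega> \<partial>noise b r)"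
    by (subst (3) nn_integral_noise) auto
  finally show ?case .
qed

section \<open>Markov property, translation and locality of the walk\<close>

lemma walk_add: "walk c z \<omega> (n + k) = walk c (walk c z \<omega> n) (sdrop n \<omega>) k"
  by (induction n arbitrary: z \<omega>) auto

lemma walk_translate: "walk c (z + y) \<omega> n = walk (\<lambda>u. c (u + y)) z \<omega> n + y"
proof (induction n arbitrary: z \<omega>)
  case (Suc n)
  have eq: "z + y + move (c (z + y)) (shd \<omega>) = z + move (c (z + y)) (shd \<omega>) + y" by (simp add: add_ac)
  show ?case by (simp only: walk.simps eq Suc)
qed simp

lemma walk_cong_color:
  assumes "\<And>k. k < n \<Longrightarrow> c (walk c z \<omega> k) = c' (walk c z \<omega> k)"
  shows "walk c' z \<omega> n = walk c z \<omega> n"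
  using assms
proof (induction n arbitrary: z \<omega>)
  case (Suc n)
  have "c z = c' z" using Suc.prems[of 0] by simp
  moreover have "walk c' (z + move (c z) (shd \<omega>)) (stl \<omega>) n = walk c (z + move (c z) (shd \<omega>)) (stl \<omega>) n"
    by (rule Suc.IH) (use Suc.prems in force)
  ultimately show ?case by simp
qed simp

lemma walk_cong_stake:
  assumes "stake n \<omega> = stake n \<omega>'" "k \<le> n"
  shows "walk c z \<omega> k = walk c z \<omega>' k"
  using assms
proof (induction k arbitrary: z \<omega> \<omega>' n)
  case (Suc k)
  then obtain m where n: "n = Suc m" by (cases n) auto
  then show ?case using Suc.IH[of m "stl \<omega>" "stl \<omega>'"] Suc.prems by simp
qed simp

lemma measurable_move_shd:
  "(\<lambda>x. z + move (fst x z) (shd (snd x))) \<in> measurable (coloring_space \<Otimes>\<^sub>M noise_space) (count_space UNIV)"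
proof -
  have eq: "z + move (fst x z) (shd (snd x)) = (if fst x z = Blue then z + fst (shd (snd x)) else z + snd (shd (snd x)))"
    for x :: "(site \<Rightarrow> color) \<times> (site \<times> site) stream"
    by (cases "fst x z") (auto simp: move_def)
  have [measurable]: "(\<lambda>x. h (shd (snd x))) \<in> measurable (coloring_space \<Otimes>\<^sub>M noise_space) (count_space UNIV)" for h :: "site \<times> site \<Rightarrow> site"
    by (rule measurable_compose[OF measurable_compose[OF measurable_snd measurable_shd]]) simp
  show ?thesis unfolding eq by measurable
qed

lemma measurable_walk [measurable]:
  "(\<lambda>x. walk (fst x) z (snd x) n) \<in> measurable (coloring_space \<Otimes>\<^sub>M noise_space) (count_space UNIV)"
proof (induction n arbitrary: z)
  case (Suc n)
  have "(\<lambda>x. walk (fst x) i (stl (snd x)) n) \<in> measurable (coloring_space \<Otimes>\<^sub>M noise_space) (count_space UNIV)" for i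
  proof -
    have "(\<lambda>x. (fst x, stl (snd x))) \<in> measurable (coloring_space \<Otimes>\<^sub>M noise_space) (coloring_space \<Otimes>\<^sub>M noise_space)"
      by measurable
    from measurable_compose[OF this Suc[of i]] show ?thesis by simp
  qed
  from measurable_compose_countable[OF this measurable_move_shd[of z]] show ?case by simp
qed simp

lemma measurable_walk_noise [measurable]: "(\<lambda>\<omega>. walk c z \<omega> n) \<in> measurable noise_space (count_space UNIV)"
  using measurable_compose[OF measurable_Pair1'[of c coloring_space noise_space] measurable_walk[of z n]]
  by (simp add: space_PiM)

lemma measurable_walk_path: "walk c z \<in> measurable noise_space path_space"
  by (rule measurable_abs_UNIV) (rule measurable_walk_noise)

text \<open>The state space is countable, so an event about finitely many coordinates is a countable
  disjoint union of prescribed initial segments.\<close>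

lemma path_measure_eqI:
  fixes P Q :: "(nat \<Rightarrow> 'a :: countable) measure"
  assumes P: "sets P = sets (PiM UNIV (\<lambda>_. count_space UNIV))" and Q: "sets Q = sets (PiM UNIV (\<lambda>_. count_space UNIV))"
    and fin: "finite_measure P"
    and eq: "\<And>n x. emeasure P {X. \<forall>k<n. X k = x k} = emeasure Q {X. \<forall>k<n. X k = x k}"
  shows "P = Q"
proof (rule measure_eqI_PiM_infinite[OF P Q _ fin])
  fix A :: "nat \<Rightarrow> 'a set" and J :: "nat set"
  assume J: "finite J"
  define n where "n = Suc (Max (insert 0 J))"
  have n: "j < n" if "j \<in> J" for j 
    unfolding n_def by (rule le_imp_less_Suc, rule Max_ge) (use J that in auto)
  let ?S = "PiM UNIV (\<lambda>_. count_space UNIV) :: (nat \<Rightarrow> 'a) measure"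
  define C where "C l = {X. \<forall>k<n. X k = l ! k}" for l :: "'a list"
  define L where "L = {l. length l = n \<and> (\<forall>j\<in>J. l ! j \<in> A j)}"
  have C_sets: "C l \<in> sets ?S" for l
  proof -
    have "{X \<in> space ?S. \<forall>k<n. X k = l ! k} \<in> sets ?S" by measurable
    then show ?thesis by (simp add: C_def space_PiM)
  qed
  have set_eq: "prod_emb UNIV (\<lambda>_. count_space UNIV) J (Pi\<^sub>E J A) = (\<Union>l\<in>L. C l)"
  proof safe
    fix X assume "X \<in> prod_emb UNIV (\<lambda>_. count_space UNIV) J (Pi\<^sub>E J A)"
    then have "\<forall>j\<in>J. X j \<in> A j" by (auto simp: prod_emb_def PiE_iff)
    then have "map X [0..<n] \<in> L" "X \<in> C (map X [0..<n])" using n by (auto simp: L_def C_def)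
    then show "X \<in> (\<Union>l\<in>L. C l)" by blast
  next
    fix X l assume "l \<in> L" "X \<in> C l"
    then show "X \<in> prod_emb UNIV (\<lambda>_. count_space UNIV) J (Pi\<^sub>E J A)"
      using n by (auto simp: L_def C_def prod_emb_def PiE_iff)
  qed
  have disj: "disjoint_family_on C L"
    unfolding disjoint_family_on_def L_def C_def by (auto simp: list_eq_iff_nth_eq)
  have "emeasure M (\<Union>l\<in>L. C l) = (\<integral>\<^sup>+l. emeasure M (C l) \<partial>count_space L)" if "sets M = sets ?S" for M
    by (rule emeasure_UN_countable[OF _ _ disj]) (auto simp: that C_sets)
  then show "emeasure P (prod_emb UNIV (\<lambda>_. count_space UNIV) J (Pi\<^sub>E J A)) =
      emeasure Q (prod_emb UNIV (\<lambda>_. count_space UNIV) J (Pi\<^sub>E J A))"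
    unfolding set_eq using P Q eq by (simp add: C_def)
qed

text \<open>The bridge between the two descriptions of the walk: driven by the noise, it gives
  initial segments the same product of transition probabilities as the Ionescu-Tulcea
  construction.\<close>

lemma distr_walk: "distr (noise b r) path_space (walk c 0) = quenched_law b r c"
proof (rule path_measure_eqI)
  have meas: "walk c z \<in> measurable (noise b r) path_space" for z
    using measurable_walk_path by (simp add: measurable_cong_sets[OF sets_noise refl])
  interpret noise: prob_space "noise b r" by (rule prob_space_noise)
  show "finite_measure (distr (noise b r) path_space (walk c 0))"
    by (rule noise.finite_measure_distr[OF meas])
  fix n and x :: "nat \<Rightarrow> site"
  have cyl: "{X. \<forall>k<n. X k = x k} \<in> sets path_space" for n and x :: "nat \<Rightarrow> site"
  proof -
    have "{X \<in> space path_space. \<forall>k<n. X k = x k} \<in> sets path_space" by measurable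
    then show ?thesis by (simp add: space_PiM)
  qed
  \<comment> \<open>\<open>transition\<close> is tied to the start 0. Induction over the first step
    needs arbitrary starting points, so the initial law is made a parameter.\<close>
  define T where "T z k x = (case k of 0 \<Rightarrow> return_pmf z | Suc _ \<Rightarrow> transition b r c k x)" for z k x
  have cyl': "{\<omega>. \<forall>k<n. walk c z \<omega> k = x k} \<in> sets noise_space" for n z and x :: "nat \<Rightarrow> site"
    using measurable_sets[OF measurable_walk_path cyl, of c z n x] by (simp add: space_stream_space vimage_def)
  have "emeasure (noise b r) {\<omega>. \<forall>k<n. walk c z \<omega> k = x k} = (\<Prod>k<n. ennreal (pmf (T z k x) (x k)))" for z
  proof (induction n arbitrary: z x)
    case 0
    then show ?case using noise.emeasure_space_1 by simp
  next
    case (Suc n)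
    let ?K = "pair_pmf (step_pmf b) (step_pmf r)"
    have ind: "(\<lambda>\<omega>. indicator {\<omega>. \<forall>k<Suc n. walk c z \<omega> k = x k} \<omega> :: ennreal) \<in> borel_measurable noise_space"
      by (rule borel_measurable_indicator[OF cyl'])
    have "emeasure (noise b r) {\<omega>. \<forall>k<Suc n. walk c z \<omega> k = x k} =
        (\<integral>\<^sup>+\<omega>. indicator {\<omega>. \<forall>k<Suc n. walk c z \<omega> k = x k} \<omega> \<partial>noise b r)"
      using cyl'[of "Suc n" z x] by (intro nn_integral_indicator[symmetric]) (simp add: sets_noise)
    also have "\<dots> = (\<integral>\<^sup>+u. \<integral>\<^sup>+\<omega>. indicator {\<omega>. \<forall>k<Suc n. walk c z \<omega> k = x k} (u ## \<omega>) \<partial>noise b r \<partial>?K)"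
      by (rule nn_integral_noise[OF ind])
    also have "\<dots> = (\<integral>\<^sup>+u. indicator {z} (x 0) * (\<Prod>k<n. ennreal (pmf (T (z + move (c z) u) k (x \<circ> Suc)) (x (Suc k)))) \<partial>?K)"
    proof (rule nn_integral_cong)
      fix u
      have "(\<integral>\<^sup>+\<omega>. indicator {\<omega>. \<forall>k<Suc n. walk c z \<omega> k = x k} (u ## \<omega>) \<partial>noise b r) =
          (\<integral>\<^sup>+\<omega>. indicator {z} (x 0) * indicator {\<omega>. \<forall>k<n. walk c (z + move (c z) u) \<omega> k = (x \<circ> Suc) k} \<omega> \<partial>noise b r)"
        by (intro nn_integral_cong) (auto simp: All_less_Suc2 split: split_indicator)
      also have "\<dots> = indicator {z} (x 0) * emeasure (noise b r) {\<omega>. \<forall>k<n. walk c (z + move (c z) u) \<omega> k = (x \<circ> Suc) k}"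
        using cyl'[of n "z + move (c z) u" "x \<circ> Suc"]
        by (subst nn_integral_cmult) (simp_all add: measurable_cong_sets[OF sets_noise refl] sets_noise)
      also have "emeasure (noise b r) {\<omega>. \<forall>k<n. walk c (z + move (c z) u) \<omega> k = (x \<circ> Suc) k} =
          (\<Prod>k<n. ennreal (pmf (T (z + move (c z) u) k (x \<circ> Suc)) ((x \<circ> Suc) k)))" by (rule Suc.IH)
      finally show "(\<integral>\<^sup>+\<omega>. indicator {\<omega>. \<forall>k<Suc n. walk c z \<omega> k = x k} (u ## \<omega>) \<partial>noise b r) =
          indicator {z} (x 0) * (\<Prod>k<n. ennreal (pmf (T (z + move (c z) u) k (x \<circ> Suc)) (x (Suc k))))" by simp
    qed
    also have "\<dots> = (\<Prod>k<Suc n. ennreal (pmf (T z k x) (x k)))"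
    proof (cases n)
      case 0
      then show ?thesis by (simp add: T_def measure_pmf.emeasure_space_1[simplified] split: split_indicator)
    next
      case (Suc m)
      have tr: "T z' (Suc k) (x \<circ> Suc) = transition b r c (Suc (Suc k)) x" for z' k by (simp add: T_def)
      have step: "(\<integral>\<^sup>+u. ennreal (pmf (return_pmf (z + move (c z) u)) (x (Suc 0))) \<partial>?K) =
          ennreal (pmf (map_pmf (\<lambda>s. z + s) (step_pmf (case c z of Blue \<Rightarrow> b | Red \<Rightarrow> r))) (x (Suc 0)))"
      proof -
        have "map_pmf (move (c z)) ?K = step_pmf (case c z of Blue \<Rightarrow> b | Red \<Rightarrow> r)"
          by (cases "c z") (auto simp: move_def[abs_def] map_fst_pair_pmf map_snd_pair_pmf)
        then have "map_pmf (\<lambda>s. z + s) (step_pmf (case c z of Blue \<Rightarrow> b | Red \<Rightarrow> r)) = map_pmf (\<lambda>u. z + move (c z) u) ?K"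
          by (metis (no_types, lifting) comp_def map_pmf_comp map_pmf_cong)
        then have "ennreal (pmf (map_pmf (\<lambda>s. z + s) (step_pmf (case c z of Blue \<Rightarrow> b | Red \<Rightarrow> r))) (x (Suc 0))) =
            emeasure ?K ((\<lambda>u. z + move (c z) u) -` {x (Suc 0)})"
          by (simp add: emeasure_pmf_single[symmetric])
        also have "\<dots> = (\<integral>\<^sup>+u. indicator ((\<lambda>u. z + move (c z) u) -` {x (Suc 0)}) u \<partial>?K)" by simp
        also have "\<dots> = (\<integral>\<^sup>+u. ennreal (pmf (return_pmf (z + move (c z) u)) (x (Suc 0))) \<partial>?K)"
          by (intro nn_integral_cong) (auto simp: pmf_return split: split_indicator)
        finally show ?thesis by simp
      qed
      have "(\<integral>\<^sup>+u. indicator {z} (x 0) * (\<Prod>k<n. ennreal (pmf (T (z + move (c z) u) k (x \<circ> Suc)) (x (Suc k)))) \<partial>?K) =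
          (\<integral>\<^sup>+u. (indicator {z} (x 0) * (\<Prod>k<m. ennreal (pmf (transition b r c (Suc (Suc k)) x) (x (Suc (Suc k)))))) *
            ennreal (pmf (return_pmf (z + move (c z) u)) (x (Suc 0))) \<partial>?K)"
        unfolding Suc prod.lessThan_Suc_shift tr by (simp add: T_def mult_ac)
      also have "\<dots> = (indicator {z} (x 0) * (\<Prod>k<m. ennreal (pmf (transition b r c (Suc (Suc k)) x) (x (Suc (Suc k)))))) *
          ennreal (pmf (map_pmf (\<lambda>s. z + s) (step_pmf (case c z of Blue \<Rightarrow> b | Red \<Rightarrow> r))) (x (Suc 0)))"
        by (subst nn_integral_cmult) (simp, simp only: step)
      also have "\<dots> = (\<Prod>k<Suc n. ennreal (pmf (T z k x) (x k)))"
        unfolding Suc prod.lessThan_Suc_shift by (auto simp: T_def pmf_return mult_ac split: split_indicator)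
      finally show ?thesis .
    qed
    finally show ?case .
  qed
  note * = this
  have "emeasure (distr (noise b r) path_space (walk c 0)) {X. \<forall>k<n. X k = x k} =
      emeasure (noise b r) {\<omega>. \<forall>k<n. walk c 0 \<omega> k = x k}"
    by (subst emeasure_distr[OF meas cyl]) (simp add: vimage_def)
  also have "\<dots> = (\<Prod>k<n. ennreal (pmf (transition b r c k x) (x k)))"
    unfolding * by (intro prod.cong) (auto simp: T_def split: nat.splits)
  finally show "emeasure (distr (noise b r) path_space (walk c 0)) {X. \<forall>k<n. X k = x k} =
      emeasure (quenched_law b r c) {X. \<forall>k<n. X k = x k}" by (simp add: emeasure_quenched_law)
qed (simp_all)

lemma nn_integral_step_pmf:
  assumes "\<And>i. i \<in> {1..4} \<Longrightarrow> 0 \<le> w i" and "(\<Sum>i=1..4. w i) = 1"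
  shows "(\<integral>\<^sup>+s. f s \<partial>step_pmf w) = (\<Sum>i=1..4. ennreal (w i) * f (axis_unit i))"
    and "set_pmf (step_pmf w) \<subseteq> axis_unit ` {1..4}"
proof -
  have I: "{1..4} = {1, 2, 3, 4::nat}" by auto
  have "pmf_of_list_wf [(axis_unit i, w i). i \<leftarrow> [1, 2, 3, 4]]"
    using assms(1)[of 1] assms(1)[of 2] assms(1)[of 3] assms(1)[of 4] assms(2)
    unfolding I by (intro pmf_of_list_wfI) (auto simp: add.assoc)
  from set_pmf_of_list[OF this] show supp: "set_pmf (step_pmf w) \<subseteq> axis_unit ` {1..4}"
    unfolding I by (simp add: step_pmf_def)
  have inj: "inj_on axis_unit {1..4}" unfolding I by (auto simp: inj_on_def axis_unit_def)
  have "(\<integral>\<^sup>+s. f s \<partial>step_pmf w) = (\<Sum>s\<in>axis_unit ` {1..4}. f s * ennreal (pmf (step_pmf w) s))"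
    by (rule nn_integral_measure_pmf_support) (use supp in auto)
  also have "\<dots> = (\<Sum>i=1..4. f (axis_unit i) * ennreal (pmf (step_pmf w) (axis_unit i)))"
    by (rule sum.reindex[OF inj, unfolded comp_def])
  also have "\<dots> = (\<Sum>i=1..4. ennreal (w i) * f (axis_unit i))"
  proof (rule sum.cong[OF refl])
    fix i :: nat assume "i \<in> {1..4}"
    from pmf_step_pmf[OF assms this]
    show "f (axis_unit i) * ennreal (pmf (step_pmf w) (axis_unit i)) = ennreal (w i) * f (axis_unit i)"
      by (simp add: mult.commute)
  qed
  finally show "(\<integral>\<^sup>+s. f s \<partial>step_pmf w) = (\<Sum>i=1..4. ennreal (w i) * f (axis_unit i))" .
qed

section \<open>One-step decompositions and the occupation of red sites\<close>

context two_vertex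
begin

lemma step_pmf_jump: "map_pmf (move a) (pair_pmf (step_pmf b) (step_pmf r)) = step_pmf (jump a)"
  by (cases a) (auto simp: move_def[abs_def] jump_def map_fst_pair_pmf map_snd_pair_pmf)

lemma nn_integral_move:
  "(\<integral>\<^sup>+u. f (move a u) \<partial>pair_pmf (step_pmf b) (step_pmf r)) = (\<Sum>i=1..4. ennreal (jump a i) * f (axis_unit i))"
proof -
  have "(\<integral>\<^sup>+u. f (move a u) \<partial>pair_pmf (step_pmf b) (step_pmf r)) = (\<integral>\<^sup>+s. f s \<partial>step_pmf (jump a))"
    unfolding step_pmf_jump[symmetric] by simp
  then show ?thesis by (simp only: nn_integral_step_pmf[OF jump_nonneg jump_sum])
qed

lemma nn_integral_walk_Suc:
  fixes f :: "site \<Rightarrow> ennreal"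
  shows "(\<integral>\<^sup>+\<omega>. f (walk c z \<omega> (Suc n)) \<partial>noise b r) =
    (\<Sum>i=1..4. ennreal (jump (c z) i) * (\<integral>\<^sup>+\<omega>. f (walk c (z + axis_unit i) \<omega> n) \<partial>noise b r))"
proof -
  have "(\<lambda>\<omega>. f (walk c z \<omega> (Suc n))) \<in> borel_measurable noise_space"
    by (rule measurable_compose[OF measurable_walk_noise]) simp
  then have "(\<integral>\<^sup>+\<omega>. f (walk c z \<omega> (Suc n)) \<partial>noise b r) =
      (\<integral>\<^sup>+u. \<integral>\<^sup>+\<omega>. f (walk c (z + move (c z) u) \<omega> n) \<partial>noise b r \<partial>pair_pmf (step_pmf b) (step_pmf r))"
    by (subst nn_integral_noise) auto
  also have "\<dots> = (\<Sum>i=1..4. ennreal (jump (c z) i) * (\<integral>\<^sup>+\<omega>. f (walk c (z + axis_unit i) \<omega> n) \<partial>noise b r))"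
    by (rule nn_integral_move[where f = "\<lambda>s. \<integral>\<^sup>+\<omega>. f (walk c (z + s) \<omega> n) \<partial>noise b r"])
  finally show ?thesis .
qed

lemma measurable_walk_fun [measurable]:
  fixes f :: "site \<Rightarrow> ennreal"
  shows "(\<lambda>\<omega>. f (walk c z \<omega> n)) \<in> borel_measurable noise_space"
  by (rule measurable_compose[OF measurable_walk_noise]) simp

text \<open>\<open>walk\<close> unfolds at its first step, whereas drift estimates act on the
  current position; iterating the decomposition at the first step yields the one at the
  last.\<close>

lemma nn_integral_walk_last_step:
  fixes f :: "site \<Rightarrow> ennreal"
  shows "(\<integral>\<^sup>+\<omega>. f (walk c z \<omega> (Suc n)) \<partial>noise b r) =
    (\<integral>\<^sup>+\<omega>. (\<Sum>i=1..4. ennreal (jump (c (walk c z \<omega> n)) i) * f (walk c z \<omega> n + axis_unit i)) \<partial>noise b r)"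
proof (induction n arbitrary: z)
  case 0
  show ?case unfolding nn_integral_walk_Suc by simp
next
  case (Suc n)
  show ?case
    unfolding nn_integral_walk_Suc[of f c z "Suc n"] Suc
    by (rule nn_integral_walk_Suc[symmetric])
qed

lemma nn_integral_walk_at:
  "(\<integral>\<^sup>+\<omega>. indicator {x} (walk c z \<omega> n) \<partial>noise b r) = ennreal (trans_prob c n x z)"
proof (induction n arbitrary: z)
  case 0
  then show ?case by (simp add: indicator_def)
next
  case (Suc n)
  show ?case
    unfolding nn_integral_walk_Suc Suc trans_prob.simps step_avg_def
    by (subst sum_ennreal[symmetric]) (auto simp: ennreal_mult jump_nonneg trans_prob_nonneg)
qed

lemma measurable_trans_prob [measurable]: "(\<lambda>c. trans_prob c n x z) \<in> borel_measurable coloring_space"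
proof (induction n arbitrary: z)
  case (Suc n)
  have [measurable]: "(\<lambda>c. jump (c z) i) \<in> borel_measurable coloring_space" for i
    by (rule measurable_compose[OF measurable_color]) simp
  show ?case unfolding trans_prob.simps step_avg_def using Suc by measurable
qed simp

definition annealed :: "real \<Rightarrow> nat \<Rightarrow> ((site \<Rightarrow> color) \<Rightarrow> site \<Rightarrow> ennreal) \<Rightarrow> ennreal" where
  "annealed p n f = (\<integral>\<^sup>+c. \<integral>\<^sup>+\<omega>. f c (walk c 0 \<omega> n) \<partial>noise b r \<partial>coloring_law p)"

text \<open>As a countable sum over sites the expectation inherits measurability in the coloring
  from \<open>trans_prob\<close>, and it can be integrated over the coloring site by site.\<close>

lemma walk_count_space:
  fixes h :: "site \<Rightarrow> ennreal"
  shows "(\<integral>\<^sup>+\<omega>. h (walk c z \<omega> n) \<partial>noise b r) = (\<integral>\<^sup>+x. h x * ennreal (trans_prob c n x z) \<partial>count_space UNIV)"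
proof -
  have "(\<integral>\<^sup>+\<omega>. h (walk c z \<omega> n) \<partial>noise b r) =
      (\<integral>\<^sup>+\<omega>. (\<integral>\<^sup>+x. h x * indicator {x} (walk c z \<omega> n) \<partial>count_space UNIV) \<partial>noise b r)"
  proof (rule nn_integral_cong)
    fix \<omega>
    have "(\<integral>\<^sup>+x. h x * indicator {x} (walk c z \<omega> n) \<partial>count_space UNIV) =
        (\<integral>\<^sup>+x. h (walk c z \<omega> n) * indicator {walk c z \<omega> n} x \<partial>count_space UNIV)"
      by (intro nn_integral_cong) (auto split: split_indicator)
    then show "h (walk c z \<omega> n) = (\<integral>\<^sup>+x. h x * indicator {x} (walk c z \<omega> n) \<partial>count_space UNIV)"
      by (simp add: nn_integral_cmult)
  qed
  also have "\<dots> = (\<integral>\<^sup>+x. (\<integral>\<^sup>+\<omega>. h x * indicator {x} (walk c z \<omega> n) \<partial>noise b r) \<partial>count_space UNIV)"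
    by (rule nn_integral_count_space_nn_integral) auto
  also have "\<dots> = (\<integral>\<^sup>+x. h x * ennreal (trans_prob c n x z) \<partial>count_space UNIV)"
    by (intro nn_integral_cong) (subst nn_integral_cmult, auto simp: nn_integral_walk_at)
  finally show ?thesis .
qed

lemma measurable_annealed_inner:
  fixes h :: "(site \<Rightarrow> color) \<Rightarrow> site \<Rightarrow> ennreal"
  assumes "\<And>x. (\<lambda>c. h c x) \<in> borel_measurable coloring_space"
  shows "(\<lambda>c. \<integral>\<^sup>+\<omega>. h c (walk c 0 \<omega> n) \<partial>noise b r) \<in> borel_measurable coloring_space"
proof -
  have [measurable]: "\<And>x. (\<lambda>c. h c x) \<in> borel_measurable coloring_space" by fact
  have *: "(\<integral>\<^sup>+\<omega>. h c (walk c 0 \<omega> n) \<partial>noise b r) = (\<Sum>k. h c (from_nat_into UNIV k) * ennreal (trans_prob c n (from_nat_into UNIV k) 0))" for c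
    unfolding walk_count_space
    by (subst nn_integral_bij_count_space[symmetric, OF bij_betw_from_nat_into])
       (auto simp: nn_integral_count_space_nat infinite_UNIV_char_0 finite_prod)
  show ?thesis unfolding * by measurable
qed

lemma annealed_count_space:
  fixes h :: "(site \<Rightarrow> color) \<Rightarrow> site \<Rightarrow> ennreal"
  assumes [measurable]: "\<And>x. (\<lambda>c. h c x) \<in> borel_measurable coloring_space"
  shows "annealed p n h = (\<integral>\<^sup>+x. \<integral>\<^sup>+c. h c x * ennreal (trans_prob c n x 0) \<partial>coloring_law p \<partial>count_space UNIV)"
  unfolding annealed_def walk_count_space
  by (rule nn_integral_count_space_nn_integral) (auto simp: measurable_coloring_law_iff)

text \<open>The weighted expected number of visits to a fixed site \<open>x\<close> is
  \<open>G c x\<close>. \<open>red_weight_bound\<close> with \<open>\<Phi> = G\<close> compares, for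
  each \<open>x\<close>, the contribution of colorings with \<open>x\<close> red to the total. Since
  this happens before summing over \<open>x\<close>, any weight \<open>w\<close> is allowed.\<close>

lemma red_occupation:
  fixes w :: "site \<Rightarrow> ennreal" and a :: "nat \<Rightarrow> real" and K :: real
  assumes p: "0 < p" "p < 1" and a: "\<And>n. 0 \<le> a n"
    and G: "\<And>c x. (\<lambda>n. a n * trans_prob c n x 0) sums G c x"
    and B: "\<And>c x. G c x \<le> B"
    and K: "0 \<le> K" "K * (1 - p) / p < 1"
    and flip: "\<And>c z x. c (z + (0, 1)) = Blue \<Longrightarrow> G c x \<le> K * G (c(z := Blue)) x"
  shows "(\<Sum>n. ennreal (a n) * annealed p n (\<lambda>c x. w x * indicator {Red} (c x))) \<le>
    ennreal (K * (1 - p) / p / (1 - K * (1 - p) / p)) * (\<Sum>n. ennreal (a n) * annealed p n (\<lambda>c x. w x))"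
proof -
  have [measurable]: "(\<lambda>c. indicator {Red} (c x) :: ennreal) \<in> borel_measurable coloring_space" for x
    by (rule measurable_compose[OF measurable_color]) simp
  have G0: "0 \<le> G c x" for c x
    unfolding sums_unique[OF G]
    by (rule suminf_nonneg[OF sums_summable[OF G]]) (simp add: a trans_prob_nonneg)
  have G_eq: "ennreal (G c x) = (\<Sum>n. ennreal (a n) * ennreal (trans_prob c n x 0))" for c x
    unfolding ennreal_mult[OF a trans_prob_nonneg, symmetric]
    by (rule suminf_ennreal_eq[symmetric, OF _ G]) (simp add: a trans_prob_nonneg)
  have [measurable]: "(\<lambda>c. ennreal (G c x)) \<in> borel_measurable coloring_space" for x
    unfolding G_eq by measurable
  have occ: "(\<Sum>n. ennreal (a n) * annealed p n (\<lambda>c x. w x * h c x)) =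
      (\<integral>\<^sup>+x. w x * (\<integral>\<^sup>+c. ennreal (G c x) * h c x \<partial>coloring_law p) \<partial>count_space UNIV)"
    if [measurable]: "\<And>x. (\<lambda>c. h c x) \<in> borel_measurable coloring_space" for h :: "(site \<Rightarrow> color) \<Rightarrow> site \<Rightarrow> ennreal"
  proof -
    have "(\<Sum>n. ennreal (a n) * annealed p n (\<lambda>c x. w x * h c x)) =
        (\<Sum>n. \<integral>\<^sup>+x. ennreal (a n) * (\<integral>\<^sup>+c. w x * h c x * ennreal (trans_prob c n x 0) \<partial>coloring_law p) \<partial>count_space UNIV)"
      by (subst annealed_count_space) (auto simp: nn_integral_cmult)
    also have "\<dots> = (\<integral>\<^sup>+x. (\<Sum>n. ennreal (a n) * (\<integral>\<^sup>+c. w x * h c x * ennreal (trans_prob c n x 0) \<partial>coloring_law p)) \<partial>count_space UNIV)"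
      by (rule nn_integral_suminf[symmetric]) simp
    also have "\<dots> = (\<integral>\<^sup>+x. w x * (\<integral>\<^sup>+c. ennreal (G c x) * h c x \<partial>coloring_law p) \<partial>count_space UNIV)"
    proof (rule nn_integral_cong)
      fix x
      have "(\<Sum>n. ennreal (a n) * (\<integral>\<^sup>+c. w x * h c x * ennreal (trans_prob c n x 0) \<partial>coloring_law p)) =
          (\<Sum>n. \<integral>\<^sup>+c. ennreal (a n) * (w x * h c x * ennreal (trans_prob c n x 0)) \<partial>coloring_law p)"
        by (subst nn_integral_cmult) (auto simp: measurable_coloring_law_iff)
      also have "\<dots> = (\<integral>\<^sup>+c. (\<Sum>n. ennreal (a n) * (w x * h c x * ennreal (trans_prob c n x 0))) \<partial>coloring_law p)"
        by (rule nn_integral_suminf[symmetric]) (auto simp: measurable_coloring_law_iff)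
      also have "\<dots> = (\<integral>\<^sup>+c. w x * (ennreal (G c x) * h c x) \<partial>coloring_law p)"
      proof (rule nn_integral_cong)
        fix c
        have "(\<Sum>n. ennreal (a n) * (w x * h c x * ennreal (trans_prob c n x 0))) =
            (\<Sum>n. (w x * h c x) * (ennreal (a n) * ennreal (trans_prob c n x 0)))"
          by (simp add: mult_ac)
        also have "\<dots> = (w x * h c x) * ennreal (G c x)" unfolding G_eq by (rule ennreal_suminf_cmult)
        finally show "(\<Sum>n. ennreal (a n) * (w x * h c x * ennreal (trans_prob c n x 0))) = w x * (ennreal (G c x) * h c x)"
          by (simp add: mult_ac)
      qed
      also have "\<dots> = w x * (\<integral>\<^sup>+c. ennreal (G c x) * h c x \<partial>coloring_law p)"
        by (rule nn_integral_cmult) (auto simp: measurable_coloring_law_iff)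
      finally show "(\<Sum>n. ennreal (a n) * (\<integral>\<^sup>+c. w x * h c x * ennreal (trans_prob c n x 0) \<partial>coloring_law p)) =
          w x * (\<integral>\<^sup>+c. ennreal (G c x) * h c x \<partial>coloring_law p)" .
    qed
    finally show ?thesis .
  qed
  have "(\<Sum>n. ennreal (a n) * annealed p n (\<lambda>c x. w x * indicator {Red} (c x))) =
      (\<integral>\<^sup>+x. w x * (\<integral>\<^sup>+c. ennreal (G c x) * indicator {Red} (c x) \<partial>coloring_law p) \<partial>count_space UNIV)"
    by (rule occ) measurable
  also have "\<dots> \<le> (\<integral>\<^sup>+x. w x * (ennreal (K * (1 - p) / p / (1 - K * (1 - p) / p)) * (\<integral>\<^sup>+c. ennreal (G c x) \<partial>coloring_law p)) \<partial>count_space UNIV)"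
  proof (intro nn_integral_mono mult_left_mono)
    fix x
    have "(\<integral>\<^sup>+c. ennreal (G c x) * indicator {Red} (c x) \<partial>coloring_law p) =
        (\<integral>\<^sup>+c. ennreal (G c x) * indicator {c. c x = Red} c \<partial>coloring_law p)"
      by (intro nn_integral_cong) (auto split: split_indicator)
    also have "\<dots> \<le> ennreal (K * (1 - p) / p / (1 - K * (1 - p) / p)) * (\<integral>\<^sup>+c. ennreal (G c x) \<partial>coloring_law p)"
    proof (rule red_weight_bound[OF p _ K, where B = B])
      show "0 \<le> B" using B[of undefined undefined] G0[of undefined undefined] by linarith
      show "ennreal (G c x) \<le> ennreal B" for c by (intro ennreal_leI B)
      show "ennreal (G c x) \<le> ennreal K * ennreal (G (c(z := Blue)) x)" if "c (z + (0, 1)) = Blue" for c z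
        using flip[of c z x, OF that] K(1) G0 by (simp add: ennreal_mult[symmetric] ennreal_leI)
    qed measurable
    finally show "(\<integral>\<^sup>+c. ennreal (G c x) * indicator {Red} (c x) \<partial>coloring_law p) \<le> \<dots>" .
  qed simp
  also have "\<dots> = ennreal (K * (1 - p) / p / (1 - K * (1 - p) / p)) *
      (\<integral>\<^sup>+x. w x * (\<integral>\<^sup>+c. ennreal (G c x) * 1 \<partial>coloring_law p) \<partial>count_space UNIV)"
    by (subst nn_integral_cmult[symmetric]) (auto simp: mult_ac)
  also have "(\<integral>\<^sup>+x. w x * (\<integral>\<^sup>+c. ennreal (G c x) * 1 \<partial>coloring_law p) \<partial>count_space UNIV) =
      (\<Sum>n. ennreal (a n) * annealed p n (\<lambda>c x. w x))"
    using occ[of "\<lambda>_ _. 1"] by simp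
  finally show ?thesis .
qed

end

section \<open>Annealed drift estimates\<close>

lemma walk_Suc_last: "walk c z \<omega> (Suc n) = walk c z \<omega> n + move (c (walk c z \<omega> n)) (\<omega> !! n)"
  using walk_add[of c z \<omega> n 1] by simp

text \<open>Summing the drift inequalities leaves \<open>1/100\<close> of the \<open>H\<close>-sum
  on the left, of which the red term uses up at most \<open>11/100 * 1/25 = 11/2500\<close>. The
  difference \<open>14/2500\<close> exceeds \<open>1/200\<close>. Boundedness and summability of
  \<open>a\<close> make all sums finite, so they may be subtracted.\<close>

lemma drift_sum_bound:
  fixes a F H R :: "nat \<Rightarrow> real"
  assumes a: "\<And>n. 0 \<le> a n" "summable a"
    and F: "\<And>n. 0 \<le> F n" "\<And>n. F n \<le> M" and H: "\<And>n. 0 \<le> H n" "\<And>n. H n \<le> M" and R: "\<And>n. 0 \<le> R n" "\<And>n. R n \<le> M"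
    and drift: "\<And>n. F (Suc n) + H n / 100 \<le> F n + 11/100 * R n"
    and red: "(\<Sum>n. a n * R n) \<le> \<kappa> * (\<Sum>n. a n * H n)" and \<kappa>: "\<kappa> \<le> 1/25"
    and C: "(\<Sum>n. a n * F n) \<le> C + (\<Sum>n. a n * F (Suc n))"
  shows "(\<Sum>n. a n * H n) \<le> 200 * C"
proof -
  have sm: "summable (\<lambda>n. a n * X n)" if "\<And>n. 0 \<le> X n" "\<And>n. X n \<le> M" for X
    using that a by (intro summable_comparison_test'[OF summable_mult2[OF a(2), of M], of 0])
      (auto simp: abs_mult intro!: mult_left_mono)
  note sms = sm[OF F] sm[OF H] sm[OF R] sm[of "\<lambda>n. F (Suc n)", OF F]
  have S0: "0 \<le> (\<Sum>n. a n * H n)" using a H by (intro suminf_nonneg sms) auto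
  have "(\<Sum>n. a n * F (Suc n)) + 1/100 * (\<Sum>n. a n * H n) = (\<Sum>n. a n * F (Suc n) + 1/100 * (a n * H n))"
    by (subst suminf_mult[OF sms(2), symmetric]) (rule suminf_add[OF sms(4) summable_mult[OF sms(2)]])
  also have "\<dots> \<le> (\<Sum>n. a n * F n + 11/100 * (a n * R n))"
  proof (intro suminf_le summable_add summable_mult sms)
    fix n
    have "a n * (F (Suc n) + H n / 100) \<le> a n * (F n + 11/100 * R n)"
      by (intro mult_left_mono drift a)
    then show "a n * F (Suc n) + 1/100 * (a n * H n) \<le> a n * F n + 11/100 * (a n * R n)"
      by (simp add: algebra_simps)
  qed
  also have "\<dots> = (\<Sum>n. a n * F n) + 11/100 * (\<Sum>n. a n * R n)"
    by (subst suminf_mult[OF sms(3), symmetric]) (rule suminf_add[OF sms(1) summable_mult[OF sms(3)], symmetric])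
  also have "(\<Sum>n. a n * R n) \<le> 1/25 * (\<Sum>n. a n * H n)"
    by (rule order_trans[OF red mult_right_mono[OF \<kappa> S0]])
  finally show ?thesis using C S0 by simp
qed

context two_vertex
begin

text \<open>The exceptional set concerns only the support of the noise pairs. One null set therefore
  serves all colorings, starting points and times.\<close>

lemma AE_walk_steps: "AE \<omega> in noise b r. \<forall>c z n. walk c z \<omega> (Suc n) - walk c z \<omega> n \<in> axis_unit ` {1..4}"
proof -
  have supp: "set_pmf (step_pmf b) \<subseteq> axis_unit ` {1..4}" "set_pmf (step_pmf r) \<subseteq> axis_unit ` {1..4}"
    using nn_integral_step_pmf(2)[OF jump_nonneg[of _ Blue] jump_sum] nn_integral_step_pmf(2)[OF jump_nonneg[of _ Red] jump_sum]
    by (simp_all add: jump_def)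
  let ?K = "pair_pmf (step_pmf b) (step_pmf r)"
  have "AE u in ?K. u \<in> set_pmf ?K" by (rule AE_pmfI)
  then have "AE \<omega> in noise b r. stream_all (\<lambda>u. u \<in> set_pmf ?K) \<omega>"
    unfolding noise_def by (intro prob_space.AE_stream_all[OF prob_space_measure_pmf]) auto
  then show ?thesis
  proof eventually_elim
    case (elim \<omega>)
    have "move a (\<omega> !! n) \<in> axis_unit ` {1..4}" for a n
    proof -
      have "\<omega> !! n \<in> set_pmf ?K" using elim by (simp add: stream_all_def)
      then have "fst (\<omega> !! n) \<in> set_pmf (step_pmf b)" "snd (\<omega> !! n) \<in> set_pmf (step_pmf r)" by auto
      then show ?thesis using supp by (cases a) (auto simp: move_def)
    qed
    note mem = this
    show ?case
    proof (intro allI)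
      fix c z n
      have "walk c z \<omega> (Suc n) - walk c z \<omega> n = move (c (walk c z \<omega> n)) (\<omega> !! n)"
        unfolding walk_Suc_last by simp
      then show "walk c z \<omega> (Suc n) - walk c z \<omega> n \<in> axis_unit ` {1..4}" by (simp only: mem)
    qed
  qed
qed

lemma AE_walk_fst: "AE \<omega> in noise b r. \<forall>c n. \<bar>fst (walk c z \<omega> n) - fst z\<bar> \<le> int n \<and> fst (walk c z \<omega> (Suc n)) \<le> fst (walk c z \<omega> n) + 1"
  using AE_walk_steps
proof eventually_elim
  case (elim \<omega>)
  have step: "\<bar>fst (walk c z \<omega> (Suc n)) - fst (walk c z \<omega> n)\<bar> \<le> 1" for c n
  proof -
    have I: "{1..4} = {1, 2, 3, 4::nat}" by auto
    have "walk c z \<omega> (Suc n) - walk c z \<omega> n \<in> axis_unit ` {1..4}" using elim by blast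
    moreover have "\<bar>fst d\<bar> \<le> 1" if "d \<in> axis_unit ` {1..4}" for d using that unfolding I by auto
    ultimately have "\<bar>fst (walk c z \<omega> (Suc n) - walk c z \<omega> n)\<bar> \<le> 1" by blast
    then show ?thesis by (simp only: fst_diff)
  qed
  have "\<bar>fst (walk c z \<omega> n) - fst z\<bar> \<le> int n" for c n
  proof (induction n)
    case (Suc n)
    then show ?case using step[of c n] by linarith
  qed simp
  moreover have "fst (walk c z \<omega> (Suc n)) \<le> fst (walk c z \<omega> n) + 1" for c n using step[of c n] by linarith
  ultimately show ?case by blast
qed

text \<open>Applying a step to \<open>(5/6) ^ x\<close> multiplies it by \<open>99/100\<close> at a blue site and by at most
  \<open>11/10\<close> at a red site. Capping at \<open>x = - L\<close> makes it bounded and preserves these inequalities.\<close>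

definition tilt :: "nat \<Rightarrow> site \<Rightarrow> real" where
  "tilt L z = (5/6) powi (max (fst z) (- int L))"

text \<open>At and beyond the cap a step does not increase \<open>tilt\<close> on average, but need
  not decrease it strictly; the gain of \<open>1/100\<close> is claimed only where this function is
  nonzero.\<close>

definition tilt_in :: "nat \<Rightarrow> site \<Rightarrow> real" where
  "tilt_in L z = (if - int L < fst z then tilt L z else 0)"

lemma powi_simps: "(5/6) powi (x + 1) = 5/6 * (5/6 :: real) powi x" "(5/6) powi (x - 1) = 6/5 * (5/6 :: real) powi x"
  by (simp_all add: power_int_add power_int_diff)

lemma powi_mono: "x \<le> y \<Longrightarrow> (5/6 :: real) powi y \<le> (5/6) powi x"
  by (rule power_int_decreasing) auto

lemma tilt_pos: "0 < tilt L z"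
  by (simp add: tilt_def)

lemma tilt_le: "tilt L z \<le> (6/5) ^ L"
proof -
  have "tilt L z \<le> (5/6) powi (- int L)" unfolding tilt_def by (rule powi_mono) simp
  also have "\<dots> = (6/5) ^ L" by (simp add: power_int_minus power_divide)
  finally show ?thesis .
qed

lemma tilt_le_powi: "tilt L z \<le> (5/6) powi (fst z)"
  unfolding tilt_def by (rule powi_mono) simp

lemma tilt_in_bounds: "0 \<le> tilt_in L z" "tilt_in L z \<le> (6/5) ^ L"
  using tilt_pos[of L z] tilt_le[of L z] by (auto simp: tilt_in_def)

text \<open>The blue factor is \<open>1/2 + 1/4 + 6/25 = 99/100\<close>, the red one
  \<open>11/10 - 11/30 * \<delta>\<close>. The gain \<open>1/100\<close> is credited at red sites
  too, so they are charged \<open>1/10 + 1/100\<close>. At the cap \<open>tilt\<close> is maximal,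
  hence its average cannot exceed it.\<close>

lemma step_avg_tilt:
  "step_avg c (tilt L) z + tilt_in L z / 100 \<le> tilt L z + 11/100 * (if c z = Red then tilt_in L z else 0)"
proof (cases "- int L < fst z")
  case True
  let ?T = "(5/6 :: real) powi (fst z)"
  have T: "0 < ?T" by simp
  have vals: "tilt L z = ?T" "tilt L (z + (1, 0)) = 5/6 * ?T" "tilt L (z + (-1, 0)) = 6/5 * ?T"
    "tilt L (z + (0, 1)) = ?T" "tilt L (z + (0, -1)) = ?T"
    using True powi_simps[of "fst z"] by (simp_all add: tilt_def max_absorb1)
  then have eq: "step_avg c (tilt L) z = (1/2 + jump (c z) 1 * (5/6) + jump (c z) 3 * (6/5)) * ?T" "tilt_in L z = ?T" "tilt L z = ?T"
    using True unfolding step_avg_eq tilt_in_def vals by (simp_all add: algebra_simps)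
  show ?thesis
  proof (cases "c z")
    case Blue
    then have j: "jump (c z) 1 = 3/10" "jump (c z) 3 = 1/5" using b by (simp_all add: jump_def)
    show ?thesis unfolding eq j using T Blue by simp
  next
    case Red
    have "\<delta> * ?T \<ge> 0" using \<delta> T by simp
    have j: "jump (c z) 1 = \<delta>" "jump (c z) 3 = 1/2 - \<delta>" using Red r by (simp_all add: jump_def)
    have "(1/2 + \<delta> * (5/6) + (1/2 - \<delta>) * (6/5)) * ?T = 11/10 * ?T - 11/30 * (\<delta> * ?T)"
      by (simp add: field_simps)
    then show ?thesis unfolding eq j using T Red \<open>\<delta> * ?T \<ge> 0\<close> by simp
  qed
next
  case False
  have "tilt L y \<le> tilt L z" for y unfolding tilt_def using False by (intro powi_mono) simp
  then have "step_avg c (tilt L) z \<le> tilt L z" using step_avg_mono[of "tilt L" "\<lambda>_. tilt L z" c z] by simp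
  then show ?thesis using False by (simp add: tilt_in_def)
qed

section \<open>Annealed expectations and the drift of the tilt\<close>

lemma annealed_bound:
  assumes "\<And>c x. f c x \<le> ennreal M"
  shows "annealed p n f \<le> ennreal M"
proof -
  interpret C: prob_space "coloring_law p" by (rule prob_space_coloring_law)
  have "annealed p n f \<le> (\<integral>\<^sup>+c. \<integral>\<^sup>+\<omega>. ennreal M \<partial>noise b r \<partial>coloring_law p)"
    unfolding annealed_def by (intro nn_integral_mono assms)
  then show ?thesis using C.emeasure_space_1 by simp
qed

lemma annealed_mono_AE:
  assumes "AE \<omega> in noise b r. \<forall>c. f c (walk c 0 \<omega> n) \<le> g c (walk c 0 \<omega> n)"
  shows "annealed p n f \<le> annealed p n g"
  unfolding annealed_def using assms by (intro nn_integral_mono nn_integral_mono_AE) auto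

lemma measurable_red [measurable]: "(\<lambda>c. indicator {Red} (c x) :: ennreal) \<in> borel_measurable coloring_space"
  by (rule measurable_compose[OF measurable_color]) simp

lemma annealed_add_cmult:
  fixes f g :: "(site \<Rightarrow> color) \<Rightarrow> site \<Rightarrow> ennreal"
  assumes [measurable]: "\<And>x. (\<lambda>c. f c x) \<in> borel_measurable coloring_space" "\<And>x. (\<lambda>c. g c x) \<in> borel_measurable coloring_space"
  shows "annealed p n (\<lambda>c x. f c x + k * g c x) = annealed p n f + k * annealed p n g"
proof -
  note [measurable] = measurable_annealed_inner[of f n, OF assms(1)] measurable_annealed_inner[of g n, OF assms(2)]
  have "annealed p n (\<lambda>c x. f c x + k * g c x) =
      (\<integral>\<^sup>+c. (\<integral>\<^sup>+\<omega>. f c (walk c 0 \<omega> n) \<partial>noise b r) + k * (\<integral>\<^sup>+\<omega>. g c (walk c 0 \<omega> n) \<partial>noise b r) \<partial>coloring_law p)"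
    unfolding annealed_def
    by (intro nn_integral_cong) (subst nn_integral_add, auto simp: nn_integral_cmult)
  also have "\<dots> = annealed p n f + k * annealed p n g"
    unfolding annealed_def
    by (subst nn_integral_add) (auto simp: nn_integral_cmult measurable_coloring_law_iff)
  finally show ?thesis .
qed

lemma annealed_Suc:
  fixes f :: "site \<Rightarrow> real"
  assumes "\<And>x. 0 \<le> f x"
  shows "annealed p (Suc n) (\<lambda>c x. ennreal (f x)) = annealed p n (\<lambda>c x. ennreal (step_avg c f x))"
  unfolding annealed_def nn_integral_walk_last_step[of "\<lambda>x. ennreal (f x)"] step_avg_def
  by (intro nn_integral_cong) (subst sum_ennreal[symmetric], auto simp: ennreal_mult jump_nonneg assms)

lemma annealed_tilt_drift:
  "annealed p (Suc n) (\<lambda>c x. ennreal (tilt L x)) + ennreal (1/100) * annealed p n (\<lambda>c x. ennreal (tilt_in L x)) \<le>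
   annealed p n (\<lambda>c x. ennreal (tilt L x)) + ennreal (11/100) * annealed p n (\<lambda>c x. ennreal (tilt_in L x) * indicator {Red} (c x))"
proof -
  have [measurable]: "(\<lambda>c. ennreal (step_avg c (tilt L) x)) \<in> borel_measurable coloring_space" for x
  proof -
    have [measurable]: "(\<lambda>c. jump (c x) i) \<in> borel_measurable coloring_space" for i
      by (rule measurable_compose[OF measurable_color]) simp
    show ?thesis unfolding step_avg_def by measurable
  qed
  have "annealed p (Suc n) (\<lambda>c x. ennreal (tilt L x)) + ennreal (1/100) * annealed p n (\<lambda>c x. ennreal (tilt_in L x)) =
      annealed p n (\<lambda>c x. ennreal (step_avg c (tilt L) x) + ennreal (1/100) * ennreal (tilt_in L x))"
    using tilt_pos less_imp_le by (subst annealed_Suc, blast, subst annealed_add_cmult) auto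
  also have "\<dots> \<le> annealed p n (\<lambda>c x. ennreal (tilt L x) + ennreal (11/100) * (ennreal (tilt_in L x) * indicator {Red} (c x)))"
  proof (intro annealed_mono_AE AE_I2 allI)
    fix \<omega> c
    have le: "ennreal (step_avg c (tilt L) x) + ennreal (1/100) * ennreal (tilt_in L x) \<le>
        ennreal (tilt L x) + ennreal (11/100) * (ennreal (tilt_in L x) * indicator {Red} (c x))" for x
    proof -
      have "ennreal (step_avg c (tilt L) x) + ennreal (1/100) * ennreal (tilt_in L x) =
          ennreal (step_avg c (tilt L) x + tilt_in L x / 100)"
        using tilt_in_bounds step_avg_nonneg[of "tilt L" c x] less_imp_le[OF tilt_pos]
        by (simp add: ennreal_mult[symmetric])
      also have "\<dots> \<le> ennreal (tilt L x + 11/100 * (if c x = Red then tilt_in L x else 0))"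
        by (intro ennreal_leI step_avg_tilt)
      also have "\<dots> = ennreal (tilt L x) + ennreal (11/100) * (ennreal (tilt_in L x) * indicator {Red} (c x))"
        using tilt_in_bounds[where L = L and z = x] less_imp_le[OF tilt_pos[of L x]]
        by (cases "c x = Red") (simp_all add: ennreal_mult[symmetric])
      finally show ?thesis .
    qed
    show "ennreal (step_avg c (tilt L) (walk c 0 \<omega> n)) + ennreal (1/100) * ennreal (tilt_in L (walk c 0 \<omega> n)) \<le>
        ennreal (tilt L (walk c 0 \<omega> n)) + ennreal (11/100) * (ennreal (tilt_in L (walk c 0 \<omega> n)) * indicator {Red} (c (walk c 0 \<omega> n)))"
      by (rule le)
  qed
  also have "\<dots> = annealed p n (\<lambda>c x. ennreal (tilt L x)) + ennreal (11/100) * annealed p n (\<lambda>c x. ennreal (tilt_in L x) * indicator {Red} (c x))"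
    by (rule annealed_add_cmult) measurable
  finally show ?thesis .
qed

end

text \<open>\<open>108900\<close> is the flip constant of \<open>green2\<close>. The ratio
  \<open>t \<le> 1/50\<close> gives \<open>t / (1 - t) \<le> 2 * t \<le> 1/25\<close>, the value of
  \<open>\<kappa>\<close> that \<open>drift_sum_bound\<close> tolerates.\<close>

locale sparse_red = two_vertex +
  fixes p :: real
  assumes p: "0 < p" "p < 1" and sparse: "108900 * (1 - p) / p \<le> 1/50"
begin

definition \<kappa> :: real where
  "\<kappa> = 108900 * (1 - p) / p / (1 - 108900 * (1 - p) / p)"

lemma \<kappa>_bounds: "0 \<le> \<kappa>" "\<kappa> \<le> 1/25" "\<kappa> \<le> 2 * (108900 * (1 - p) / p)"
proof -
  define t where "t = 108900 * (1 - p) / p"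
  have t: "0 \<le> t" "t \<le> 1/50" using p sparse by (auto simp: t_def)
  have "t / (1 - t) \<le> 2 * t"
  proof -
    have "t * 1 \<le> t * (2 * (1 - t))" using t by (intro mult_left_mono) auto
    then show ?thesis using t by (simp add: divide_le_eq algebra_simps)
  qed
  then show "0 \<le> \<kappa>" "\<kappa> \<le> 1/25" "\<kappa> \<le> 2 * (108900 * (1 - p) / p)"
    using t unfolding \<kappa>_def t_def[symmetric] by auto
qed

lemma sparse_less_1: "108900 * (1 - p) / p < 1"
  using sparse by linarith

text \<open>For \<open>green\<close> the factor 330 is weakened to \<open>108900\<close>, so that a
  single \<open>\<kappa>\<close> serves both Green functions.\<close>

lemma red_green:
  assumes s: "1/2 \<le> s" "s < 1"
  shows "(\<Sum>n. ennreal (s ^ n) * annealed p n (\<lambda>c x. w x * indicator {Red} (c x))) \<le>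
    ennreal \<kappa> * (\<Sum>n. ennreal (s ^ n) * annealed p n (\<lambda>c x. w x))"
  unfolding \<kappa>_def
proof (rule red_occupation[OF p])
  have s0: "0 \<le> s" using s by simp
  show "0 \<le> s ^ n" for n using s0 by simp
  show "(\<lambda>n. s ^ n * trans_prob c n x 0) sums green s c x 0" for c x
    unfolding green_def by (rule summable_sums[OF summable_green[OF s0 s(2)]])
  show "green s c x 0 \<le> 1 / (1 - s)" for c x by (rule green_bounds[OF s0 s(2)])
  show "green s c x 0 \<le> 108900 * green s (c(z := Blue)) x 0" if "c (z + (0, 1)) = Blue" for c z x
    using green_flip[where c = c and z = z, OF s that, of x 0] green_bounds(1)[OF s0 s(2), of "c(z := Blue)" x 0] by simp
qed (rule sparse_less_1 | simp)+

lemma red_green2: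
  assumes s: "1/2 \<le> s" "s < 1"
  shows "(\<Sum>n. ennreal (real (Suc n) * s ^ n) * annealed p n (\<lambda>c x. w x * indicator {Red} (c x))) \<le>
    ennreal \<kappa> * (\<Sum>n. ennreal (real (Suc n) * s ^ n) * annealed p n (\<lambda>c x. w x))"
  unfolding \<kappa>_def
proof (rule red_occupation[OF p])
  have s0: "0 \<le> s" using s by simp
  show "0 \<le> real (Suc n) * s ^ n" for n using s0 by simp
  show "(\<lambda>n. real (Suc n) * s ^ n * trans_prob c n x 0) sums green2 s c x 0" for c x
    unfolding green2_def by (rule summable_sums[OF summable_green2[OF s0 s(2)]])
  show "green2 s c x 0 \<le> 1 / (1 - s)\<^sup>2" for c x by (rule green2_bounds[OF s0 s(2)])
  show "green2 s c x 0 \<le> 108900 * green2 s (c(z := Blue)) x 0" if "c (z + (0, 1)) = Blue" for c z x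
    using green2_flip[where c = c and z = z, OF s that, of x 0] .
qed (rule sparse_less_1 | simp)+

section \<open>Summability of the exponential moments\<close>

definition EF :: "nat \<Rightarrow> nat \<Rightarrow> real" where
  "EF L n = enn2real (annealed p n (\<lambda>c x. ennreal (tilt L x)))"

definition EH :: "nat \<Rightarrow> nat \<Rightarrow> real" where
  "EH L n = enn2real (annealed p n (\<lambda>c x. ennreal (tilt_in L x)))"

definition ER :: "nat \<Rightarrow> nat \<Rightarrow> real" where
  "ER L n = enn2real (annealed p n (\<lambda>c x. ennreal (tilt_in L x) * indicator {Red} (c x)))"

definition E_tilt :: "nat \<Rightarrow> real" where
  "E_tilt n = enn2real (annealed p n (\<lambda>c x. ennreal ((5/6) powi (fst x))))"

lemma
  shows EF: "annealed p n (\<lambda>c x. ennreal (tilt L x)) = ennreal (EF L n)" "0 \<le> EF L n" "EF L n \<le> (6/5) ^ L"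
    and EH: "annealed p n (\<lambda>c x. ennreal (tilt_in L x)) = ennreal (EH L n)" "0 \<le> EH L n" "EH L n \<le> (6/5) ^ L"
    and ER: "annealed p n (\<lambda>c x. ennreal (tilt_in L x) * indicator {Red} (c x)) = ennreal (ER L n)" "0 \<le> ER L n" "ER L n \<le> (6/5) ^ L"
proof -
  have *: "X = ennreal (enn2real X) \<and> 0 \<le> enn2real X \<and> enn2real X \<le> (6/5) ^ L" if "X \<le> ennreal ((6/5) ^ L)" for X
    using that enn2real_mono[OF that] le_less_trans[OF that ennreal_less_top] by auto
  have 1: "annealed p n (\<lambda>c x. ennreal (tilt L x)) \<le> ennreal ((6/5) ^ L)"
    by (intro annealed_bound ennreal_leI tilt_le)
  have 2: "annealed p n (\<lambda>c x. ennreal (tilt_in L x)) \<le> ennreal ((6/5) ^ L)"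
    by (intro annealed_bound ennreal_leI tilt_in_bounds)
  have 3: "annealed p n (\<lambda>c x. ennreal (tilt_in L x) * indicator {Red} (c x)) \<le> ennreal ((6/5) ^ L)"
    by (intro annealed_bound) (auto split: split_indicator intro!: ennreal_leI tilt_in_bounds)
  show "annealed p n (\<lambda>c x. ennreal (tilt L x)) = ennreal (EF L n)" "0 \<le> EF L n" "EF L n \<le> (6/5) ^ L"
    using *[OF 1] by (simp_all add: EF_def)
  show "annealed p n (\<lambda>c x. ennreal (tilt_in L x)) = ennreal (EH L n)" "0 \<le> EH L n" "EH L n \<le> (6/5) ^ L"
    using *[OF 2] by (simp_all add: EH_def)
  show "annealed p n (\<lambda>c x. ennreal (tilt_in L x) * indicator {Red} (c x)) = ennreal (ER L n)" "0 \<le> ER L n" "ER L n \<le> (6/5) ^ L"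
    using *[OF 3] by (simp_all add: ER_def)
qed

lemma E_drift: "EF L (Suc n) + EH L n / 100 \<le> EF L n + 11/100 * ER L n"
  using annealed_tilt_drift[of p n L] unfolding EF(1) EH(1) ER(1)
  using EF(2) EH(2) ER(2) by (simp add: ennreal_mult[symmetric] ennreal_plus[symmetric] ennreal_le_iff del: ennreal_plus)

lemma EF_0: "EF L 0 = 1"
proof -
  interpret C: prob_space "coloring_law p" by (rule prob_space_coloring_law)
  have "annealed p 0 (\<lambda>c x. ennreal (tilt L x)) = ennreal (tilt L 0)"
    using C.emeasure_space_1 by (simp add: annealed_def)
  then show ?thesis by (simp add: EF_def tilt_def max_def)
qed

text \<open>Fewer than \<open>L\<close> steps from the origin cannot reach the cap at
  \<open>- L\<close>.\<close>

lemma EH_eq: "n < L \<Longrightarrow> EH L n = E_tilt n"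
proof -
  assume n: "n < L"
  have "AE \<omega> in noise b r. \<forall>c. ennreal (tilt_in L (walk c 0 \<omega> n)) = ennreal ((5/6) powi (fst (walk c 0 \<omega> n)))"
    using AE_walk_fst[of 0]
  proof eventually_elim
    case (elim \<omega>)
    have "- int L < fst (walk c 0 \<omega> n)" for c
    proof -
      have "\<bar>fst (walk c 0 \<omega> n) - fst (0 :: site)\<bar> \<le> int n" by (rule elim[rule_format, THEN conjunct1])
      then show ?thesis using n by (simp add: abs_le_iff)
    qed
    then show ?case by (simp add: tilt_in_def tilt_def max_absorb1 less_imp_le)
  qed
  then have "annealed p n (\<lambda>c x. ennreal (tilt_in L x)) = annealed p n (\<lambda>c x. ennreal ((5/6) powi (fst x)))"
    unfolding annealed_def by (intro nn_integral_cong nn_integral_cong_AE) auto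
  then show ?thesis by (simp add: EH_def E_tilt_def)
qed

lemma E_tilt: "annealed p n (\<lambda>c x. ennreal ((5/6) powi (fst x))) = ennreal (E_tilt n)" "0 \<le> E_tilt n"
proof -
  have "AE \<omega> in noise b r. \<forall>c. ennreal ((5/6) powi (fst (walk c 0 \<omega> n))) \<le> ennreal (tilt_in (Suc n) (walk c 0 \<omega> n))"
    using AE_walk_fst[of 0]
  proof eventually_elim
    case (elim \<omega>)
    have "- int (Suc n) < fst (walk c 0 \<omega> n)" for c
    proof -
      have "\<bar>fst (walk c 0 \<omega> n) - fst (0 :: site)\<bar> \<le> int n" by (rule elim[rule_format, THEN conjunct1])
      then show ?thesis by (simp add: abs_le_iff)
    qed
    then show ?case by (simp add: tilt_in_def tilt_def max_absorb1 less_imp_le)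
  qed
  then have "annealed p n (\<lambda>c x. ennreal ((5/6) powi (fst x))) \<le> annealed p n (\<lambda>c x. ennreal (tilt_in (Suc n) x))"
    by (rule annealed_mono_AE)
  also have "\<dots> < \<infinity>" unfolding EH(1) by simp
  finally show "annealed p n (\<lambda>c x. ennreal ((5/6) powi (fst x))) = ennreal (E_tilt n)" by (simp add: E_tilt_def)
qed (simp add: E_tilt_def)

lemma EF_le: "EF L n \<le> E_tilt n"
proof -
  have "ennreal (EF L n) \<le> ennreal (E_tilt n)"
    unfolding EF(1)[symmetric] E_tilt(1)[symmetric]
    by (intro annealed_mono_AE AE_I2 allI ennreal_leI tilt_le_powi)
  then show ?thesis using E_tilt(2) by simp
qed

lemma summable_geometric_bounded:
  fixes X :: "nat \<Rightarrow> real"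
  assumes "\<And>n. 0 \<le> a n" "summable a" "\<And>n. 0 \<le> X n" "\<And>n. X n \<le> M"
  shows "summable (\<lambda>n. a n * X n)"
  using assms by (intro summable_comparison_test'[OF summable_mult2[OF assms(2), of M], of 0])
      (auto simp: abs_mult intro!: mult_left_mono)

lemma red_sum_real:
  assumes a: "\<And>n. 0 \<le> a n" "summable a"
    and red: "(\<Sum>n. ennreal (a n) * annealed p n (\<lambda>c x. ennreal (tilt_in L x) * indicator {Red} (c x))) \<le>
      ennreal \<kappa> * (\<Sum>n. ennreal (a n) * annealed p n (\<lambda>c x. ennreal (tilt_in L x)))"
  shows "(\<Sum>n. a n * ER L n) \<le> \<kappa> * (\<Sum>n. a n * EH L n)"
proof -
  have *: "(\<Sum>n. ennreal (a n) * ennreal (X n)) = ennreal (\<Sum>n. a n * X n)" "0 \<le> (\<Sum>n. a n * X n)"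
    if "\<And>n. 0 \<le> X n" "\<And>n. X n \<le> (6/5) ^ L" for X
  proof -
    have sm: "summable (\<lambda>n. a n * X n)" by (rule summable_geometric_bounded[OF a that])
    show "(\<Sum>n. ennreal (a n) * ennreal (X n)) = ennreal (\<Sum>n. a n * X n)"
      unfolding ennreal_mult[OF a(1) that(1), symmetric]
      using a that by (intro suminf_ennreal_eq summable_sums sm) auto
    show "0 \<le> (\<Sum>n. a n * X n)" using a that by (intro suminf_nonneg sm) auto
  qed
  show ?thesis
    using red unfolding ER(1) EH(1) *(1)[OF ER(2,3)] *(1)[OF EH(2,3)]
    using \<kappa>_bounds(1) *(2)[OF EH(2,3)] by (simp add: ennreal_mult[symmetric] ennreal_le_iff)
qed

text \<open>The red contribution to the drift is absorbed by the blue one, uniformly in the discount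
  \<open>s < 1\<close> and in the cap, which are then removed.\<close>

lemma sum_E_tilt_le: "(\<Sum>n<N. E_tilt n) \<le> 200"
proof -
  have le: "(\<Sum>n<N. s ^ n * E_tilt n) \<le> 200" if s: "1/2 \<le> s" "s < 1" for s
  proof -
    have sm: "summable (\<lambda>n. s ^ n)" using s by (intro summable_geometric) simp
    have a: "0 \<le> s ^ n" for n using s by simp
    have smF: "summable (\<lambda>n. s ^ n * EF N n)" "summable (\<lambda>n. s ^ n * EF N (Suc n))"
      by (rule summable_geometric_bounded[OF a sm EF(2,3)], rule summable_geometric_bounded[OF a sm EF(2,3)])
    have "(\<Sum>n. s ^ n * EH N n) \<le> 200 * 1"
    proof (rule drift_sum_bound[where F = "EF N" and H = "EH N" and R = "ER N" and M = "(6/5) ^ N" and a = "\<lambda>n. s ^ n", OF a sm EF(2,3) EH(2,3) ER(2,3) E_drift _ \<kappa>_bounds(2)])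
      show "(\<Sum>n. s ^ n * ER N n) \<le> \<kappa> * (\<Sum>n. s ^ n * EH N n)"
        by (rule red_sum_real[OF a sm red_green[OF s]])
      \<comment> \<open>An index shift isolates the initial value \<open>EF N 0 = 1\<close>, which
        is the constant \<open>C\<close>; the remaining factor \<open>s\<close> is at most
        1.\<close>
      have "(\<Sum>n. s ^ n * EF N n) = 1 + (\<Sum>n. s * (s ^ n * EF N (Suc n)))"
        using suminf_split_head[OF smF(1)] EF_0 by (simp add: mult.assoc)
      also have "(\<Sum>n. s * (s ^ n * EF N (Suc n))) = s * (\<Sum>n. s ^ n * EF N (Suc n))"
        by (rule suminf_mult[OF smF(2)])
      also have "\<dots> \<le> 1 * (\<Sum>n. s ^ n * EF N (Suc n))"
        using s a EF(2) by (intro mult_right_mono suminf_nonneg smF) auto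
      finally show "(\<Sum>n. s ^ n * EF N n) \<le> 1 + (\<Sum>n. s ^ n * EF N (Suc n))" by simp
    qed
    moreover have "(\<Sum>n<N. s ^ n * E_tilt n) = (\<Sum>n<N. s ^ n * EH N n)" by (simp add: EH_eq)
    moreover have "(\<Sum>n<N. s ^ n * EH N n) \<le> (\<Sum>n. s ^ n * EH N n)"
      using a EH(2) by (intro sum_le_suminf summable_geometric_bounded[OF a sm EH(2,3)]) auto
    ultimately show ?thesis by simp
  qed
  have lim: "(\<lambda>k. \<Sum>n<N. (1 - 1 / real (Suc (Suc k))) ^ n * E_tilt n) \<longlonglongrightarrow> (\<Sum>n<N. (1 - 0) ^ n * E_tilt n)"
    by (intro tendsto_intros LIMSEQ_inverse_real_of_nat[unfolded inverse_eq_divide, THEN LIMSEQ_Suc])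
  have "(\<Sum>n<N. (1 - 0) ^ n * E_tilt n) \<le> 200"
    by (rule LIMSEQ_le_const2[OF lim], intro exI allI impI le) (auto simp: field_simps)
  then show ?thesis by simp
qed

lemma summable_E_tilt: "summable E_tilt" "suminf E_tilt \<le> 200"
proof -
  show "summable E_tilt" using sum_E_tilt_le E_tilt(2) by (intro summableI_nonneg_bounded[of _ 200]) auto
  then show "suminf E_tilt \<le> 200" by (rule suminf_le_const) (rule sum_E_tilt_le)
qed

text \<open>With weights \<open>(n + 1) * s ^ n\<close> the index shift leaves the discounted sum of
  \<open>EF N\<close>, which the previous bound controls by 200; hence
  \<open>40000 = 200 * 200\<close>.\<close>

lemma sum_Suc_E_tilt_le: "(\<Sum>n<N. real (Suc n) * E_tilt n) \<le> 40000"
proof -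
  have le: "(\<Sum>n<N. real (Suc n) * s ^ n * E_tilt n) \<le> 40000" if s: "1/2 \<le> s" "s < 1" for s
  proof -
    have s0: "0 \<le> s" using s by simp
    have sm: "summable (\<lambda>n. real (Suc n) * s ^ n)" by (rule summable_Suc_power[OF s0 s(2)])
    have sm1: "summable (\<lambda>n. s ^ n)" using s by (intro summable_geometric) simp
    have a: "0 \<le> real (Suc n) * s ^ n" for n using s by simp
    have a1: "0 \<le> s ^ n" for n using s by simp
    have smF: "summable (\<lambda>n. real (Suc n) * s ^ n * EF N n)" "summable (\<lambda>n. real (Suc n) * s ^ n * EF N (Suc n))" "summable (\<lambda>n. s ^ n * EF N n)"
      by (rule summable_geometric_bounded[OF a sm EF(2,3)], rule summable_geometric_bounded[OF a sm EF(2,3)],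
          rule summable_geometric_bounded[OF a1 sm1 EF(2,3)])
    have smD: "summable (\<lambda>n. real n * s ^ n * EF N n)"
      using summable_diff[OF smF(1,3)] by (simp add: algebra_simps)
    have "(\<Sum>n. real (Suc n) * s ^ n * EH N n) \<le> 200 * (\<Sum>n. s ^ n * EF N n)"
    proof (rule drift_sum_bound[where F = "EF N" and H = "EH N" and R = "ER N" and M = "(6/5) ^ N" and a = "\<lambda>n. real (Suc n) * s ^ n", OF a sm EF(2,3) EH(2,3) ER(2,3) E_drift _ \<kappa>_bounds(2)])
      show "(\<Sum>n. real (Suc n) * s ^ n * ER N n) \<le> \<kappa> * (\<Sum>n. real (Suc n) * s ^ n * EH N n)"
        by (rule red_sum_real[OF a sm red_green2[OF s]])
      have "(\<Sum>n. real (Suc n) * s ^ n * EF N n) = (\<Sum>n. s ^ n * EF N n + real n * s ^ n * EF N n)"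
        by (simp add: algebra_simps)
      also have "\<dots> = (\<Sum>n. s ^ n * EF N n) + (\<Sum>n. real n * s ^ n * EF N n)"
        by (rule suminf_add[OF smF(3) smD, symmetric])
      also have "(\<Sum>n. real n * s ^ n * EF N n) = (\<Sum>n. s * (real (Suc n) * s ^ n * EF N (Suc n)))"
        using suminf_split_head[OF smD] by (simp add: mult_ac del: of_nat_Suc)
      also have "\<dots> = s * (\<Sum>n. real (Suc n) * s ^ n * EF N (Suc n))"
        by (rule suminf_mult[OF smF(2)])
      also have "\<dots> \<le> 1 * (\<Sum>n. real (Suc n) * s ^ n * EF N (Suc n))"
        using s a EF(2) by (intro mult_right_mono suminf_nonneg smF) auto
      finally show "(\<Sum>n. real (Suc n) * s ^ n * EF N n) \<le> (\<Sum>n. s ^ n * EF N n) + (\<Sum>n. real (Suc n) * s ^ n * EF N (Suc n))"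
        by simp
    qed
    also have "(\<Sum>n. s ^ n * EF N n) \<le> suminf E_tilt"
    proof (intro suminf_le smF summable_E_tilt)
      fix n
      have "s ^ n * EF N n \<le> 1 * E_tilt n"
        using s EF_le[of N n] EF(2) by (intro mult_mono) (auto simp: power_le_one)
      then show "s ^ n * EF N n \<le> E_tilt n" by simp
    qed
    also have "\<dots> \<le> 200" by (rule summable_E_tilt)
    finally have "(\<Sum>n. real (Suc n) * s ^ n * EH N n) \<le> 40000" by simp
    moreover have "(\<Sum>n<N. real (Suc n) * s ^ n * E_tilt n) = (\<Sum>n<N. real (Suc n) * s ^ n * EH N n)" by (simp add: EH_eq)
    moreover have "(\<Sum>n<N. real (Suc n) * s ^ n * EH N n) \<le> (\<Sum>n. real (Suc n) * s ^ n * EH N n)"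
      using a EH(2) by (intro sum_le_suminf summable_geometric_bounded[OF a sm EH(2,3)]) auto
    ultimately show ?thesis by simp
  qed
  have lim: "(\<lambda>k. \<Sum>n<N. real (Suc n) * (1 - 1 / real (Suc (Suc k))) ^ n * E_tilt n) \<longlonglongrightarrow> (\<Sum>n<N. real (Suc n) * (1 - 0) ^ n * E_tilt n)"
    by (intro tendsto_intros LIMSEQ_inverse_real_of_nat[unfolded inverse_eq_divide, THEN LIMSEQ_Suc])
  have "(\<Sum>n<N. real (Suc n) * (1 - 0) ^ n * E_tilt n) \<le> 40000"
    by (rule LIMSEQ_le_const2[OF lim], intro exI allI impI le) (auto simp: field_simps)
  then show ?thesis by simp
qed

section \<open>Expected time at red sites\<close>

definition E_red :: "nat \<Rightarrow> real" where
  "E_red n = enn2real (annealed p n (\<lambda>c x. indicator {Red} (c x)))"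

lemma E_red: "annealed p n (\<lambda>c x. indicator {Red} (c x)) = ennreal (E_red n)" "0 \<le> E_red n" "E_red n \<le> 1"
proof -
  have *: "annealed p n (\<lambda>c x. indicator {Red} (c x)) \<le> ennreal 1"
    by (rule annealed_bound) (auto split: split_indicator)
  show "annealed p n (\<lambda>c x. indicator {Red} (c x)) = ennreal (E_red n)" "0 \<le> E_red n" "E_red n \<le> 1"
    using enn2real_mono[OF *] le_less_trans[OF * ennreal_less_top] by (auto simp: E_red_def)
qed

text \<open>Take the discount \<open>s = 1 - 1 / (2 * n)\<close>: its total weight is
  \<open>2 * n\<close>, and Bernoulli's inequality gives \<open>s ^ k \<ge> 1/2\<close> for
  \<open>k < n\<close>. The two factors 2 make up the 4.\<close>

lemma sum_E_red_le: "(\<Sum>k<n. E_red k) \<le> 4 * \<kappa> * n"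
proof (cases "n = 0")
  case False
  interpret C: prob_space "coloring_law p" by (rule prob_space_coloring_law)
  define s where "s = 1 - 1 / (2 * real n)"
  have s: "1/2 \<le> s" "s < 1" using False by (auto simp: s_def field_simps)
  have sm: "summable (\<lambda>k. s ^ k)" using s by (intro summable_geometric) simp
  have a: "0 \<le> s ^ k" for k using s by simp
  have smR: "summable (\<lambda>k. s ^ k * E_red k)" by (rule summable_geometric_bounded[OF a sm E_red(2,3)])
  have one: "annealed p k (\<lambda>c x. 1) = 1" for k using C.emeasure_space_1 by (simp add: annealed_def)
  have "ennreal (\<Sum>k. s ^ k * E_red k) = (\<Sum>k. ennreal (s ^ k) * annealed p k (\<lambda>c x. 1 * indicator {Red} (c x)))"
    unfolding mult_1 E_red(1) ennreal_mult[OF a E_red(2), symmetric]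
    using a E_red(2) by (intro suminf_ennreal_eq[symmetric] summable_sums smR) auto
  also have "\<dots> \<le> ennreal \<kappa> * (\<Sum>k. ennreal (s ^ k) * annealed p k (\<lambda>c x. 1))"
    by (rule red_green[OF s])
  also have "(\<Sum>k. ennreal (s ^ k) * annealed p k (\<lambda>c x. 1)) = ennreal (\<Sum>k. s ^ k)"
    unfolding one mult_1_right by (intro suminf_ennreal_eq summable_sums sm a)
  also have "(\<Sum>k. s ^ k) = 2 * n" using s False by (simp add: suminf_geometric) (simp add: s_def)
  finally have "ennreal (\<Sum>k. s ^ k * E_red k) \<le> ennreal (\<kappa> * (2 * n))"
    using \<kappa>_bounds by (simp add: ennreal_mult)
  then have *: "(\<Sum>k. s ^ k * E_red k) \<le> \<kappa> * (2 * n)" using \<kappa>_bounds by (subst (asm) ennreal_le_iff) auto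
  have "(\<Sum>k<n. 1/2 * E_red k) \<le> (\<Sum>k<n. s ^ k * E_red k)"
  proof (intro sum_mono mult_right_mono E_red)
    fix k assume k: "k \<in> {..<n}"
    have "1/2 \<le> 1 + real k * (- 1 / (2 * real n))" using k False by (simp add: field_simps)
    also have "\<dots> \<le> (1 + (- 1 / (2 * real n))) ^ k" using False by (intro Bernoulli_inequality) (auto simp: field_simps)
    finally show "1/2 \<le> s ^ k" by (simp add: s_def)
  qed
  also have "\<dots> \<le> (\<Sum>k. s ^ k * E_red k)" using a E_red(2) by (intro sum_le_suminf smR) auto
  also note *
  finally have "(\<Sum>k<n. E_red k) / 2 \<le> \<kappa> * (2 * n)" by (simp add: sum_divide_distrib)
  then show ?thesis by simp
qed simp

end

section \<open>The first coordinate of the walk\<close>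

definition xwalk :: "(site \<Rightarrow> color) \<Rightarrow> (site \<times> site) stream \<Rightarrow> nat \<Rightarrow> int" where
  "xwalk c \<omega> n = fst (walk c 0 \<omega> n)"

lemma measurable_xwalk [measurable]:
  "(\<lambda>x. xwalk (fst x) (snd x)) \<in> measurable (coloring_space \<Otimes>\<^sub>M noise_space) int_paths"
  unfolding xwalk_def[abs_def]
  by (intro measurable_abs_UNIV measurable_compose[OF measurable_walk]) simp

lemma measurable_xwalk_noise [measurable]: "xwalk c \<in> measurable noise_space int_paths"
  unfolding xwalk_def[abs_def]
  by (intro measurable_abs_UNIV measurable_compose[OF measurable_walk_noise]) simp

lemma xwalk_0 [simp]: "xwalk c \<omega> 0 = 0"
  by (simp add: xwalk_def)

section \<open>The annealed law of the first coordinate\<close>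

lemma measurable_nn_integral_noise:
  assumes "(\<lambda>x. F (fst x) (snd x)) \<in> borel_measurable (coloring_space \<Otimes>\<^sub>M noise_space)"
  shows "(\<lambda>c. \<integral>\<^sup>+\<omega>. F c \<omega> \<partial>noise b r) \<in> borel_measurable coloring_space"
proof -
  interpret N: prob_space "noise b r" by (rule prob_space_noise)
  have "(\<lambda>x. F (fst x) (snd x)) \<in> borel_measurable (coloring_space \<Otimes>\<^sub>M noise b r)"
    using assms by (simp add: measurable_cong_sets[OF sets_pair_measure_cong[OF refl sets_noise] refl])
  from N.borel_measurable_nn_integral_fst[OF this] show ?thesis by simp
qed

definition path_law :: "real \<Rightarrow> (nat \<Rightarrow> real) \<Rightarrow> (nat \<Rightarrow> real) \<Rightarrow> (nat \<Rightarrow> int) measure" where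
  "path_law p b r = distr (coloring_law p \<Otimes>\<^sub>M noise b r) int_paths (\<lambda>x. xwalk (fst x) (snd x))"

lemma sets_joint: "sets (coloring_law p \<Otimes>\<^sub>M noise b r) = sets (coloring_space \<Otimes>\<^sub>M noise_space)"
  by (intro sets_pair_measure_cong sets_coloring_law sets_noise)

lemma measurable_joint_iff: "measurable (coloring_law p \<Otimes>\<^sub>M noise b r) N = measurable (coloring_space \<Otimes>\<^sub>M noise_space) N"
  by (rule measurable_cong_sets[OF sets_joint refl])

lemma nn_integral_path_law:
  assumes f: "f \<in> borel_measurable int_paths"
  shows "(\<integral>\<^sup>+x. f x \<partial>path_law p b r) = (\<integral>\<^sup>+c. \<integral>\<^sup>+\<omega>. f (xwalk c \<omega>) \<partial>noise b r \<partial>coloring_law p)"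
proof -
  interpret N: prob_space "noise b r" by (rule prob_space_noise)
  have m: "(\<lambda>x. f (xwalk (fst x) (snd x))) \<in> borel_measurable (coloring_law p \<Otimes>\<^sub>M noise b r)"
    unfolding measurable_joint_iff by (rule measurable_compose[OF measurable_xwalk f])
  have "(\<integral>\<^sup>+x. f x \<partial>path_law p b r) = (\<integral>\<^sup>+x. f (xwalk (fst x) (snd x)) \<partial>(coloring_law p \<Otimes>\<^sub>M noise b r))"
    unfolding path_law_def by (rule nn_integral_distr) (use f measurable_xwalk in \<open>simp_all add: measurable_joint_iff\<close>)
  then show ?thesis using N.nn_integral_fst[OF m] by simp
qed

lemma AE_path_lawI:
  assumes P: "Measurable.pred int_paths P" and ae: "\<And>c. AE \<omega> in noise b r. P (xwalk c \<omega>)"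
  shows "AE x in path_law p b r. P x"
proof -
  interpret C: prob_space "coloring_law p" by (rule prob_space_coloring_law)
  interpret N: prob_space "noise b r" by (rule prob_space_noise)
  interpret pair_prob_space "coloring_law p" "noise b r" ..
  have "AE x in coloring_law p \<Otimes>\<^sub>M noise b r. P (xwalk (fst x) (snd x))"
  proof (rule AE_pair_measure)
    have "Measurable.pred (coloring_law p \<Otimes>\<^sub>M noise b r) (\<lambda>x. P (xwalk (fst x) (snd x)))"
      unfolding measurable_joint_iff by (rule measurable_compose[OF measurable_xwalk P])
    then show "{x \<in> space (coloring_law p \<Otimes>\<^sub>M noise b r). P (xwalk (fst x) (snd x))} \<in> sets (coloring_law p \<Otimes>\<^sub>M noise b r)"
      by (simp add: pred_def)
  qed (use ae in simp)
  then show ?thesis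
    unfolding path_law_def
    using P by (subst AE_distr_iff) (auto simp: measurable_joint_iff pred_def)
qed

lemma prob_space_path_law: "prob_space (path_law p b r)"
proof -
  interpret C: prob_space "coloring_law p" by (rule prob_space_coloring_law)
  interpret N: prob_space "noise b r" by (rule prob_space_noise)
  interpret pair_prob_space "coloring_law p" "noise b r" ..
  show ?thesis unfolding path_law_def
    by (rule prob_space_distr) (simp add: measurable_joint_iff)
qed

lemma sets_path_law [measurable_cong]: "sets (path_law p b r) = sets int_paths"
  by (simp add: path_law_def)

lemma borel_measurable_nn_integral_int:
  fixes f :: "int \<Rightarrow> 'a \<Rightarrow> ennreal"
  assumes [measurable]: "\<And>y. (\<lambda>x. f y x) \<in> borel_measurable M"
  shows "(\<lambda>x. \<integral>\<^sup>+y. f y x \<partial>count_space UNIV) \<in> borel_measurable M"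
proof -
  have *: "(\<integral>\<^sup>+y. f y x \<partial>count_space UNIV) = (\<Sum>k. f (from_nat_into UNIV k) x)" for x
    by (subst nn_integral_bij_count_space[symmetric, OF bij_betw_from_nat_into])
       (auto simp: nn_integral_count_space_nat infinite_UNIV_char_0)
  show ?thesis unfolding * by measurable
qed

lemma measurable_real_coord [measurable]:
  fixes h :: "int \<Rightarrow> 'b :: topological_space"
  shows "(\<lambda>x. h (x n)) \<in> borel_measurable int_paths"
  by (rule measurable_compose[OF measurable_coord]) simp

lemma xwalk_cong:
  assumes "\<And>k. k < n \<Longrightarrow> c (walk c 0 \<omega> k) = c' (walk c 0 \<omega> k)" "k \<le> n"
  shows "walk c' 0 \<omega> k = walk c 0 \<omega> k"
  by (rule walk_cong_color) (use assms in auto)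

section \<open>Verification of the regenerative structure\<close>

context sparse_red
begin

abbreviation \<nu> :: "(nat \<Rightarrow> int) measure" where "\<nu> \<equiv> path_law p b r"

lemma AE_path_step: "AE x in \<nu>. \<forall>n. x (Suc n) \<le> x n + 1"
proof (rule AE_path_lawI)
  show "AE \<omega> in noise b r. \<forall>n. xwalk c \<omega> (Suc n) \<le> xwalk c \<omega> n + 1" for c
    using AE_walk_fst[of 0] by eventually_elim (auto simp: xwalk_def simp del: walk.simps)
qed measurable

lemma AE_path_abs: "AE x in \<nu>. \<forall>n. \<bar>x n\<bar> \<le> int n"
proof (rule AE_path_lawI)
  show "AE \<omega> in noise b r. \<forall>n. \<bar>xwalk c \<omega> n\<bar> \<le> int n" for c
    using AE_walk_fst[of 0] by eventually_elim (auto simp: xwalk_def simp del: walk.simps)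
  have "Measurable.pred int_paths (\<lambda>x. \<forall>n. - int n \<le> x n \<and> x n < int n + 1)" by measurable
  moreover have "(\<bar>y\<bar> \<le> k) = (- k \<le> y \<and> y < k + 1)" for y k :: int by auto
  ultimately show "Measurable.pred int_paths (\<lambda>x. \<forall>n. \<bar>x n\<bar> \<le> int n)" by simp
qed

lemma AE_path_start: "AE x in \<nu>. x 0 = 0"
  by (rule AE_path_lawI) auto

lemma nn_integral_path_coord:
  fixes h :: "int \<Rightarrow> ennreal"
  shows "(\<integral>\<^sup>+x. h (x n) \<partial>\<nu>) = annealed p n (\<lambda>c x. h (fst x))"
  by (subst nn_integral_path_law) (auto simp: annealed_def xwalk_def)

text \<open>The series of \<open>(5/6) ^ x n\<close> has finite mean, so almost surely its terms
  tend to 0 and the path tends to the right. It skips no level on the way.\<close>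

lemma AE_path_hits: "AE x in \<nu>. \<forall>m. \<exists>n. first_hit x m n"
proof -
  have "(\<integral>\<^sup>+x. (\<Sum>n. ennreal ((5/6) powi (x n))) \<partial>\<nu>) = (\<Sum>n. \<integral>\<^sup>+x. ennreal ((5/6) powi (x n)) \<partial>\<nu>)"
    by (rule nn_integral_suminf) measurable
  also have "\<dots> = (\<Sum>n. ennreal (E_tilt n))"
    by (simp add: nn_integral_path_coord[of "\<lambda>k. ennreal ((5/6) powi k)"] E_tilt(1))
  also have "\<dots> = ennreal (suminf E_tilt)"
    by (intro suminf_ennreal_eq summable_sums summable_E_tilt E_tilt(2))
  finally have "AE x in \<nu>. (\<Sum>n. ennreal ((5/6) powi (x n))) \<noteq> \<infinity>"
    by (intro nn_integral_PInf_AE) auto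
  with AE_path_start AE_path_step show ?thesis
  proof eventually_elim
    case (elim x)
    have "summable (\<lambda>n. (5/6 :: real) powi (x n))"
      using elim(3) by (intro summable_suminf_not_top) auto
    then have lim: "(\<lambda>n. (5/6 :: real) powi (x n)) \<longlonglongrightarrow> 0" by (rule summable_LIMSEQ_zero)
    show ?case
    proof
      fix m
      have "0 < (5/6 :: real) powi int m" by simp
      from order_tendstoD(2)[OF lim this] obtain n where "(5/6 :: real) powi (x n) < (5/6) powi int m"
        by (auto simp: eventually_sequentially)
      then have "int m \<le> x n" using powi_mono[of "x n" "int m"] by (meson leI less_imp_le not_less)
      then have ex: "\<exists>n. int m \<le> x n" ..
      define n where "n = (LEAST n. int m \<le> x n)"
      have n: "int m \<le> x n" unfolding n_def by (rule LeastI_ex[OF ex])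
      have lt: "x k < int m" if "k < n" for k using not_less_Least[of k "\<lambda>n. int m \<le> x n"] that by (simp add: n_def)
      have "x n \<le> int m"
      proof (cases n)
        case 0
        then show ?thesis using elim(1) by simp
      next
        case (Suc k)
        then show ?thesis using lt[of k] elim(2)[rule_format, of k] by simp
      qed
      then show "\<exists>n. first_hit x m n" using n lt by (auto simp: first_hit_def)
    qed
  qed
qed

text \<open>Markov's inequality for the exponential moment. The sum over \<open>n\<close> of the
  right side is finite and exponentially small in \<open>h\<close>.\<close>

lemma path_tail_prob: "emeasure \<nu> {x. x n < - int h} \<le> ennreal ((5/6) ^ h * E_tilt n)"
proof -
  have s: "{x. x n < - int h} \<in> sets int_paths"
    using pred_coord(1)[of n "- int h"] by (simp add: pred_def space_PiM)
  have "emeasure \<nu> {x. x n < - int h} = (\<integral>\<^sup>+x. indicator {x. x n < - int h} x \<partial>\<nu>)"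
    using s by (intro nn_integral_indicator[symmetric]) (simp add: sets_path_law)
  also have "\<dots> \<le> (\<integral>\<^sup>+x. ennreal ((5/6) ^ h) * ennreal ((5/6) powi (x n)) \<partial>\<nu>)"
  proof (rule nn_integral_mono)
    fix x :: "nat \<Rightarrow> int"
    have "(1::real) \<le> (5/6) ^ h * (5/6) powi (x n)" if "x n < - int h"
    proof -
      have "(5/6 :: real) ^ h * (5/6) powi (- int h) \<le> (5/6) ^ h * (5/6) powi (x n)"
        using that by (intro mult_left_mono powi_mono) auto
      then show ?thesis by (simp add: power_int_minus)
    qed
    then show "indicator {x. x n < - int h} x \<le> ennreal ((5/6) ^ h) * ennreal ((5/6) powi (x n))"
      by (auto simp: ennreal_mult[symmetric] split: split_indicator)
  qed
  also have "\<dots> = ennreal ((5/6) ^ h) * ennreal (E_tilt n)"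
    by (subst nn_integral_cmult)
       (auto simp: nn_integral_path_coord[of "\<lambda>k. ennreal ((5/6) powi k)"] E_tilt(1))
  finally show ?thesis by (simp add: ennreal_mult E_tilt(2))
qed

lemma path_returns: "summable (\<lambda>n. real (Suc n) * measure \<nu> {x. x n < 0})"
proof (rule summableI_nonneg_bounded)
  interpret prob_space \<nu> by (rule prob_space_path_law)
  fix N
  have le: "prob {x. x n < 0} \<le> E_tilt n" for n
    using path_tail_prob[of n 0] E_tilt(2)[of n] by (simp add: emeasure_eq_measure)
  have "(\<Sum>n<N. real (Suc n) * prob {x. x n < 0}) \<le> (\<Sum>n<N. real (Suc n) * E_tilt n)"
    by (intro sum_mono mult_left_mono le) auto
  also have "\<dots> \<le> 40000" by (rule sum_Suc_E_tilt_le)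
  finally show "(\<Sum>n<N. real (Suc n) * prob {x. x n < 0}) \<le> 40000" .
qed simp

text \<open>Adding \<open>n\<close> to the position keeps it nonnegative, so that extended
  nonnegative integrals apply, and raises the drift to \<open>11/10\<close>. A red site has drift at
  least \<open>-1/2\<close> instead of \<open>1/10\<close>, a loss of at most \<open>6/10\<close>;
  with the red time bound \<open>4 * \<kappa> * n\<close> this gives
  \<open>12/5 * \<kappa>\<close>.\<close>

lemma annealed_displacement: "ennreal ((11/10 - 12/5 * \<kappa>) * n) \<le> annealed p n (\<lambda>c x. ennreal (real_of_int (fst x) + real n))"
proof -
  define G where "G n = annealed p n (\<lambda>c x. ennreal (real_of_int (fst x) + real n))" for n
  interpret C: prob_space "coloring_law p" by (rule prob_space_coloring_law)
  have step: "G n + ennreal (11/10) \<le> G (Suc n) + ennreal (6/10 * E_red n)" for n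
  proof -
    \<comment> \<open>\<open>annealed_Suc\<close> asks for a nonnegative function on all sites;
      cutting at 0 provides this and does not change the values reached by the walk.\<close>
    define f :: "site \<Rightarrow> real" where "f x = max 0 (real_of_int (fst x) + real (Suc n))" for x
    have [measurable]: "(\<lambda>c. ennreal (step_avg c f x)) \<in> borel_measurable coloring_space" for x
    proof -
      have [measurable]: "(\<lambda>c. jump (c x) i) \<in> borel_measurable coloring_space" for i
        by (rule measurable_compose[OF measurable_color]) simp
      show ?thesis unfolding step_avg_def by measurable
    qed
    have one: "annealed p n (\<lambda>c x. 1) = 1" using C.emeasure_space_1 by (simp add: annealed_def)
    have "G n + ennreal (11/10) = annealed p n (\<lambda>c x. ennreal (real_of_int (fst x) + real n) + ennreal (11/10) * 1)"
      unfolding G_def by (subst annealed_add_cmult) (auto simp: one)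
    also have "\<dots> \<le> annealed p n (\<lambda>c x. ennreal (step_avg c f x) + ennreal (6/10) * indicator {Red} (c x))"
    proof (rule annealed_mono_AE)
      have pt: "ennreal (real_of_int (fst x) + real n) + ennreal (11/10) * 1 \<le> ennreal (step_avg c f x) + ennreal (6/10) * indicator {Red} (c x)"
        if x: "- int n \<le> fst x" for c and x :: site
      proof -
        define g :: "site \<Rightarrow> real" where "g y = real_of_int (fst y) + real (Suc n)" for y
        have "step_avg c g x \<le> step_avg c f x" by (rule step_avg_mono) (simp add: f_def g_def)
        moreover have "step_avg c g x = real_of_int (fst x) + real (Suc n) + (jump (c x) 1 - jump (c x) 3)"
        proof -
          have j: "jump (c x) 3 = 1/2 - jump (c x) 1" using jump_1_3(3)[of "c x"] by simp
          show ?thesis unfolding step_avg_eq j by (simp add: g_def field_simps)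
        qed
        moreover have "1/10 \<le> jump (c x) 1 - jump (c x) 3 + 6/10 * indicator {Red} (c x)"
          using b r \<delta> by (cases "c x") (auto simp: jump_def)
        ultimately have "real_of_int (fst x) + real n + 11/10 \<le> step_avg c f x + 6/10 * indicator {Red} (c x)"
          by simp
        then have "ennreal (real_of_int (fst x) + real n + 11/10) \<le> ennreal (step_avg c f x + 6/10 * indicator {Red} (c x))"
          by (rule ennreal_leI)
        moreover have "0 \<le> step_avg c f x" by (rule step_avg_nonneg) (simp add: f_def)
        moreover have "0 \<le> real_of_int (fst x) + real n" using x by linarith
        ultimately show ?thesis
          by (cases "c x = Red") (simp_all add: ennreal_plus[symmetric] del: ennreal_plus)
      qed
      show "AE \<omega> in noise b r. \<forall>c. ennreal (real_of_int (fst (walk c 0 \<omega> n)) + real n) + ennreal (11/10) * 1 \<le>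
          ennreal (step_avg c f (walk c 0 \<omega> n)) + ennreal (6/10) * indicator {Red} (c (walk c 0 \<omega> n))"
        using AE_walk_fst[of 0]
      proof eventually_elim
        case (elim \<omega>)
        have "- int n \<le> fst (walk c 0 \<omega> n)" for c
        proof -
          have "\<bar>fst (walk c 0 \<omega> n) - fst (0 :: site)\<bar> \<le> int n" by (rule elim[rule_format, THEN conjunct1])
          then show ?thesis by (simp add: abs_le_iff)
        qed
        then show ?case using pt by blast
      qed
    qed
    also have "\<dots> = annealed p n (\<lambda>c x. ennreal (step_avg c f x)) + ennreal (6/10) * annealed p n (\<lambda>c x. indicator {Red} (c x))"
      by (rule annealed_add_cmult) measurable
    also have "annealed p n (\<lambda>c x. ennreal (step_avg c f x)) = annealed p (Suc n) (\<lambda>c x. ennreal (f x))"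
      by (rule annealed_Suc[symmetric]) (simp add: f_def)
    also have "\<dots> = G (Suc n)" by (simp add: G_def f_def ennreal_max_0 max.commute)
    also have "ennreal (6/10) * annealed p n (\<lambda>c x. indicator {Red} (c x)) = ennreal (6/10 * E_red n)"
      unfolding E_red(1) by (rule ennreal_mult[symmetric]) (simp_all add: E_red(2))
    finally show ?thesis .
  qed
  have "ennreal (11/10 * n) \<le> G n + ennreal (6/10 * (\<Sum>k<n. E_red k))"
  proof (induction n)
    case (Suc n)
    have "ennreal (11/10 * Suc n) = ennreal (11/10 * n) + ennreal (11/10)"
      by (simp add: ennreal_plus[symmetric] algebra_simps del: ennreal_plus)
    also have "\<dots> \<le> (G n + ennreal (6/10 * (\<Sum>k<n. E_red k))) + ennreal (11/10)"
      by (intro add_right_mono Suc)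
    also have "\<dots> = (G n + ennreal (11/10)) + ennreal (6/10 * (\<Sum>k<n. E_red k))" by (simp only: add_ac)
    also have "\<dots> \<le> (G (Suc n) + ennreal (6/10 * E_red n)) + ennreal (6/10 * (\<Sum>k<n. E_red k))"
      by (intro add_right_mono step)
    also have "\<dots> = G (Suc n) + ennreal (6/10 * (\<Sum>k<Suc n. E_red k))"
      using E_red(2) by (simp add: add.assoc ennreal_plus[symmetric] sum_nonneg algebra_simps del: ennreal_plus)
    finally show ?case .
  qed simp
  also have "\<dots> \<le> G n + ennreal (12/5 * \<kappa> * n)"
    using sum_E_red_le[of n] by (intro add_left_mono ennreal_leI) (simp add: mult_ac)
  finally have *: "ennreal (11/10 * n) \<le> G n + ennreal (12/5 * \<kappa> * n)" .
  have "ennreal ((11/10 - 12/5 * \<kappa>) * n) + ennreal (12/5 * \<kappa> * n) = ennreal (11/10 * n)"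
  proof -
    have eq: "11/10 * real n = (11/10 - 12/5 * \<kappa>) * n + 12/5 * \<kappa> * n" by (simp add: algebra_simps)
    have "0 \<le> (11/10 - 12/5 * \<kappa>) * n" "0 \<le> 12/5 * \<kappa> * n"
      using \<kappa>_bounds(1,2) by (auto intro!: mult_nonneg_nonneg)
    then show ?thesis unfolding eq by (rule ennreal_plus[symmetric])
  qed
  with * have "ennreal (12/5 * \<kappa> * n) + ennreal ((11/10 - 12/5 * \<kappa>) * n) \<le> ennreal (12/5 * \<kappa> * n) + G n"
    by (simp only: add.commute)
  then show ?thesis unfolding ennreal_add_left_cancel_le G_def by simp
qed

text \<open>\<open>ennreal\<close> cuts negative values to 0, so this concerns the positive part of
  \<open>x n\<close>: compare \<open>x n + n\<close> with \<open>max 0 (x n) + n\<close> and cancel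
  \<open>n\<close>.\<close>

lemma path_growth: "ennreal ((1/10 - 12/5 * \<kappa>) * n) \<le> (\<integral>\<^sup>+x. ennreal (real_of_int (x n)) \<partial>\<nu>)"
proof -
  interpret prob_space \<nu> by (rule prob_space_path_law)
  have "ennreal ((11/10 - 12/5 * \<kappa>) * n) \<le> annealed p n (\<lambda>c x. ennreal (real_of_int (fst x) + real n))"
    by (rule annealed_displacement)
  also have "\<dots> = (\<integral>\<^sup>+x. ennreal (real_of_int (x n) + real n) \<partial>\<nu>)"
    by (rule nn_integral_path_coord[of "\<lambda>k. ennreal (real_of_int k + real n)", symmetric])
  also have "\<dots> \<le> (\<integral>\<^sup>+x. ennreal (real n) + ennreal (real_of_int (x n)) \<partial>\<nu>)"
  proof (rule nn_integral_mono)
    fix x :: "nat \<Rightarrow> int"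
    have "ennreal (real_of_int (x n) + real n) \<le> ennreal (max 0 (real_of_int (x n)) + real n)"
      by (intro ennreal_leI) simp
    also have "\<dots> = ennreal (real n) + ennreal (real_of_int (x n))"
      by (subst ennreal_plus) (auto simp: max.commute ennreal_max_0 add.commute)
    finally show "ennreal (real_of_int (x n) + real n) \<le> ennreal (real n) + ennreal (real_of_int (x n))" .
  qed
  also have "\<dots> = ennreal (real n) + (\<integral>\<^sup>+x. ennreal (real_of_int (x n)) \<partial>\<nu>)"
    using emeasure_space_1 by (subst nn_integral_add) auto
  finally have "ennreal ((11/10 - 12/5 * \<kappa>) * n) \<le> ennreal (real n) + (\<integral>\<^sup>+x. ennreal (real_of_int (x n)) \<partial>\<nu>)" .
  moreover have "ennreal ((11/10 - 12/5 * \<kappa>) * n) = ennreal (real n) + ennreal ((1/10 - 12/5 * \<kappa>) * n)"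
  proof -
    have eq: "(11/10 - 12/5 * \<kappa>) * n = real n + (1/10 - 12/5 * \<kappa>) * n" by (simp add: algebra_simps)
    have "0 \<le> (1/10 - 12/5 * \<kappa>) * n" using \<kappa>_bounds(2) by (intro mult_nonneg_nonneg) auto
    then show ?thesis unfolding eq by (intro ennreal_plus) auto
  qed
  ultimately show ?thesis by (simp add: ennreal_add_left_cancel_le)
qed

text \<open>Split by the time \<open>n\<close> and the height \<open>y\<close> of the first visit to
  column \<open>m\<close>. For fixed \<open>n\<close> and \<open>y\<close> the noise separates at
  time \<open>n\<close> and the colors separate at column \<open>m\<close>: the past reads only
  columns to its left, and a future on which \<open>\<phi>\<close> is nonzero reads only the others.
  Translation invariance makes the future factor independent of \<open>n\<close> and
  \<open>y\<close>.\<close>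

lemma path_factorization:
  fixes H \<phi> :: "(nat \<Rightarrow> int) \<Rightarrow> ennreal"
  assumes [measurable]: "H \<in> borel_measurable int_paths" "\<phi> \<in> borel_measurable int_paths"
    and \<phi>: "\<And>x. \<phi> x \<noteq> 0 \<Longrightarrow> x \<in> Stay"
    and H: "\<And>x x' n. first_hit x m n \<Longrightarrow> (\<And>k. k \<le> n \<Longrightarrow> x' k = x k) \<Longrightarrow> H x' = H x"
  shows "(\<integral>\<^sup>+x. H x * at_level \<phi> m x \<partial>\<nu>) = (\<integral>\<^sup>+x. H x \<partial>\<nu>) * (\<integral>\<^sup>+x. \<phi> x \<partial>\<nu>)"
proof -
  define f where "f n y c \<omega> = indicator {x. first_hit x m n} (xwalk c \<omega>) * indicator {y} (snd (walk c 0 \<omega> n)) * H (xwalk c \<omega>)" for n y c \<omega>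
  define g where "g y c \<omega> = \<phi> (xwalk (\<lambda>z. c (z + (int m, y))) \<omega>)" for y c \<omega>
  have ind_hit [measurable]: "(indicator {x. first_hit x m n} :: (nat \<Rightarrow> int) \<Rightarrow> ennreal) \<in> borel_measurable int_paths" for n
    using measurable_first_hit[of m n] by (intro borel_measurable_indicator) (simp add: pred_def space_PiM)
  have f_meas: "(\<lambda>x. f n y (fst x) (snd x)) \<in> borel_measurable (coloring_space \<Otimes>\<^sub>M noise_space)" for n y
  proof -
    have [measurable]: "(\<lambda>x. indicator {x. first_hit x m n} (xwalk (fst x) (snd x)) :: ennreal) \<in> borel_measurable (coloring_space \<Otimes>\<^sub>M noise_space)"
      by (rule measurable_compose[OF measurable_xwalk ind_hit])
    have [measurable]: "(\<lambda>x. indicator {y} (snd (walk (fst x) 0 (snd x) n)) :: ennreal) \<in> borel_measurable (coloring_space \<Otimes>\<^sub>M noise_space)"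
      by (rule measurable_compose[OF measurable_walk]) simp
    show ?thesis unfolding f_def by measurable
  qed
  have g_meas: "(\<lambda>x. g y (fst x) (snd x)) \<in> borel_measurable (coloring_space \<Otimes>\<^sub>M noise_space)" for y
  proof -
    have "(\<lambda>x. ((\<lambda>z. fst x (z + (int m, y))), snd x)) \<in> measurable (coloring_space \<Otimes>\<^sub>M noise_space) (coloring_space \<Otimes>\<^sub>M noise_space)"
      by (intro measurable_Pair measurable_compose[OF measurable_fst measurable_color_shift] measurable_snd)
    from measurable_compose[OF this measurable_compose[OF measurable_xwalk assms(2)]]
    show ?thesis by (simp add: g_def)
  qed
  have slice: "(\<lambda>\<omega>. F c \<omega>) \<in> borel_measurable noise_space"
    if "(\<lambda>x. F (fst x) (snd x)) \<in> borel_measurable (coloring_space \<Otimes>\<^sub>M noise_space)" for F :: "(site \<Rightarrow> color) \<Rightarrow> (site \<times> site) stream \<Rightarrow> ennreal" and c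
    using measurable_compose[OF measurable_Pair1'[of c coloring_space noise_space] that] by (simp add: space_PiM)
  note f_sec [measurable] = slice[OF f_meas] and g_sec [measurable] = slice[OF g_meas]
  have shift_eq: "shift n (xwalk c \<omega>) = xwalk (\<lambda>z. c (z + (int m, y))) (sdrop n \<omega>)"
    if "first_hit (xwalk c \<omega>) m n" "snd (walk c 0 \<omega> n) = y" for n y c \<omega>
  proof
    fix k
    have pos: "walk c 0 \<omega> n = 0 + (int m, y)" using that by (auto simp: first_hit_def xwalk_def prod_eq_iff)
    have "xwalk c \<omega> (n + k) = fst (walk c (0 + (int m, y)) (sdrop n \<omega>) k)"
      unfolding xwalk_def walk_add pos ..
    also have "\<dots> = xwalk (\<lambda>z. c (z + (int m, y))) (sdrop n \<omega>) k + int m"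
      unfolding walk_translate by (simp add: xwalk_def)
    finally show "shift n (xwalk c \<omega>) k = xwalk (\<lambda>z. c (z + (int m, y))) (sdrop n \<omega>) k"
      using that(1) by (simp add: shift_def first_hit_def)
  qed
  have decomp: "F (xwalk c \<omega>) n = (\<integral>\<^sup>+y. indicator {y} (snd (walk c 0 \<omega> n)) * F (xwalk c \<omega>) n \<partial>count_space UNIV)"
    for F :: "(nat \<Rightarrow> int) \<Rightarrow> nat \<Rightarrow> ennreal" and c \<omega> n
  proof -
    have "(\<integral>\<^sup>+y. indicator {y} (snd (walk c 0 \<omega> n)) * F (xwalk c \<omega>) n \<partial>count_space UNIV) =
        (\<integral>\<^sup>+y. F (xwalk c \<omega>) n * indicator {snd (walk c 0 \<omega> n)} y \<partial>count_space UNIV)"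
      by (intro nn_integral_cong) (auto split: split_indicator)
    then show ?thesis by (simp add: nn_integral_cmult)
  qed
  have sum_swap: "(\<integral>\<^sup>+c. \<integral>\<^sup>+\<omega>. (\<Sum>n. \<integral>\<^sup>+y. F n y c \<omega> \<partial>count_space UNIV) \<partial>noise b r \<partial>coloring_law p) =
      (\<Sum>n. \<integral>\<^sup>+y. \<integral>\<^sup>+c. \<integral>\<^sup>+\<omega>. F n y c \<omega> \<partial>noise b r \<partial>coloring_law p \<partial>count_space UNIV)"
    if F: "\<And>n y. (\<lambda>x. F n y (fst x) (snd x)) \<in> borel_measurable (coloring_space \<Otimes>\<^sub>M noise_space)"
    for F :: "nat \<Rightarrow> int \<Rightarrow> (site \<Rightarrow> color) \<Rightarrow> (site \<times> site) stream \<Rightarrow> ennreal"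
  proof -
    note [measurable] = slice[OF F] measurable_nn_integral_noise[OF F]
    have [measurable]: "(\<lambda>\<omega>. \<integral>\<^sup>+y. F n y c \<omega> \<partial>count_space UNIV) \<in> borel_measurable noise_space" for n c
      by (rule borel_measurable_nn_integral_int) (rule slice[OF F])
    have "(\<integral>\<^sup>+\<omega>. (\<Sum>n. \<integral>\<^sup>+y. F n y c \<omega> \<partial>count_space UNIV) \<partial>noise b r) =
        (\<Sum>n. \<integral>\<^sup>+y. \<integral>\<^sup>+\<omega>. F n y c \<omega> \<partial>noise b r \<partial>count_space UNIV)" for c
      by (subst nn_integral_suminf) (auto simp: nn_integral_count_space_nn_integral measurable_cong_sets[OF sets_noise refl])
    then have "(\<integral>\<^sup>+c. \<integral>\<^sup>+\<omega>. (\<Sum>n. \<integral>\<^sup>+y. F n y c \<omega> \<partial>count_space UNIV) \<partial>noise b r \<partial>coloring_law p) =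
        (\<integral>\<^sup>+c. (\<Sum>n. \<integral>\<^sup>+y. \<integral>\<^sup>+\<omega>. F n y c \<omega> \<partial>noise b r \<partial>count_space UNIV) \<partial>coloring_law p)"
      by simp
    also have "\<dots> = (\<Sum>n. \<integral>\<^sup>+y. \<integral>\<^sup>+c. \<integral>\<^sup>+\<omega>. F n y c \<omega> \<partial>noise b r \<partial>coloring_law p \<partial>count_space UNIV)"
    proof -
      have "(\<lambda>c. \<integral>\<^sup>+y. \<integral>\<^sup>+\<omega>. F n y c \<omega> \<partial>noise b r \<partial>count_space UNIV) \<in> borel_measurable (coloring_law p)" for n
        unfolding measurable_coloring_law_iff
        by (rule borel_measurable_nn_integral_int) (rule measurable_nn_integral_noise[OF F])
      then show ?thesis
        by (subst nn_integral_suminf) (auto simp: nn_integral_count_space_nn_integral measurable_coloring_law_iff)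
    qed
    finally show ?thesis .
  qed
  have quenched: "(\<integral>\<^sup>+\<omega>. f n y c \<omega> * g y c (sdrop n \<omega>) \<partial>noise b r) = (\<integral>\<^sup>+\<omega>. f n y c \<omega> \<partial>noise b r) * (\<integral>\<^sup>+\<omega>. g y c \<omega> \<partial>noise b r)" for n y c
  proof (rule nn_integral_noise_split)
    fix \<omega> \<omega>' :: "(site \<times> site) stream" assume st: "stake n \<omega> = stake n \<omega>'"
    have w: "walk c 0 \<omega>' k = walk c 0 \<omega> k" if "k \<le> n" for k by (rule walk_cong_stake[symmetric, OF st that])
    have hit: "first_hit (xwalk c \<omega>') m n \<longleftrightarrow> first_hit (xwalk c \<omega>) m n"
      by (auto simp: first_hit_def xwalk_def w)
    show "f n y c \<omega> = f n y c \<omega>'"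
    proof (cases "first_hit (xwalk c \<omega>) m n")
      case True
      then have "H (xwalk c \<omega>') = H (xwalk c \<omega>)" by (rule H) (simp add: xwalk_def w)
      then show ?thesis using True hit w[of n] by (simp add: f_def)
    next
      case False
      then show ?thesis using hit by (simp add: f_def)
    qed
  qed measurable
  have annealed: "(\<integral>\<^sup>+c. (\<integral>\<^sup>+\<omega>. f n y c \<omega> \<partial>noise b r) * (\<integral>\<^sup>+\<omega>. g y c \<omega> \<partial>noise b r) \<partial>coloring_law p) =
      (\<integral>\<^sup>+c. \<integral>\<^sup>+\<omega>. f n y c \<omega> \<partial>noise b r \<partial>coloring_law p) * (\<integral>\<^sup>+c. \<integral>\<^sup>+\<omega>. g y c \<omega> \<partial>noise b r \<partial>coloring_law p)" for n y
  proof (rule nn_integral_coloring_independent[where J = "{z. fst z < int m}"])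
    show "(\<lambda>c. \<integral>\<^sup>+\<omega>. f n y c \<omega> \<partial>noise b r) \<in> borel_measurable coloring_space"
      by (rule measurable_nn_integral_noise[OF f_meas])
    show "(\<lambda>c. \<integral>\<^sup>+\<omega>. g y c \<omega> \<partial>noise b r) \<in> borel_measurable coloring_space"
      by (rule measurable_nn_integral_noise[OF g_meas])
  next
    fix c c' :: "site \<Rightarrow> color" assume agree: "\<And>z. z \<in> {z. fst z < int m} \<Longrightarrow> c z = c' z"
    \<comment> \<open>Up to its first visit to column \<open>m\<close> the walk reads only colors on
      which the two colorings agree. The statement is used with the colorings in either
      order.\<close>
    have *: "walk c2 0 \<omega> k = walk c1 0 \<omega> k"
      if "\<And>z. fst z < int m \<Longrightarrow> c1 z = c2 z" "first_hit (xwalk c1 \<omega>) m n" "k \<le> n" for c1 c2 k and \<omega> :: "(site \<times> site) stream"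
      by (rule xwalk_cong[OF _ that(3)]) (use that(1,2) in \<open>auto simp: first_hit_def xwalk_def\<close>)
    have hit: "first_hit (xwalk c2 \<omega>) m n"
      if "\<And>z. fst z < int m \<Longrightarrow> c1 z = c2 z" "first_hit (xwalk c1 \<omega>) m n" for c1 c2 and \<omega> :: "(site \<times> site) stream"
      using that(2) *[OF that] by (auto simp: first_hit_def xwalk_def)
    show "(\<integral>\<^sup>+\<omega>. f n y c \<omega> \<partial>noise b r) = (\<integral>\<^sup>+\<omega>. f n y c' \<omega> \<partial>noise b r)"
    proof (rule nn_integral_cong)
      fix \<omega>
      have eq: "first_hit (xwalk c \<omega>) m n \<longleftrightarrow> first_hit (xwalk c' \<omega>) m n"
        using hit[of c c' \<omega>] hit[of c' c \<omega>] agree by auto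
      show "f n y c \<omega> = f n y c' \<omega>"
      proof (cases "first_hit (xwalk c \<omega>) m n")
        case True
        have w: "walk c' 0 \<omega> k = walk c 0 \<omega> k" if "k \<le> n" for k using *[OF _ True that, of c'] agree by simp
        have "H (xwalk c' \<omega>) = H (xwalk c \<omega>)" by (rule H[OF True]) (simp add: xwalk_def w)
        then show ?thesis using True eq w[of n] by (simp add: f_def)
      next
        case False
        then show ?thesis using eq by (simp add: f_def)
      qed
    qed
  next
    fix c c' :: "site \<Rightarrow> color" assume agree: "\<And>z. z \<notin> {z. fst z < int m} \<Longrightarrow> c z = c' z"
    define d d' where "d = (\<lambda>z. c (z + (int m, y)))" and "d' = (\<lambda>z. c' (z + (int m, y)))"
    have dd': "d z = d' z" if "0 \<le> fst z" for z unfolding d_def d'_def by (rule agree) (use that in simp)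
    \<comment> \<open>It is enough that one of the two paths stays in the right half plane: it then
      meets only common colors, so the other path coincides with it. If neither stays,
      \<open>\<phi>\<close> vanishes on both.\<close>
    have *: "xwalk d2 \<omega> = xwalk d1 \<omega>" if "\<And>z. 0 \<le> fst z \<Longrightarrow> d1 z = d2 z" "xwalk d1 \<omega> \<in> Stay" for d1 d2 \<omega>
    proof
      fix k
      have "walk d2 0 \<omega> k = walk d1 0 \<omega> k"
        by (rule walk_cong_color) (use that in \<open>auto simp: Stay_def xwalk_def\<close>)
      then show "xwalk d2 \<omega> k = xwalk d1 \<omega> k" by (simp add: xwalk_def)
    qed
    show "(\<integral>\<^sup>+\<omega>. g y c \<omega> \<partial>noise b r) = (\<integral>\<^sup>+\<omega>. g y c' \<omega> \<partial>noise b r)"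
    proof (rule nn_integral_cong)
      fix \<omega>
      have "\<phi> (xwalk d \<omega>) = \<phi> (xwalk d' \<omega>)"
      proof (cases "xwalk d \<omega> \<in> Stay \<or> xwalk d' \<omega> \<in> Stay")
        case True
        then show ?thesis using *[of d d' \<omega>] *[of d' d \<omega>] dd' by auto
      next
        case False
        then show ?thesis using \<phi> by metis
      qed
      then show "g y c \<omega> = g y c' \<omega>" by (simp add: g_def d_def d'_def)
    qed
  qed
  \<comment> \<open>By translation invariance the height \<open>y\<close> disappears, so the future
    can be factored out of the sum over \<open>n\<close> and \<open>y\<close>.\<close>
  have g_int: "(\<integral>\<^sup>+c. \<integral>\<^sup>+\<omega>. g y c \<omega> \<partial>noise b r \<partial>coloring_law p) = (\<integral>\<^sup>+x. \<phi> x \<partial>\<nu>)" for y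
  proof -
    have "(\<lambda>x. \<phi> (xwalk (fst x) (snd x))) \<in> borel_measurable (coloring_space \<Otimes>\<^sub>M noise_space)"
      by (rule measurable_compose[OF measurable_xwalk assms(2)])
    from nn_integral_coloring_shift[OF measurable_nn_integral_noise[OF this, of b r], where y = "(int m, y)" and p = p]
    show ?thesis by (simp add: g_def nn_integral_path_law)
  qed
  have fg_meas: "(\<lambda>x. f n y (fst x) (snd x) * g y (fst x) (sdrop n (snd x))) \<in> borel_measurable (coloring_space \<Otimes>\<^sub>M noise_space)" for n y
  proof -
    have "(\<lambda>x. (fst x, sdrop n (snd x))) \<in> measurable (coloring_space \<Otimes>\<^sub>M noise_space) (coloring_space \<Otimes>\<^sub>M noise_space)"
      by measurable
    from measurable_compose[OF this g_meas[of y]] have "(\<lambda>x. g y (fst x) (sdrop n (snd x))) \<in> borel_measurable (coloring_space \<Otimes>\<^sub>M noise_space)"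
      by simp
    then show ?thesis using f_meas by (intro borel_measurable_times_ennreal) auto
  qed
  have "(\<integral>\<^sup>+x. H x * at_level \<phi> m x \<partial>\<nu>) =
      (\<integral>\<^sup>+c. \<integral>\<^sup>+\<omega>. H (xwalk c \<omega>) * at_level \<phi> m (xwalk c \<omega>) \<partial>noise b r \<partial>coloring_law p)"
    by (rule nn_integral_path_law) measurable
  also have "\<dots> = (\<integral>\<^sup>+c. \<integral>\<^sup>+\<omega>. (\<Sum>n. \<integral>\<^sup>+y. f n y c \<omega> * g y c (sdrop n \<omega>) \<partial>count_space UNIV) \<partial>noise b r \<partial>coloring_law p)"
  proof (intro nn_integral_cong)
    fix c \<omega>
    have "H (xwalk c \<omega>) * at_level \<phi> m (xwalk c \<omega>) =
        (\<Sum>n. H (xwalk c \<omega>) * (indicator {x. first_hit x m n} (xwalk c \<omega>) * \<phi> (shift n (xwalk c \<omega>))))"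
      unfolding at_level_def by (rule ennreal_suminf_cmult[symmetric])
    also have "\<dots> = (\<Sum>n. \<integral>\<^sup>+y. f n y c \<omega> * g y c (sdrop n \<omega>) \<partial>count_space UNIV)"
    proof (rule suminf_cong)
      fix n
      have "H (xwalk c \<omega>) * (indicator {x. first_hit x m n} (xwalk c \<omega>) * \<phi> (shift n (xwalk c \<omega>))) =
          (\<integral>\<^sup>+y. indicator {y} (snd (walk c 0 \<omega> n)) * (H (xwalk c \<omega>) * (indicator {x. first_hit x m n} (xwalk c \<omega>) * \<phi> (shift n (xwalk c \<omega>)))) \<partial>count_space UNIV)"
        by (rule decomp[of "\<lambda>x n. H x * (indicator {x. first_hit x m n} x * \<phi> (shift n x))"])
      also have "\<dots> = (\<integral>\<^sup>+y. f n y c \<omega> * g y c (sdrop n \<omega>) \<partial>count_space UNIV)"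
        using shift_eq[of c \<omega> n] by (intro nn_integral_cong) (auto simp: f_def g_def split: split_indicator)
      finally show "H (xwalk c \<omega>) * (indicator {x. first_hit x m n} (xwalk c \<omega>) * \<phi> (shift n (xwalk c \<omega>))) = \<dots>" .
    qed
    finally show "H (xwalk c \<omega>) * at_level \<phi> m (xwalk c \<omega>) = \<dots>" .
  qed
  also have "\<dots> = (\<Sum>n. \<integral>\<^sup>+y. \<integral>\<^sup>+c. \<integral>\<^sup>+\<omega>. f n y c \<omega> * g y c (sdrop n \<omega>) \<partial>noise b r \<partial>coloring_law p \<partial>count_space UNIV)"
    by (rule sum_swap[of "\<lambda>n y c \<omega>. f n y c \<omega> * g y c (sdrop n \<omega>)"]) (rule fg_meas)
  also have "\<dots> = (\<Sum>n. (\<integral>\<^sup>+y. \<integral>\<^sup>+c. \<integral>\<^sup>+\<omega>. f n y c \<omega> \<partial>noise b r \<partial>coloring_law p \<partial>count_space UNIV) * (\<integral>\<^sup>+x. \<phi> x \<partial>\<nu>))"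
    unfolding quenched annealed g_int by (simp add: nn_integral_multc)
  also have "\<dots> = (\<Sum>n. \<integral>\<^sup>+y. \<integral>\<^sup>+c. \<integral>\<^sup>+\<omega>. f n y c \<omega> \<partial>noise b r \<partial>coloring_law p \<partial>count_space UNIV) * (\<integral>\<^sup>+x. \<phi> x \<partial>\<nu>)"
    by (rule ennreal_suminf_multc)
  also have "(\<Sum>n. \<integral>\<^sup>+y. \<integral>\<^sup>+c. \<integral>\<^sup>+\<omega>. f n y c \<omega> \<partial>noise b r \<partial>coloring_law p \<partial>count_space UNIV) =
      (\<integral>\<^sup>+c. \<integral>\<^sup>+\<omega>. (\<Sum>n. \<integral>\<^sup>+y. f n y c \<omega> \<partial>count_space UNIV) \<partial>noise b r \<partial>coloring_law p)"
    by (rule sum_swap[OF f_meas, symmetric])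
  also have "\<dots> = (\<integral>\<^sup>+c. \<integral>\<^sup>+\<omega>. (\<Sum>n. indicator {x. first_hit x m n} (xwalk c \<omega>) * H (xwalk c \<omega>)) \<partial>noise b r \<partial>coloring_law p)"
  proof (intro nn_integral_cong suminf_cong)
    fix c \<omega> n
    have "(\<integral>\<^sup>+y. f n y c \<omega> \<partial>count_space UNIV) =
        (\<integral>\<^sup>+y. indicator {y} (snd (walk c 0 \<omega> n)) * (indicator {x. first_hit x m n} (xwalk c \<omega>) * H (xwalk c \<omega>)) \<partial>count_space UNIV)"
      by (intro nn_integral_cong) (simp add: f_def mult_ac)
    also have "\<dots> = indicator {x. first_hit x m n} (xwalk c \<omega>) * H (xwalk c \<omega>)"
      by (rule decomp[of "\<lambda>x n. indicator {x. first_hit x m n} x * H x", symmetric])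
    finally show "(\<integral>\<^sup>+y. f n y c \<omega> \<partial>count_space UNIV) = indicator {x. first_hit x m n} (xwalk c \<omega>) * H (xwalk c \<omega>)" .
  qed
  also have "\<dots> = (\<integral>\<^sup>+x. (\<Sum>n. indicator {x. first_hit x m n} x * H x) \<partial>\<nu>)"
    by (rule nn_integral_path_law[symmetric]) measurable
  also have "\<dots> = (\<integral>\<^sup>+x. H x \<partial>\<nu>)"
  proof (rule nn_integral_cong_AE)
    show "AE x in \<nu>. (\<Sum>n. indicator {x. first_hit x m n} x * H x) = H x"
      using AE_path_hits
    proof eventually_elim
      case (elim x)
      then obtain n where n: "first_hit x m n" by blast
      show ?case by (rule suminf_first_hit[OF n])
    qed
  qed
  finally show ?thesis .
qed

text \<open>Reach column \<open>40\<close> through blue sites only; the bound on the visits far to the left shows that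
  the walk may then fail to ever come back \<open>40\<close> columns.\<close>

lemma path_Stay_pos: "0 < measure \<nu> Stay"
proof -
  interpret P: prob_space \<nu> by (rule prob_space_path_law)
  interpret C: prob_space "coloring_law p" by (rule prob_space_coloring_law)
  \<comment> \<open>For \<open>h = 40\<close> the left excursions cost
    \<open>200 * (5/6) ^ h < 1/5\<close> and the red sites at most \<open>h / 1000\<close>; together
    this stays below 1.\<close>
  define h :: nat where "h = 40"
  define St where "St = {x :: nat \<Rightarrow> int. \<forall>k. - int h \<le> x k}"
  have [measurable]: "St \<in> sets int_paths"
  proof -
    have "{x \<in> space int_paths. \<forall>k. - int h \<le> x k} \<in> sets int_paths" by measurable
    then show ?thesis by (simp add: St_def space_PiM)
  qed
  have [measurable]: "- St \<in> sets int_paths"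
    using sets.compl_sets[of St int_paths] by (simp add: space_PiM Compl_eq_Diff_UNIV)
  define sh where "sh c = (\<lambda>z. c (z + (int h, 0)))" for c :: "site \<Rightarrow> color"
  define I where "I A c = (\<integral>\<^sup>+\<omega>. indicator A (xwalk c \<omega>) \<partial>noise b r)" for A :: "(nat \<Rightarrow> int) set" and c
  have [measurable]: "(\<lambda>\<omega>. indicator A (xwalk c \<omega>) :: ennreal) \<in> borel_measurable noise_space" if "A \<in> sets int_paths" for A c
    by (rule measurable_compose[OF measurable_xwalk_noise]) (use that in simp)
  have I_meas: "I A \<in> borel_measurable coloring_space" if A: "A \<in> sets int_paths" for A
    unfolding I_def[abs_def]
    by (rule measurable_nn_integral_noise, rule measurable_compose[OF measurable_xwalk]) (use A in simp)
  have I_sh [measurable]: "(\<lambda>c. I A (sh c)) \<in> borel_measurable coloring_space" if A: "A \<in> sets int_paths" for A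
    unfolding sh_def by (rule measurable_compose[OF measurable_color_shift I_meas[OF A]])
  define right :: "nat \<Rightarrow> (site \<times> site) stream \<Rightarrow> ennreal" where "right n = indicator {\<omega>. \<forall>i<n. fst (\<omega> !! i) = (1, 0)}" for n
  have right_meas [measurable]: "right n \<in> borel_measurable noise_space" for n
  proof -
    have [measurable]: "Measurable.pred noise_space (\<lambda>\<omega>. fst (\<omega> !! i) = (1, 0))" for i
      by (rule measurable_compose[OF measurable_snth]) simp
    have "Measurable.pred noise_space (\<lambda>\<omega>. \<forall>i<n. fst (\<omega> !! i) = (1, 0))" by measurable
    then show ?thesis unfolding right_def by (intro borel_measurable_indicator) (simp add: pred_def space_stream_space)
  qed
  have right_int: "(\<integral>\<^sup>+\<omega>. right n \<omega> \<partial>noise b r) = ennreal ((3/10) ^ n)" for n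
  proof (induction n)
    case (Suc n)
    have "(\<integral>\<^sup>+\<omega>. right (Suc n) \<omega> \<partial>noise b r) =
        (\<integral>\<^sup>+u. \<integral>\<^sup>+\<omega>. right (Suc n) (u ## \<omega>) \<partial>noise b r \<partial>pair_pmf (step_pmf b) (step_pmf r))"
      by (rule nn_integral_noise) measurable
    also have "\<dots> = (\<integral>\<^sup>+u. \<integral>\<^sup>+\<omega>. indicator {(1, 0)} (move Blue u) * right n \<omega> \<partial>noise b r \<partial>pair_pmf (step_pmf b) (step_pmf r))"
      by (intro nn_integral_cong) (auto simp: right_def move_def All_less_Suc2 split: split_indicator)
    also have "\<dots> = (\<integral>\<^sup>+u. indicator {(1, 0)} (move Blue u) * ennreal ((3/10) ^ n) \<partial>pair_pmf (step_pmf b) (step_pmf r))"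
      by (intro nn_integral_cong) (subst nn_integral_cmult, auto simp: Suc measurable_cong_sets[OF sets_noise refl])
    also have "\<dots> = (\<integral>\<^sup>+u. indicator {(1, 0)} (move Blue u) \<partial>pair_pmf (step_pmf b) (step_pmf r)) * ennreal ((3/10) ^ n)"
      by (rule nn_integral_multc) simp
    also have "(\<integral>\<^sup>+u. indicator {(1, 0)} (move Blue u) \<partial>pair_pmf (step_pmf b) (step_pmf r)) = ennreal (3/10)"
      unfolding nn_integral_move[of "indicator {(1, 0)}" Blue] sum_1_4 using b by (simp add: jump_def)
    finally show ?case by (simp add: ennreal_mult[symmetric])
  qed (simp add: right_def)
  define blue :: "(site \<Rightarrow> color) \<Rightarrow> ennreal" where "blue = indicator {c. \<forall>i<h. c (int i, 0) = Blue}"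
  have [measurable]: "blue \<in> borel_measurable coloring_space"
  proof -
    have "Measurable.pred coloring_space (\<lambda>c. \<forall>i<h. c (int i, 0) = Blue)" by measurable
    from measurable_color_indicator[OF this] show ?thesis by (simp add: blue_def)
  qed
  \<comment> \<open>A union bound: after reaching column \<open>h\<close> the walk may fall back by
    \<open>h\<close> columns and read the colors of the initial segment again, so the two events are
    not independent.\<close>
  have split1: "1 \<le> blue c * I St (sh c) + (I (- St) (sh c) + (\<Sum>i<h. indicator {c. c (int i, 0) = Red} c))" for c
  proof (cases "\<forall>i<h. c (int i, 0) = Blue")
    case True
    have "I St (sh c) + I (- St) (sh c) = (\<integral>\<^sup>+\<omega>. indicator St (xwalk (sh c) \<omega>) + indicator (- St) (xwalk (sh c) \<omega>) \<partial>noise b r)"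
      unfolding I_def by (rule nn_integral_add[symmetric]) (simp_all add: measurable_cong_sets[OF sets_noise refl])
    also have "\<dots> = (\<integral>\<^sup>+\<omega>. 1 \<partial>noise b r)" by (intro nn_integral_cong) (auto split: split_indicator)
    also have "\<dots> = 1" by simp
    finally have "1 = blue c * I St (sh c) + I (- St) (sh c)" using True by (simp add: blue_def)
    also have "\<dots> \<le> blue c * I St (sh c) + (I (- St) (sh c) + (\<Sum>i<h. indicator {c. c (int i, 0) = Red} c))"
      by (intro add_left_mono) simp
    finally show ?thesis .
  next
    case False
    then obtain i where i: "i < h" "c (int i, 0) = Red" by (auto simp: color_not_Blue)
    have "1 = (\<Sum>i\<in>{i}. indicator {c. c (int i, 0) = Red} c :: ennreal)" using i by simp
    also have "\<dots> \<le> (\<Sum>i<h. indicator {c. c (int i, 0) = Red} c)" by (rule sum_mono2) (use i in auto)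
    finally show ?thesis by (rule add_increasing[OF zero_le add_increasing[OF zero_le]])
  qed
  have red_meas [measurable]: "(\<lambda>c. indicator {c. c z = a} c :: ennreal) \<in> borel_measurable coloring_space" for z a
    by (intro measurable_color_indicator pred_color)
  have "1 = (\<integral>\<^sup>+c. 1 \<partial>coloring_law p)" using C.emeasure_space_1 by simp
  also have "\<dots> \<le> (\<integral>\<^sup>+c. blue c * I St (sh c) + (I (- St) (sh c) + (\<Sum>i<h. indicator {c. c (int i, 0) = Red} c)) \<partial>coloring_law p)"
    by (intro nn_integral_mono split1)
  also have "\<dots> = (\<integral>\<^sup>+c. blue c * I St (sh c) \<partial>coloring_law p) + ((\<integral>\<^sup>+c. I (- St) (sh c) \<partial>coloring_law p) + (\<Sum>i<h. ennreal (1 - p)))"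
  proof -
    have "(\<integral>\<^sup>+c. (\<Sum>i<h. indicator {c. c (int i, 0) = Red} c) \<partial>coloring_law p) = (\<Sum>i<h. ennreal (1 - p))"
      using p by (subst nn_integral_sum)
        (auto simp: nn_integral_coloring_color[OF p] pmf_color_pmf measurable_coloring_law_iff simp del: nn_integral_indicator)
    then show ?thesis
      by (subst nn_integral_add, simp add: measurable_coloring_law_iff, simp add: measurable_coloring_law_iff,
          subst nn_integral_add) (simp_all add: measurable_coloring_law_iff)
  qed
  also have "(\<integral>\<^sup>+c. I (- St) (sh c) \<partial>coloring_law p) \<le> ennreal (200 * (5/6) ^ h)"
  proof -
    have "(\<integral>\<^sup>+c. I (- St) (sh c) \<partial>coloring_law p) = (\<integral>\<^sup>+c. I (- St) c \<partial>coloring_law p)"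
      unfolding sh_def by (rule nn_integral_coloring_shift[OF I_meas]) simp
    also have "\<dots> = (\<integral>\<^sup>+x. indicator (- St) x \<partial>\<nu>)"
      unfolding I_def by (rule nn_integral_path_law[symmetric]) simp
    also have "\<dots> = emeasure \<nu> (\<Union>n. {x. x n < - int h})"
    proof -
      have eq: "- St = (\<Union>n. {x. x n < - int h})" by (simp add: St_def set_eq_iff not_le)
      have "(\<integral>\<^sup>+x. indicator (- St) x \<partial>\<nu>) = emeasure \<nu> (- St)"
        by (rule nn_integral_indicator) (simp add: sets_path_law)
      then show ?thesis unfolding eq .
    qed
    also have "\<dots> \<le> (\<Sum>n. emeasure \<nu> {x. x n < - int h})"
    proof (rule emeasure_subadditive_countably)
      have "{x. x n < - int h} \<in> sets int_paths" for n
        using pred_coord(1)[of n "- int h"] by (simp add: pred_def space_PiM)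
      then show "range (\<lambda>n. {x. x n < - int h}) \<subseteq> sets \<nu>" by (auto simp: sets_path_law)
    qed
    also have "\<dots> \<le> (\<Sum>n. ennreal ((5/6) ^ h * E_tilt n))"
      by (intro suminf_le summableI path_tail_prob)
    also have "\<dots> = ennreal ((5/6) ^ h * suminf E_tilt)"
      unfolding suminf_mult[OF summable_E_tilt(1), symmetric]
      by (intro suminf_ennreal_eq summable_sums summable_mult summable_E_tilt) (simp add: E_tilt(2))
    also have "\<dots> \<le> ennreal (200 * (5/6) ^ h)"
      using summable_E_tilt(2) by (intro ennreal_leI) simp
    finally show ?thesis .
  qed
  finally have le: "1 \<le> (\<integral>\<^sup>+c. blue c * I St (sh c) \<partial>coloring_law p) + (ennreal (200 * (5/6) ^ h) + (\<Sum>i<h. ennreal (1 - p)))"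
    by (simp add: add_left_mono add_right_mono)
  have small: "ennreal (200 * (5/6) ^ h) + (\<Sum>i<h. ennreal (1 - p)) < 1"
  proof -
    have "1 - p \<le> 1/1000"
    proof -
      have "108900 * (1 - p) \<le> 1/50 * p" using sparse p by (simp add: divide_le_eq)
      then show ?thesis using p by simp
    qed
    moreover have "200 * (5/6 :: real) ^ h < 1/5" by (simp add: h_def power_divide)
    ultimately have "200 * (5/6) ^ h + (\<Sum>i<h. 1 - p) < 1" by (simp add: h_def)
    moreover have "ennreal (200 * (5/6) ^ h) + (\<Sum>i<h. ennreal (1 - p)) = ennreal (200 * (5/6) ^ h + (\<Sum>i<h. 1 - p))"
    proof -
      have "(\<Sum>i<h. ennreal (1 - p)) = ennreal (\<Sum>i<h. 1 - p)" by (rule sum_ennreal) (use p in simp)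
      moreover have "0 \<le> (\<Sum>i<h. 1 - p)" by (rule sum_nonneg) (use p in simp)
      ultimately show ?thesis by (simp only:) (rule ennreal_plus[symmetric], simp)
    qed
    ultimately show ?thesis by (simp add: ennreal_less_one_iff)
  qed
  have pos: "0 < (\<integral>\<^sup>+c. blue c * I St (sh c) \<partial>coloring_law p)"
  proof (rule ccontr)
    assume "\<not> ?thesis"
    then have "(\<integral>\<^sup>+c. blue c * I St (sh c) \<partial>coloring_law p) = 0" by simp
    with le small show False by simp
  qed
  \<comment> \<open>Only the noise is split, at time \<open>h\<close>: the first \<open>h\<close>
    blue steps all point right with probability \<open>(3/10) ^ h\<close>, for every coloring, while
    the later noise drives the walk seen from column \<open>h\<close>.\<close>
  have "ennreal ((3/10) ^ h) * (\<integral>\<^sup>+c. blue c * I St (sh c) \<partial>coloring_law p) =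
      (\<integral>\<^sup>+c. blue c * (ennreal ((3/10) ^ h) * I St (sh c)) \<partial>coloring_law p)"
    by (subst nn_integral_cmult[symmetric]) (auto simp: measurable_coloring_law_iff mult_ac)
  also have "\<dots> = (\<integral>\<^sup>+c. blue c * (\<integral>\<^sup>+\<omega>. right h \<omega> * indicator St (xwalk (sh c) (sdrop h \<omega>)) \<partial>noise b r) \<partial>coloring_law p)"
  proof (rule nn_integral_cong)
    fix c
    have right_stake: "right h \<omega> = right h \<omega>'" if st: "stake h \<omega> = stake h \<omega>'" for \<omega> \<omega>' :: "(site \<times> site) stream"
    proof -
      have "\<omega> !! i = \<omega>' !! i" if "i < h" for i using st that by (metis stake_nth)
      then show ?thesis by (simp add: right_def indicator_def)
    qed
    have St_meas: "(\<lambda>\<omega>. indicator St (xwalk (sh c) \<omega>) :: ennreal) \<in> borel_measurable noise_space"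
      by measurable
    have "(\<integral>\<^sup>+\<omega>. right h \<omega> * indicator St (xwalk (sh c) (sdrop h \<omega>)) \<partial>noise b r) = ennreal ((3/10) ^ h) * I St (sh c)"
      unfolding I_def right_int[symmetric]
      by (rule nn_integral_noise_split[OF right_meas St_meas right_stake])
    then show "blue c * (ennreal ((3/10) ^ h) * I St (sh c)) =
        blue c * (\<integral>\<^sup>+\<omega>. right h \<omega> * indicator St (xwalk (sh c) (sdrop h \<omega>)) \<partial>noise b r)" by simp
  qed
  also have "\<dots> \<le> (\<integral>\<^sup>+c. \<integral>\<^sup>+\<omega>. indicator Stay (xwalk c \<omega>) \<partial>noise b r \<partial>coloring_law p)"
  proof (rule nn_integral_mono)
    fix c
    show "blue c * (\<integral>\<^sup>+\<omega>. right h \<omega> * indicator St (xwalk (sh c) (sdrop h \<omega>)) \<partial>noise b r) \<le>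
        (\<integral>\<^sup>+\<omega>. indicator Stay (xwalk c \<omega>) \<partial>noise b r)"
    proof (cases "\<forall>i<h. c (int i, 0) = Blue")
      case True
      have "(\<integral>\<^sup>+\<omega>. right h \<omega> * indicator St (xwalk (sh c) (sdrop h \<omega>)) \<partial>noise b r) \<le>
          (\<integral>\<^sup>+\<omega>. indicator Stay (xwalk c \<omega>) \<partial>noise b r)"
      proof (rule nn_integral_mono)
        fix \<omega> :: "(site \<times> site) stream"
        have "xwalk c \<omega> \<in> Stay" if rt: "\<And>i. i < h \<Longrightarrow> fst (\<omega> !! i) = (1, 0)" and st: "xwalk (sh c) (sdrop h \<omega>) \<in> St"
        proof -
          have w: "walk c 0 \<omega> i = (int i, 0)" if "i \<le> h" for i
            using that
          proof (induction i)
            case (Suc i)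
            then have "walk c 0 \<omega> i = (int i, 0)" "c (int i, 0) = Blue" "fst (\<omega> !! i) = (1, 0)" using True rt by auto
            then show ?case unfolding walk_Suc_last by (simp add: move_def)
          qed (simp add: zero_prod_def)
          have "0 \<le> xwalk c \<omega> k" for k
          proof (cases "k \<le> h")
            case True
            then show ?thesis by (simp add: xwalk_def w)
          next
            case False
            then obtain j where k: "k = h + j" by (metis le_add_diff_inverse nat_le_linear)
            have "walk c 0 \<omega> k = walk c (0 + (int h, 0)) (sdrop h \<omega>) j" unfolding k walk_add by (simp add: w)
            also have "\<dots> = walk (sh c) 0 (sdrop h \<omega>) j + (int h, 0)" unfolding walk_translate sh_def ..
            finally have "xwalk c \<omega> k = xwalk (sh c) (sdrop h \<omega>) j + int h" by (simp add: xwalk_def)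
            moreover have "- int h \<le> xwalk (sh c) (sdrop h \<omega>) j" using st by (simp add: St_def)
            ultimately show ?thesis by simp
          qed
          then show ?thesis by (simp add: Stay_def)
        qed
        then show "right h \<omega> * indicator St (xwalk (sh c) (sdrop h \<omega>)) \<le> indicator Stay (xwalk c \<omega>)"
          by (auto simp: right_def split: split_indicator)
      qed
      then show ?thesis using True by (simp add: blue_def)
    qed (simp add: blue_def)
  qed
  also have "\<dots> = (\<integral>\<^sup>+x. indicator Stay x \<partial>\<nu>)"
    by (rule nn_integral_path_law[symmetric]) measurable
  also have "\<dots> = ennreal (measure \<nu> Stay)"
    by (subst nn_integral_indicator) (auto simp: sets_path_law P.emeasure_eq_measure)
  finally have "ennreal ((3/10) ^ h) * (\<integral>\<^sup>+c. blue c * I St (sh c) \<partial>coloring_law p) \<le> ennreal (measure \<nu> Stay)" .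
  moreover have "0 < ennreal ((3/10) ^ h) * (\<integral>\<^sup>+c. blue c * I St (sh c) \<partial>coloring_law p)"
    using pos by (simp add: ennreal_zero_less_mult_iff)
  ultimately have "0 < ennreal (measure \<nu> Stay)" by (rule less_le_trans[rotated])
  then show ?thesis by simp
qed

sublocale path: regenerative_walk \<nu>
proof (intro regenerative_walk.intro regenerative_walk_axioms.intro)
  show "\<exists>c>0. \<exists>n0. \<forall>n\<ge>n0. ennreal (c * real n) \<le> (\<integral>\<^sup>+x. ennreal (real_of_int (x n)) \<partial>\<nu>)"
    using path_growth \<kappa>_bounds(2) by (intro exI[of _ "1/10 - 12/5 * \<kappa>"] conjI exI[of _ 0]) auto
  show "(\<integral>\<^sup>+x. H x * at_level \<phi> m x \<partial>\<nu>) = (\<integral>\<^sup>+x. H x \<partial>\<nu>) * (\<integral>\<^sup>+x. \<phi> x \<partial>\<nu>)"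
    if "H \<in> borel_measurable int_paths" "\<phi> \<in> borel_measurable int_paths" "\<And>x. \<phi> x \<noteq> 0 \<Longrightarrow> x \<in> Stay"
      "\<And>x x' n. first_hit x m n \<Longrightarrow> (\<And>k. k \<le> n \<Longrightarrow> x' k = x k) \<Longrightarrow> H x' = H x" for H \<phi> m
    using that by (rule path_factorization)
qed (fact prob_space_path_law sets_path_law AE_path_start AE_path_step AE_path_hits path_Stay_pos path_returns)+

text \<open>Since \<open>x n / n\<close> is bounded by 1, its expectation converges to the constant
  limit \<open>v\<close>, and \<open>annealed_displacement\<close> bounds these expectations from
  below.\<close>

lemma speed_bound:
  assumes "AE x in \<nu>. (\<lambda>n. real_of_int (x n) / real n) \<longlonglongrightarrow> v"
  shows "1/10 - 12/5 * \<kappa> \<le> v"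
proof -
  have abs1: "AE x in \<nu>. norm (real_of_int (x n) / real n) \<le> 1" for n
    using AE_path_abs
  proof eventually_elim
    case (elim x)
    have "\<bar>real_of_int (x n)\<bar> \<le> real n" using elim[rule_format, of n] by linarith
    then show ?case by (simp add: divide_le_eq)
  qed
  have lim: "(\<lambda>n. path.expectation (\<lambda>x. real_of_int (x n) / real n)) \<longlonglongrightarrow> path.expectation (\<lambda>x. v)"
    by (rule integral_dominated_convergence[where w = "\<lambda>_. 1" and f = "\<lambda>_. v" and s = "\<lambda>n x. real_of_int (x n) / real n"])
       (use assms abs1 in auto)
  have "1/10 - 12/5 * \<kappa> \<le> path.expectation (\<lambda>x. real_of_int (x n) / real n)" if n: "1 \<le> n" for n
  proof -
    have int: "integrable \<nu> (\<lambda>x. real_of_int (x n) / real n)"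
      by (rule path.integrable_const_bound[OF abs1]) measurable
    have int': "integrable \<nu> (\<lambda>x. real_of_int (x n) + real n)"
      using integrable_mult_right[OF int, of "real n"] n by simp
    have nonneg: "AE x in \<nu>. 0 \<le> real_of_int (x n) + real n"
      using AE_path_abs
    proof eventually_elim
      case (elim x)
      show ?case using elim[rule_format, of n] by linarith
    qed
    have "ennreal ((11/10 - 12/5 * \<kappa>) * n) \<le> annealed p n (\<lambda>c x. ennreal (real_of_int (fst x) + real n))"
      by (rule annealed_displacement)
    also have "\<dots> = (\<integral>\<^sup>+x. ennreal (real_of_int (x n) + real n) \<partial>\<nu>)"
      by (rule nn_integral_path_coord[of "\<lambda>k. ennreal (real_of_int k + real n)", symmetric])
    also have "\<dots> = ennreal (path.expectation (\<lambda>x. real_of_int (x n) + real n))"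
      by (rule nn_integral_eq_integral[OF int' nonneg])
    finally have "(11/10 - 12/5 * \<kappa>) * n \<le> path.expectation (\<lambda>x. real_of_int (x n) + real n)"
    proof (subst (asm) ennreal_le_iff)
      show "0 \<le> path.expectation (\<lambda>x. real_of_int (x n) + real n)"
        by (rule integral_nonneg_AE[OF nonneg])
    qed
    also have "path.expectation (\<lambda>x. real_of_int (x n) + real n) = path.expectation (\<lambda>x. real n * (real_of_int (x n) / real n) + real n)"
      using n by simp
    also have "\<dots> = real n * path.expectation (\<lambda>x. real_of_int (x n) / real n) + real n"
    proof -
      have "path.expectation (\<lambda>x. real n * (real_of_int (x n) / real n) + real n) =
          path.expectation (\<lambda>x. real n * (real_of_int (x n) / real n)) + path.expectation (\<lambda>x. real n)"
        by (intro Bochner_Integration.integral_add integrable_mult_right int) simp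
      also have "path.expectation (\<lambda>x. real n * (real_of_int (x n) / real n)) = real n * path.expectation (\<lambda>x. real_of_int (x n) / real n)"
        by (rule integral_mult_right_zero)
      also have "path.expectation (\<lambda>x. real n) = real n" using path.prob_space by simp
      finally show ?thesis .
    qed
    finally have "real n * (1/10 - 12/5 * \<kappa>) \<le> real n * path.expectation (\<lambda>x. real_of_int (x n) / real n)"
      by (simp add: algebra_simps)
    then show ?thesis using n by (subst (asm) mult_le_cancel_left_pos) auto
  qed
  then have "1/10 - 12/5 * \<kappa> \<le> path.expectation (\<lambda>x. v)"
    by (intro LIMSEQ_le_const[OF lim]) auto
  then show ?thesis by (simp add: path.prob_space[unfolded path.space_M])
qed

end

section \<open>Transfer to the annealed law and choice of the density\<close>

lemma AE_annealed_lawI: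
  assumes P: "Measurable.pred (coloring_space \<Otimes>\<^sub>M path_space) P"
    and ae: "AE c in coloring_law p. AE \<omega> in noise b r. P (c, walk c 0 \<omega>)"
  shows "AE z in annealed_law p b r. P z"
proof -
  have kernel: "(\<lambda>c. distr (quenched_law b r c) (coloring_space \<Otimes>\<^sub>M path_space) (Pair c)) \<in>
      measurable (coloring_law p) (subprob_algebra (coloring_space \<Otimes>\<^sub>M path_space))"
    unfolding measurable_coloring_law_iff by (rule measurable_prob_algebraD[OF measurable_annealed_kernel])
  have "AE z in distr (quenched_law b r c) (coloring_space \<Otimes>\<^sub>M path_space) (Pair c). P z"
    if "AE \<omega> in noise b r. P (c, walk c 0 \<omega>)" for c
  proof -
    have Pair: "Pair c \<in> measurable path_space (coloring_space \<Otimes>\<^sub>M path_space)"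
      by (rule measurable_Pair1') (simp add: space_PiM)
    have PairQ: "Pair c \<in> measurable (quenched_law b r c) (coloring_space \<Otimes>\<^sub>M path_space)"
      using Pair by (simp add: measurable_cong_sets[OF sets_quenched_law refl])
    have Pc: "Measurable.pred path_space (\<lambda>X. P (c, X))"
      by (rule measurable_compose[OF Pair P])
    have walk: "walk c 0 \<in> measurable (noise b r) path_space"
      using measurable_walk_path by (simp add: measurable_cong_sets[OF sets_noise refl])
    have "AE X in quenched_law b r c. P (c, X)"
      unfolding distr_walk[symmetric]
      using that Pc by (subst AE_distr_iff[OF walk]) (auto simp: pred_def)
    then show ?thesis
      using P by (subst AE_distr_iff[OF PairQ]) (auto simp: pred_def)
  qed
  then have "AE c in coloring_law p. AE z in distr (quenched_law b r c) (coloring_space \<Otimes>\<^sub>M path_space) (Pair c). P z"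
    using ae by (auto elim: eventually_mono)
  then show ?thesis
    unfolding annealed_law_def by (subst AE_bind[OF kernel P])
qed

text \<open>The limit statement passes from the law of the first coordinate to almost every coloring
  and noise, and from there through \<open>distr_walk\<close> to the original joint law.\<close>

lemma annealed_law_speed:
  assumes "AE x in path_law p b r. (\<lambda>n. real_of_int (x n) / real n) \<longlonglongrightarrow> v"
  shows "AE (c, X) in annealed_law p b r. (\<lambda>n. real_of_int (fst (X n)) / real n) \<longlonglongrightarrow> v"
proof -
  interpret C: prob_space "coloring_law p" by (rule prob_space_coloring_law)
  interpret N: prob_space "noise b r" by (rule prob_space_noise)
  interpret pair_prob_space "coloring_law p" "noise b r" ..
  have lim_meas: "Measurable.pred int_paths (\<lambda>x. (\<lambda>n. real_of_int (x n) / real n) \<longlonglongrightarrow> v)"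
    by measurable
  have m: "(\<lambda>x. xwalk (fst x) (snd x)) \<in> measurable (coloring_law p \<Otimes>\<^sub>M noise b r) int_paths"
    unfolding measurable_joint_iff by (rule measurable_xwalk)
  have "AE x in coloring_law p \<Otimes>\<^sub>M noise b r. (\<lambda>n. real_of_int (xwalk (fst x) (snd x) n) / real n) \<longlonglongrightarrow> v"
    using assms lim_meas unfolding path_law_def by (subst (asm) AE_distr_iff[OF m]) (auto simp: pred_def)
  from AE_pair[OF this]
  have ae: "AE c in coloring_law p. AE \<omega> in noise b r. (\<lambda>n. real_of_int (fst (snd (c, walk c 0 \<omega>) n)) / real n) \<longlonglongrightarrow> v"
    by (simp add: xwalk_def)
  have pred: "Measurable.pred (coloring_space \<Otimes>\<^sub>M path_space) (\<lambda>z. (\<lambda>n. real_of_int (fst (snd z n)) / real n) \<longlonglongrightarrow> v)"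
  proof -
    have [measurable]: "(\<lambda>z. real_of_int (fst (snd z n))) \<in> borel_measurable (coloring_space \<Otimes>\<^sub>M path_space)" for n
      by (rule measurable_compose[OF measurable_compose[OF measurable_snd measurable_component_singleton[of n]]]) auto
    show ?thesis by measurable
  qed
  have "AE z in annealed_law p b r. (\<lambda>n. real_of_int (fst (snd z n)) / real n) \<longlonglongrightarrow> v"
    by (rule AE_annealed_lawI[OF pred ae])
  then show ?thesis by (simp add: case_prod_beta)
qed

theorem theorem2:
  fixes \<delta> :: real and b r :: "nat \<Rightarrow> real"
  assumes "0 \<le> \<delta>" and "\<delta> \<le> 1/2"
    and "b 1 = 0.3" and "b 2 = 1/4" and "b 3 = 0.2" and "b 4 = 1/4"
    and "r 1 = \<delta>" and "r 2 = 1/4" and "r 3 = 1/2 - \<delta>" and "r 4 = 1/4"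
  shows "\<forall>\<epsilon>>0. \<exists>p\<^sub>0\<in>{0<..<1}. \<forall>p\<in>{p\<^sub>0<..<1}.
    \<exists>v::real. (AE (c, X) in annealed_law p b r. (\<lambda>n. real_of_int (fst (X n)) / real n) \<longlonglongrightarrow> v)
      \<and> v \<ge> 0.1 - \<epsilon>"
proof (intro allI impI)
  fix \<epsilon> :: real assume \<epsilon>: "0 < \<epsilon>"
  \<comment> \<open>\<open>1/50\<close> is the bound required by \<open>sparse_red\<close>.
    \<open>\<epsilon> / 5\<close> suffices since \<open>\<kappa> \<le> 2 * \<eta>\<close> makes the
    loss \<open>12/5 * \<kappa>\<close> at most \<open>24/25 * \<epsilon>\<close>.\<close>
  define \<eta> where "\<eta> = min (1/50) (\<epsilon> / 5)"
  have \<eta>: "0 < \<eta>" "\<eta> \<le> 1/50" "\<eta> \<le> \<epsilon> / 5" using \<epsilon> by (auto simp: \<eta>_def)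
  \<comment> \<open>The solution of \<open>108900 * (1 - p) / p = \<eta>\<close>; the left side
    decreases in \<open>p\<close>.\<close>
  define p0 where "p0 = 108900 / (108900 + \<eta>)"
  show "\<exists>p\<^sub>0\<in>{0<..<1}. \<forall>p\<in>{p\<^sub>0<..<1}.
    \<exists>v::real. (AE (c, X) in annealed_law p b r. (\<lambda>n. real_of_int (fst (X n)) / real n) \<longlonglongrightarrow> v) \<and> v \<ge> 0.1 - \<epsilon>"
  proof (intro bexI[of _ p0] ballI)
    show p0: "p0 \<in> {0<..<1}" using \<eta> by (auto simp: p0_def field_simps)
    fix p assume "p \<in> {p0<..<1}"
    then have p: "0 < p" "p < 1" "p0 < p" using p0 by auto
    have "108900 < p * (108900 + \<eta>)" using p(3) \<eta>(1) by (simp add: p0_def divide_less_eq)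
    then have "108900 * (1 - p) \<le> \<eta> * p" by (simp add: algebra_simps)
    then have t: "108900 * (1 - p) / p \<le> \<eta>" using p by (simp add: divide_le_eq)
    have sparse: "108900 * (1 - p) / p \<le> 1/50" using t \<eta> by linarith
    interpret sparse_red \<delta> b r p
      by unfold_locales (rule assms p sparse)+
    obtain v where v: "AE x in \<nu>. (\<lambda>n. real_of_int (x n) / real n) \<longlonglongrightarrow> v"
      using path.law_of_large_numbers by blast
    have "\<kappa> \<le> 2 * \<eta>" using \<kappa>_bounds(3) t by linarith
    then have "0.1 - \<epsilon> \<le> v" using speed_bound[OF v] \<eta>(3) \<epsilon> by simp
    with annealed_law_speed[OF v]
    show "\<exists>v::real. (AE (c, X) in annealed_law p b r. (\<lambda>n. real_of_int (fst (X n)) / real n) \<longlonglongrightarrow> v) \<and> v \<ge> 0.1 - \<epsilon>"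
      by blast
  qed
qed

end
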